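(* Let $X$ be a non-compact proper metric space. Then $X$ is coarsely equivalent to $\mathbb{Z}$ if and only if the following two conditions are satisfied: (i) $X$ is coarsely geodesic and has coarse bounded geometry, and (ii) the Higson corona $\nu X$ is a topological sum of two indecomposable continua, each of which is homeomorphic to $\nu\mathbb{N}$.
   Context: $\mathbb{R}_+=[0,\infty)$. $\mathbb{N}$ (natural numbers) and $\mathbb{Z}$ (integers) carry the metric $d(x,y)=|x-y|$. A metric space $(X,d_X)$ is proper if every closed ball $B(x,r)=\{y\in X : d_X(x,y)\le r\}$ is compact. Coarse equivalence: A (not necessarily continuous) function $f:X\to Y$ between metric spaces is a coarse map if (a) there is a non-decreasing function $\sigma:\mathbb{R}_+\to\mathbb{R}_+$ with $d_Y(f(x),f(x'))\le\sigma(d_X(x,x'))$ for all $x,x'\in X$, and (b) $f^{-1}(B)$ is bounded for every bounded $B\subset Y$. Two maps $f,g:X\to Y$ are close if there is $r>0$ with $d_Y(f(x),g(x))<r$ for all $x\in X$. A coarse map $f:X\to Y$ is a coarse equivalence if there is a coarse map $g:Y\to X$ such that $g\circ f$ is close to $\mathrm{id}_X$ and $f\circ g$ is close to $\mathrm{id}_Y$; then $X$ and $Y$ are called coarsely equivalent. A metric space is coarsely geodesic if it is coarsely equivalent to a geodesic metric space. A subset $A\subset X$ is a net if there is $r>0$ such that for every $x\in X$ there is $a\in A$ with $d_X(x,a)<r$. A metric space $X$ has coarse bounded geometry if there exist a net $A$ of $X$ and a function $\lambda:\mathbb{R}_+\to\mathbb{R}_+$ such that $\#(A\cap B(x,t))\le\lambda(t)$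 for every $x\in X$ and $t>0$. Higson corona: for a proper metric space $X$, let $C_H(X)$ be the set of bounded continuous functions $f:X\to\mathbb{R}$ such that for all $r>0$ and $\varepsilon>0$ there is a compact $K\subset X$ with $\operatorname{diam} f(B(x,r))<\varepsilon$ for all $x\in X\setminus K$. The evaluation map $e:X\to\prod_{f\in C_H(X)}[\inf f,\sup f]$, $(e(x))_f=f(x)$, is a topological embedding; the Higson compactification $X^\nu$ is the closure of $e(X)$ (with $X$ identified with $e(X)$), and the Higson corona is $\nu X=X^\nu\setminus X$. A continuum is a non-empty compact connected Hausdorff space; it is decomposable if it is the union of two of its proper subcontinua (subcontinua not equal to the whole space), and indecomposable otherwise. *)

theory Defs
  imports "HOL-Analysis.Analysis"
begin

section \<open>Coarse geometry\<close>

definition int_metric :: "int metric" where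
  "int_metric = metric (UNIV, \<lambda>m n. \<bar>real_of_int m - real_of_int n\<bar>)"

definition nat_metric :: "nat metric" where
  "nat_metric = metric (UNIV, \<lambda>m n. \<bar>real m - real n\<bar>)"

lemma mspace_int_metric [simp]: "mspace int_metric = UNIV"
  and mdist_int_metric [simp]: "mdist int_metric m n = \<bar>real_of_int m - real_of_int n\<bar>"
proof -
  interpret Metric_space UNIV "\<lambda>m n. \<bar>real_of_int m - real_of_int n\<bar>"
    by unfold_locales auto
  show "mspace int_metric = UNIV"
    and "mdist int_metric m n = \<bar>real_of_int m - real_of_int n\<bar>"
    by (simp_all add: int_metric_def)
qed

lemma mspace_nat_metric [simp]: "mspace nat_metric = UNIV"
  and mdist_nat_metric [simp]: "mdist nat_metric m n = \<bar>real m - real n\<bar>"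
proof -
  interpret Metric_space UNIV "\<lambda>m n. \<bar>real m - real n\<bar>"
    by unfold_locales auto
  show "mspace nat_metric = UNIV" and "mdist nat_metric m n = \<bar>real m - real n\<bar>"
    by (simp_all add: nat_metric_def)
qed

definition proper_metric :: "'a metric \<Rightarrow> bool" where
  "proper_metric X \<longleftrightarrow> (\<forall>x\<in>mspace X. \<forall>r. compactin (mtopology_of X) (mcball_of X x r))"

definition bounded_subset :: "'a metric \<Rightarrow> 'a set \<Rightarrow> bool" where
  "bounded_subset X = Metric_space.mbounded (mspace X) (mdist X)"

definition coarse_map :: "'a metric \<Rightarrow> 'b metric \<Rightarrow> ('a \<Rightarrow> 'b) \<Rightarrow> bool" where
  "coarse_map X Y f \<longleftrightarrow>
     f \<in> mspace X \<rightarrow> mspace Y \<and>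
     (\<exists>\<sigma>::real \<Rightarrow> real. \<sigma> \<in> {0..} \<rightarrow> {0..} \<and> mono_on {0..} \<sigma> \<and>
        (\<forall>x\<in>mspace X. \<forall>x'\<in>mspace X. mdist Y (f x) (f x') \<le> \<sigma> (mdist X x x'))) \<and>
     (\<forall>B. bounded_subset Y B \<longrightarrow> bounded_subset X {x \<in> mspace X. f x \<in> B})"

definition close_maps :: "'a metric \<Rightarrow> 'b metric \<Rightarrow> ('a \<Rightarrow> 'b) \<Rightarrow> ('a \<Rightarrow> 'b) \<Rightarrow> bool" where
  "close_maps X Y f g \<longleftrightarrow> (\<exists>r>0. \<forall>x\<in>mspace X. mdist Y (f x) (g x) < r)"

definition coarse_equivalence :: "'a metric \<Rightarrow> 'b metric \<Rightarrow> ('a \<Rightarrow> 'b) \<Rightarrow> bool" where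
  "coarse_equivalence X Y f \<longleftrightarrow>
     coarse_map X Y f \<and>
     (\<exists>g. coarse_map Y X g \<and> close_maps X X (g \<circ> f) id \<and> close_maps Y Y (f \<circ> g) id)"

definition coarsely_equivalent :: "'a metric \<Rightarrow> 'b metric \<Rightarrow> bool" where
  "coarsely_equivalent X Y \<longleftrightarrow> (\<exists>f. coarse_equivalence X Y f)"

definition geodesic_metric :: "'a metric \<Rightarrow> bool" where
  "geodesic_metric X \<longleftrightarrow>
     (\<forall>x\<in>mspace X. \<forall>y\<in>mspace X.
        \<exists>\<gamma> \<in> {0..mdist X x y} \<rightarrow> mspace X.
          \<gamma> 0 = x \<and> \<gamma> (mdist X x y) = y \<and>
          (\<forall>s\<in>{0..mdist X x y}. \<forall>t\<in>{0..mdist X x y}. mdist X (\<gamma> s) (\<gamma> t) = \<bar>s - t\<bar>))"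

text \<open>HOL cannot quantify existentially over the carrier type of the geodesic space. The type
  \<^typ>\<open>'a \<times> real\<close> is always large enough: the theorem \<open>coarsely_geodesicI\<close> below shows that a
  space that is coarsely equivalent to a geodesic metric space over any type whatsoever is
  coarsely geodesic in the sense of this definition.\<close>
definition coarsely_geodesic :: "'a metric \<Rightarrow> bool" where
  "coarsely_geodesic X \<longleftrightarrow>
     (\<exists>Y :: ('a \<times> real) metric. geodesic_metric Y \<and> coarsely_equivalent X Y)"

definition metric_net :: "'a metric \<Rightarrow> 'a set \<Rightarrow> bool" where
  "metric_net X A \<longleftrightarrow> A \<subseteq> mspace X \<and> (\<exists>r>0. \<forall>x\<in>mspace X. \<exists>a\<in>A. mdist X x a < r)"

definition coarse_bounded_geometry :: "'a metric \<Rightarrow> bool" where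
  "coarse_bounded_geometry X \<longleftrightarrow>
     (\<exists>A. \<exists>N::real \<Rightarrow> real. metric_net X A \<and> N \<in> {0..} \<rightarrow> {0..} \<and>
        (\<forall>x\<in>mspace X. \<forall>t>0.
           finite (A \<inter> mcball_of X x t) \<and> real (card (A \<inter> mcball_of X x t)) \<le> N t))"


section \<open>The Higson corona\<close>

text \<open>Restricting to extensional functions picks one HOL function for each function on the
  carrier of \<open>X\<close>.\<close>
definition higson_functions :: "'a metric \<Rightarrow> ('a \<Rightarrow> real) set" where
  "higson_functions X =
     {f \<in> extensional (mspace X).
        bounded (f ` mspace X) \<and>
        continuous_map (mtopology_of X) euclideanreal f \<and>
        (\<forall>r>0. \<forall>\<epsilon>>0. \<exists>K. compactin (mtopology_of X) K \<and>
           (\<forall>x \<in> mspace X - K. diameter (f ` mcball_of X x r) < \<epsilon>))}"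

definition higson_cube :: "'a metric \<Rightarrow> (('a \<Rightarrow> real) \<Rightarrow> real) topology" where
  "higson_cube X =
     product_topology (\<lambda>f. top_of_set {(INF x\<in>mspace X. f x)..(SUP x\<in>mspace X. f x)})
       (higson_functions X)"

definition higson_evaluation :: "'a metric \<Rightarrow> 'a \<Rightarrow> ('a \<Rightarrow> real) \<Rightarrow> real" where
  "higson_evaluation X x = (\<lambda>f\<in>higson_functions X. f x)"

definition higson_compactification :: "'a metric \<Rightarrow> (('a \<Rightarrow> real) \<Rightarrow> real) topology" where
  "higson_compactification X =
     subtopology (higson_cube X) (higson_cube X closure_of (higson_evaluation X ` mspace X))"

definition higson_corona :: "'a metric \<Rightarrow> (('a \<Rightarrow> real) \<Rightarrow> real) topology" where
  "higson_corona X =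
     subtopology (higson_compactification X)
       (topspace (higson_compactification X) - higson_evaluation X ` mspace X)"


section \<open>Continua\<close>

definition continuum_space :: "'a topology \<Rightarrow> bool" where
  "continuum_space T \<longleftrightarrow>
     topspace T \<noteq> {} \<and> compact_space T \<and> connected_space T \<and> Hausdorff_space T"

definition decomposable_space :: "'a topology \<Rightarrow> bool" where
  "decomposable_space T \<longleftrightarrow>
     (\<exists>A B. A \<subset> topspace T \<and> B \<subset> topspace T \<and>
        continuum_space (subtopology T A) \<and> continuum_space (subtopology T B) \<and>
        A \<union> B = topspace T)"

definition indecomposable_continuum :: "'a topology \<Rightarrow> bool" where
  "indecomposable_continuum T \<longleftrightarrow> continuum_space T \<and> \<not> decomposable_space T"


section \<open>Independence of the carrier type\<close>

lemma geodesic_hull_exists: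
  includes cardinal_syntax
  fixes Y :: "'b metric" and f :: "'a \<Rightarrow> 'b"
  assumes geo: "geodesic_metric Y" and A: "f ` M \<subseteq> mspace Y"
  obtains S and h :: "'b \<Rightarrow> 'a \<times> real"
  where "f ` M \<subseteq> S" "S \<subseteq> mspace Y" "geodesic_metric (submetric Y S)" "inj_on h S"
proof -
  have "\<forall>x y. \<exists>\<gamma>. x \<in> mspace Y \<longrightarrow> y \<in> mspace Y \<longrightarrow>
      \<gamma> \<in> {0..mdist Y x y} \<rightarrow> mspace Y \<and> \<gamma> 0 = x \<and> \<gamma> (mdist Y x y) = y \<and>
      (\<forall>s\<in>{0..mdist Y x y}. \<forall>t\<in>{0..mdist Y x y}. mdist Y (\<gamma> s) (\<gamma> t) = \<bar>s - t\<bar>)"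
    using geo unfolding geodesic_metric_def by blast
  then obtain c where c: "\<And>x y. x \<in> mspace Y \<Longrightarrow> y \<in> mspace Y \<Longrightarrow>
      c x y \<in> {0..mdist Y x y} \<rightarrow> mspace Y \<and> c x y 0 = x \<and> c x y (mdist Y x y) = y \<and>
      (\<forall>s\<in>{0..mdist Y x y}. \<forall>t\<in>{0..mdist Y x y}. mdist Y (c x y s) (c x y t) = \<bar>s - t\<bar>)"
    by metis
  define step where
    "step = (\<lambda>S. (\<lambda>(x, y, t). c x y t) ` {(x, y, t). x \<in> S \<and> y \<in> S \<and> t \<in> {0..mdist Y x y}})"
  define G where "G = (\<lambda>n. (step ^^ n) (f ` M))"
  define S where "S = (\<Union>n. G n)"
  have G_Suc: "G (Suc n) = step (G n)" for n by (simp add: G_def)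
  have G_sub: "G n \<subseteq> mspace Y" for n
  proof (induction n)
    case 0 then show ?case using A by (simp add: G_def)
  next
    case (Suc n)
    then show ?case using c unfolding G_Suc step_def by fastforce
  qed
  have G_mono1: "G n \<subseteq> G (Suc n)" for n
  proof
    fix x assume x: "x \<in> G n"
    then have "x = c x x 0" using c G_sub by (metis subsetD)
    moreover have "0 \<in> {0..mdist Y x x}" by simp
    ultimately show "x \<in> G (Suc n)" using x unfolding G_Suc step_def by force
  qed
  have G_mono: "m \<le> n \<Longrightarrow> G m \<subseteq> G n" for m n
    using G_mono1 by (rule lift_Suc_mono_le)
  have inf: "infinite (UNIV :: ('a \<times> real) set)"
    using infinite_UNIV_char_0[where 'a = real] by (simp add: finite_prod)
  have real_le: "|UNIV :: real set| \<le>o |UNIV :: ('a \<times> real) set|"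
    by (rule card_of_ordLeqI[where f = "\<lambda>t. (undefined, t)"]) (auto simp: inj_on_def)
  have G_card: "|G n| \<le>o |UNIV :: ('a \<times> real) set|" for n
  proof (induction n)
    case 0
    have "|f ` M| \<le>o |UNIV :: ('a \<times> real) set|"
      by (rule surj_imp_ordLeq[where f = "\<lambda>(x, t). f x"]) force
    then show ?case by (simp add: G_def)
  next
    case (Suc n)
    have "|G n \<times> (G n \<times> (UNIV :: real set))| \<le>o |UNIV :: ('a \<times> real) set|"
      by (intro card_of_Times_ordLeq_infinite_Field Suc real_le card_of_Card_order)
         (simp_all add: inf Field_card_of)
    moreover have "|G (Suc n)| \<le>o |G n \<times> (G n \<times> (UNIV :: real set))|"
      by (rule surj_imp_ordLeq[where f = "\<lambda>(x, y, t). c x y t"])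
         (auto simp: G_Suc step_def image_iff split: prod.splits, force)
    ultimately show ?case using ordLeq_transitive by blast
  qed
  have nat_le: "|UNIV :: nat set| \<le>o |UNIV :: ('a \<times> real) set|"
    using inf infinite_iff_card_of_nat by blast
  have S_card: "|S| \<le>o |UNIV :: ('a \<times> real) set|"
    unfolding S_def using card_of_UNION_ordLeq_infinite[OF inf nat_le] G_card by blast
  have S_sub: "S \<subseteq> mspace Y" using G_sub by (auto simp: S_def)
  have S_closed: "c x y t \<in> S" if xyt: "x \<in> S" "y \<in> S" "t \<in> {0..mdist Y x y}" for x y t
  proof -
    obtain m n where "x \<in> G m" "y \<in> G n" using xyt by (auto simp: S_def)
    then have "x \<in> G (max m n)" "y \<in> G (max m n)"
      using G_mono[of m "max m n"] G_mono[of n "max m n"] by auto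
    then have "c x y t \<in> G (Suc (max m n))" using xyt(3) unfolding G_Suc step_def by force
    then show ?thesis by (auto simp: S_def)
  qed
  have "geodesic_metric (submetric Y S)"
    unfolding geodesic_metric_def
  proof (intro ballI)
    fix x y assume "x \<in> mspace (submetric Y S)" "y \<in> mspace (submetric Y S)"
    then have "x \<in> S" "y \<in> S" "x \<in> mspace Y" "y \<in> mspace Y" by auto
    then show "\<exists>\<gamma>\<in>{0..mdist (submetric Y S) x y} \<rightarrow> mspace (submetric Y S).
          \<gamma> 0 = x \<and> \<gamma> (mdist (submetric Y S) x y) = y \<and>
          (\<forall>s\<in>{0..mdist (submetric Y S) x y}. \<forall>t\<in>{0..mdist (submetric Y S) x y}.
             mdist (submetric Y S) (\<gamma> s) (\<gamma> t) = \<bar>s - t\<bar>)"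
      using c[of x y] S_closed[of x y] S_sub by (intro bexI[of _ "c x y"]) auto
  qed
  moreover have "f ` M \<subseteq> S" using UN_upper[of 0 UNIV G] by (simp add: S_def G_def)
  moreover obtain h :: "'b \<Rightarrow> 'a \<times> real" where "inj_on h S"
    using iffD2[OF card_of_ordLeq S_card] by auto
  ultimately show ?thesis by (intro that[of S h] S_sub)
qed

lemma bounded_subset_iff:
  "bounded_subset X B \<longleftrightarrow> B \<subseteq> mspace X \<and> (\<exists>r. \<forall>x\<in>B. \<forall>y\<in>B. mdist X x y \<le> r)"
  unfolding bounded_subset_def by (rule Metric_space.mbounded_alt[OF Metric_space_mspace_mdist])

theorem coarsely_geodesicI:
  fixes X :: "'a metric" and Y :: "'b metric"
  assumes geo: "geodesic_metric Y" and eq: "coarsely_equivalent X Y"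
  shows "coarsely_geodesic X"
proof -
  obtain f g where f: "coarse_map X Y f" and g: "coarse_map Y X g"
    and gf: "close_maps X X (g \<circ> f) id" and fg: "close_maps Y Y (f \<circ> g) id"
    using eq unfolding coarsely_equivalent_def coarse_equivalence_def by blast
  have fY: "f \<in> mspace X \<rightarrow> mspace Y" and gX: "g \<in> mspace Y \<rightarrow> mspace X"
    using f g by (auto simp: coarse_map_def)
  then have "f ` mspace X \<subseteq> mspace Y" by auto
  then obtain S and h :: "'b \<Rightarrow> 'a \<times> real" where fS: "f ` mspace X \<subseteq> S" and SY: "S \<subseteq> mspace Y"
    and geoS: "geodesic_metric (submetric Y S)" and h: "inj_on h S"
    by (rule geodesic_hull_exists[OF geo])
  define k where "k = inv_into S h"
  have kh: "k (h y) = y" if "y \<in> S" for y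
    using h that by (simp add: k_def)
  define Z where "Z = metric (h ` S, \<lambda>u v. mdist Y (k u) (k v))"
  have MZ: "Metric_space (h ` S) (\<lambda>u v. mdist Y (k u) (k v))"
  proof
    fix u v assume uv: "u \<in> h ` S" "v \<in> h ` S"
    then have "k u \<in> mspace Y" "k v \<in> mspace Y" using SY by (auto simp: kh)
    moreover have "k u = k v \<longleftrightarrow> u = v" using uv kh by auto
    ultimately show "mdist Y (k u) (k v) = 0 \<longleftrightarrow> u = v" by simp
  next
    fix u v w assume "u \<in> h ` S" "v \<in> h ` S" "w \<in> h ` S"
    then show "mdist Y (k u) (k w) \<le> mdist Y (k u) (k v) + mdist Y (k v) (k w)"
      using SY by (intro mdist_triangle) (auto simp: kh)
  qed (auto simp: mdist_commute)
  have spZ: "mspace Z = h ` S" and dZ: "mdist Z = (\<lambda>u v. mdist Y (k u) (k v))"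
    unfolding Z_def using Metric_space.mspace_metric[OF MZ] Metric_space.mdist_metric[OF MZ] by auto
  have geoZ: "geodesic_metric Z"
    unfolding geodesic_metric_def
  proof (intro ballI)
    fix u v assume "u \<in> mspace Z" "v \<in> mspace Z"
    then obtain x y where xy: "x \<in> S" "y \<in> S" "u = h x" "v = h y" by (auto simp: spZ)
    then have d: "mdist Z u v = mdist Y x y" by (simp add: dZ kh)
    have "x \<in> mspace (submetric Y S)" "y \<in> mspace (submetric Y S)" using xy SY by auto
    then have "\<exists>\<gamma> \<in> {0..mdist Y x y} \<rightarrow> mspace Y \<inter> S. \<gamma> 0 = x \<and> \<gamma> (mdist Y x y) = y \<and>
        (\<forall>s\<in>{0..mdist Y x y}. \<forall>t\<in>{0..mdist Y x y}. mdist Y (\<gamma> s) (\<gamma> t) = \<bar>s - t\<bar>)"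
      using geoS unfolding geodesic_metric_def by (metis Int_commute mdist_submetric mspace_submetric)
    then obtain \<gamma> where \<gamma>: "\<gamma> \<in> {0..mdist Y x y} \<rightarrow> S" "\<gamma> 0 = x" "\<gamma> (mdist Y x y) = y"
      "\<forall>s\<in>{0..mdist Y x y}. \<forall>t\<in>{0..mdist Y x y}. mdist Y (\<gamma> s) (\<gamma> t) = \<bar>s - t\<bar>"
      by blast
    show "\<exists>\<gamma>\<in>{0..mdist Z u v} \<rightarrow> mspace Z. \<gamma> 0 = u \<and> \<gamma> (mdist Z u v) = v \<and>
        (\<forall>s\<in>{0..mdist Z u v}. \<forall>t\<in>{0..mdist Z u v}. mdist Z (\<gamma> s) (\<gamma> t) = \<bar>s - t\<bar>)"
      unfolding d using \<gamma> xy by (intro bexI[of _ "h \<circ> \<gamma>"]) (auto simp: spZ dZ kh Pi_iff)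
  qed
  have kY: "k u \<in> S" "k u \<in> mspace Y" if "u \<in> h ` S" for u using that SY by (auto simp: kh)
  have hf: "coarse_map X Z (h \<circ> f)"
    unfolding coarse_map_def
  proof (intro conjI allI impI)
    show "h \<circ> f \<in> mspace X \<rightarrow> mspace Z" using fS by (auto simp: spZ)
    obtain \<sigma> where "\<sigma> \<in> {0::real..} \<rightarrow> {0::real..}" "mono_on {0..} \<sigma>"
      "\<forall>x\<in>mspace X. \<forall>x'\<in>mspace X. mdist Y (f x) (f x') \<le> \<sigma> (mdist X x x')"
      using f unfolding coarse_map_def by blast
    then show "\<exists>\<sigma>::real \<Rightarrow> real. \<sigma> \<in> {0..} \<rightarrow> {0..} \<and> mono_on {0..} \<sigma> \<and>
        (\<forall>x\<in>mspace X. \<forall>x'\<in>mspace X. mdist Z ((h \<circ> f) x) ((h \<circ> f) x') \<le> \<sigma> (mdist X x x'))"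
      using fS by (intro exI[of _ \<sigma>]) (auto simp: dZ kh image_subset_iff)
  next
    fix B assume "bounded_subset Z B"
    then obtain r where B: "B \<subseteq> h ` S" "\<And>u v. u \<in> B \<Longrightarrow> v \<in> B \<Longrightarrow> mdist Y (k u) (k v) \<le> r"
      unfolding bounded_subset_iff spZ dZ by blast
    have "bounded_subset Y (k ` B)"
      unfolding bounded_subset_iff
    proof (intro conjI exI[of _ r] ballI)
      show "k ` B \<subseteq> mspace Y" using B(1) kY by blast
    qed (use B(2) in blast)
    then have b: "bounded_subset X {x \<in> mspace X. f x \<in> k ` B}" using f unfolding coarse_map_def by blast
    have "{x \<in> mspace X. (h \<circ> f) x \<in> B} \<subseteq> {x \<in> mspace X. f x \<in> k ` B}"
      using fS kh by (force simp: image_subset_iff)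
    with b show "bounded_subset X {x \<in> mspace X. (h \<circ> f) x \<in> B}"
      unfolding bounded_subset_iff by blast
  qed
  have gk: "coarse_map Z X (g \<circ> k)"
    unfolding coarse_map_def
  proof (intro conjI allI impI)
    show "g \<circ> k \<in> mspace Z \<rightarrow> mspace X" using gX SY by (auto simp: spZ kh)
    obtain \<sigma> where "\<sigma> \<in> {0::real..} \<rightarrow> {0::real..}" "mono_on {0..} \<sigma>"
      "\<forall>x\<in>mspace Y. \<forall>x'\<in>mspace Y. mdist X (g x) (g x') \<le> \<sigma> (mdist Y x x')"
      using g unfolding coarse_map_def by blast
    then show "\<exists>\<sigma>::real \<Rightarrow> real. \<sigma> \<in> {0..} \<rightarrow> {0..} \<and> mono_on {0..} \<sigma> \<and>
        (\<forall>x\<in>mspace Z. \<forall>x'\<in>mspace Z. mdist X ((g \<circ> k) x) ((g \<circ> k) x') \<le> \<sigma> (mdist Z x x'))"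
      using kY by (intro exI[of _ \<sigma>]) (simp add: dZ spZ)
  next
    fix B assume "bounded_subset X B"
    then have "bounded_subset Y {y \<in> mspace Y. g y \<in> B}" using g unfolding coarse_map_def by blast
    then have "\<exists>r. \<forall>y\<in>mspace Y. \<forall>y'\<in>mspace Y. g y \<in> B \<longrightarrow> g y' \<in> B \<longrightarrow> mdist Y y y' \<le> r"
      unfolding bounded_subset_iff by auto
    then have "\<exists>r. \<forall>y\<in>h ` S. \<forall>y'\<in>h ` S. g (k y) \<in> B \<longrightarrow> g (k y') \<in> B \<longrightarrow> mdist Z y y' \<le> r"
      unfolding dZ using kY by blast
    then show "bounded_subset Z {x \<in> mspace Z. (g \<circ> k) x \<in> B}"
      unfolding bounded_subset_iff spZ mem_Collect_eq comp_apply by blast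
  qed
  have "close_maps X X ((g \<circ> k) \<circ> (h \<circ> f)) id"
    using gf fS by (auto simp: close_maps_def kh image_subset_iff)
  moreover have "close_maps Z Z ((h \<circ> f) \<circ> (g \<circ> k)) id"
  proof -
    obtain r where r: "r > 0" "\<forall>y\<in>mspace Y. mdist Y (f (g y)) y < r"
      using fg by (auto simp: close_maps_def)
    have "mdist Z (h (f (g (k u)))) u < r" if u: "u \<in> h ` S" for u
    proof -
      have "g (k u) \<in> mspace X" using kY[OF u] gX by auto
      then have "f (g (k u)) \<in> S" using fS by auto
      then show ?thesis using r kY[OF u] by (simp add: dZ kh)
    qed
    then show ?thesis using r(1) unfolding close_maps_def spZ comp_apply id_apply by blast
  qed
  ultimately have "coarsely_equivalent X Z"
    using hf gk unfolding coarsely_equivalent_def coarse_equivalence_def by blast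
  then show ?thesis using geoZ unfolding coarsely_geodesic_def by blast
qed

end

theory Submission
  imports Defs
begin

text \<open>The corona only sees slowly oscillating functions modulo functions tending to 0 at infinity: continuity can
  be restored by an inf-convolution. Hence coarse maps act on coronas, coarse equivalences act by homeomorphisms,
  and the corona of \<open>\<int>\<close> is the sum of two copies of that of \<open>\<nat>\<close>, an indecomposable
  continuum.

  Conversely, a coarsely geodesic space of coarse bounded geometry is coarsely equivalent to a locally finite
  connected graph. The two clopen parts of its corona correspond to two ends of the graph, and Koenig's lemma
  yields a geodesic ray in each of them. If a ray missed points of its end by arbitrarily large distances, a tube
  around it with slowly growing radius would trace out a proper subcontinuum with interior points, and a continuum
  with such a subcontinuum is decomposable. So the two rays are coarsely dense, and together they form a coarse
  copy of \<open>\<int>\<close>.\<close>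

section \<open>Coarse maps\<close>

text \<open>Two obstacles shape the proof. Coarse maps are not continuous, so pulling back a Higson
  function leaves the class; hence almost everything is stated for arbitrary slowly oscillating
  functions. And a point of the corona is a function on a huge family; hence it is traded for a
  filter on \<open>X\<close>, and topological claims become claims about what happens eventually or
  frequently far out. The bridge in both directions is one remark: a function that varies by less
  than 1/3 over each bounded step cannot jump from below 1/3 to above 2/3. It turns chains in
  \<open>X\<close> into connectedness of the corona, and a clopen splitting of the corona into a
  splitting of \<open>X\<close> far out. The tube has to meet competing demands: its radius must be
  unbounded, so that its trace contains an open set around the limit points of the ray, yet only a
  fraction of the distance to the missed points, so that these accumulate elsewhere, and only a
  fraction of the distance to the base point, so that its far part stays connected. Two rays glue to
  a copy of the integers because a path between the two ends has to pass close to the base point;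
  this leaves an additive error only.\<close>

definition bornologous :: "'a metric \<Rightarrow> 'b metric \<Rightarrow> ('a \<Rightarrow> 'b) \<Rightarrow> bool" where
  "bornologous X Y f \<longleftrightarrow> f \<in> mspace X \<rightarrow> mspace Y \<and>
     (\<forall>r. \<exists>s. \<forall>x\<in>mspace X. \<forall>x'\<in>mspace X. mdist X x x' \<le> r \<longrightarrow> mdist Y (f x) (f x') \<le> s)"

text \<open>The lower control is uniform over pairs of points, whereas a coarse map only pulls
  bounded sets back to bounded sets. Together with \<open>coarsely_onto\<close> it characterises
  coarse equivalences without naming an inverse.\<close>

definition coarse_embedding :: "'a metric \<Rightarrow> 'b metric \<Rightarrow> ('a \<Rightarrow> 'b) \<Rightarrow> bool" where
  "coarse_embedding X Y f \<longleftrightarrow> bornologous X Y f \<and>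
     (\<forall>s. \<exists>r. \<forall>x\<in>mspace X. \<forall>x'\<in>mspace X. mdist Y (f x) (f x') \<le> s \<longrightarrow> mdist X x x' \<le> r)"

definition coarsely_onto :: "'a metric \<Rightarrow> 'b metric \<Rightarrow> ('a \<Rightarrow> 'b) \<Rightarrow> bool" where
  "coarsely_onto X Y f \<longleftrightarrow> (\<exists>c. \<forall>y\<in>mspace Y. \<exists>x\<in>mspace X. mdist Y (f x) y \<le> c)"

lemma bornologousD:
  assumes "bornologous X Y f"
  obtains s where "\<And>x x'. x \<in> mspace X \<Longrightarrow> x' \<in> mspace X \<Longrightarrow> mdist X x x' \<le> r \<Longrightarrow> mdist Y (f x) (f x') \<le> s"
  using assms unfolding bornologous_def by meson

lemma bornologous_comp:
  assumes "bornologous X Y f" "bornologous Y Z g"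
  shows "bornologous X Z (g \<circ> f)"
  unfolding bornologous_def
proof (intro conjI allI)
  show "g \<circ> f \<in> mspace X \<rightarrow> mspace Z" using assms by (auto simp: bornologous_def)
  fix r
  obtain s where s: "\<And>x x'. x \<in> mspace X \<Longrightarrow> x' \<in> mspace X \<Longrightarrow> mdist X x x' \<le> r \<Longrightarrow> mdist Y (f x) (f x') \<le> s"
    using bornologousD[OF assms(1)] by metis
  obtain t where t: "\<And>x x'. x \<in> mspace Y \<Longrightarrow> x' \<in> mspace Y \<Longrightarrow> mdist Y x x' \<le> s \<Longrightarrow> mdist Z (g x) (g x') \<le> t"
    using bornologousD[OF assms(2)] by metis
  have "f x \<in> mspace Y" if "x \<in> mspace X" for x using assms(1) that by (auto simp: bornologous_def)
  then show "\<exists>s. \<forall>x\<in>mspace X. \<forall>x'\<in>mspace X. mdist X x x' \<le> r \<longrightarrow> mdist Z ((g \<circ> f) x) ((g \<circ> f) x') \<le> s"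
    using s t by (metis comp_apply)
qed

lemma coarse_map_iff:
  "coarse_map X Y f \<longleftrightarrow> bornologous X Y f \<and>
     (\<forall>B. bounded_subset Y B \<longrightarrow> bounded_subset X {x \<in> mspace X. f x \<in> B})"
proof -
  have "(\<forall>r. \<exists>s. \<forall>x\<in>mspace X. \<forall>x'\<in>mspace X. mdist X x x' \<le> r \<longrightarrow> mdist Y (f x) (f x') \<le> s) \<longleftrightarrow>
    (\<exists>\<sigma>::real \<Rightarrow> real. \<sigma> \<in> {0..} \<rightarrow> {0..} \<and> mono_on {0..} \<sigma> \<and>
        (\<forall>x\<in>mspace X. \<forall>x'\<in>mspace X. mdist Y (f x) (f x') \<le> \<sigma> (mdist X x x')))" (is "?L \<longleftrightarrow> ?R")
  proof
    assume ?R
    then obtain \<sigma> :: "real \<Rightarrow> real" where \<sigma>: "mono_on {0..} \<sigma>"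
        "\<forall>x\<in>mspace X. \<forall>x'\<in>mspace X. mdist Y (f x) (f x') \<le> \<sigma> (mdist X x x')" by blast
    show ?L
    proof (intro allI exI ballI impI)
      fix r x x' assume x: "x \<in> mspace X" "x' \<in> mspace X" "mdist X x x' \<le> r"
      then have "\<sigma> (mdist X x x') \<le> \<sigma> r"
        by (intro mono_onD[OF \<sigma>(1)]) (auto intro: order_trans[OF mdist_nonneg])
      then show "mdist Y (f x) (f x') \<le> \<sigma> r" using \<sigma>(2) x by force
    qed
  next
    assume ?L
    then obtain s where s: "\<And>r x x'. x \<in> mspace X \<Longrightarrow> x' \<in> mspace X \<Longrightarrow> mdist X x x' \<le> r \<Longrightarrow>
      mdist Y (f x) (f x') \<le> s r" by metis
    \<comment> \<open>The least control function is the supremum of the distances that occur. The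
      extra 0 keeps the set non-empty and the supremum non-negative when there are no pairs at
      distance at most \<open>t\<close>.\<close>
    define D where "D = (\<lambda>t. insert 0 {mdist Y (f x) (f x') |x x'. x \<in> mspace X \<and> x' \<in> mspace X \<and> mdist X x x' \<le> t})"
    have bdd: "bdd_above (D t)" for t
      unfolding D_def bdd_above_insert using s[of _ _ t] by (intro bdd_aboveI[of _ "s t"]) auto
    have "(\<lambda>t. Sup (D t)) \<in> {0..} \<rightarrow> {0..}"
      using bdd by (auto simp: D_def intro!: cSup_upper)
    moreover have "mono_on {0..} (\<lambda>t. Sup (D t))"
    proof (rule mono_onI)
      fix r t :: real assume "r \<le> t"
      then have "D r \<subseteq> D t" by (auto simp: D_def; force)
      then show "Sup (D r) \<le> Sup (D t)" using bdd by (intro cSup_subset_mono) (auto simp: D_def)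
    qed
    moreover have "mdist Y (f x) (f x') \<le> Sup (D (mdist X x x'))" if "x \<in> mspace X" "x' \<in> mspace X" for x x'
      using bdd that by (intro cSup_upper) (auto simp: D_def)
    ultimately show ?R by blast
  qed
  then show ?thesis unfolding coarse_map_def bornologous_def by blast
qed

lemma bounded_subset_iff_center:
  assumes "a \<in> mspace X"
  shows "bounded_subset X B \<longleftrightarrow> B \<subseteq> mspace X \<and> (\<exists>r. \<forall>x\<in>B. mdist X a x \<le> r)"
proof -
  have "\<exists>r. \<forall>x\<in>B. \<forall>y\<in>B. mdist X x y \<le> r" if "B \<subseteq> mspace X" "\<forall>x\<in>B. mdist X a x \<le> r" for r
  proof (intro exI ballI)
    fix x y assume "x \<in> B" "y \<in> B"
    then show "mdist X x y \<le> 2 * r"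
      using that mdist_triangle[of x X a y] assms mdist_commute[of X x a] by (smt (verit) subsetD)
  qed
  moreover have "\<exists>r. \<forall>x\<in>B. mdist X a x \<le> r" if B: "B \<subseteq> mspace X" "\<forall>x\<in>B. \<forall>y\<in>B. mdist X x y \<le> r" for r
  proof (cases "B = {}")
    case False
    then obtain b where b: "b \<in> B" by blast
    have "mdist X a x \<le> mdist X a b + r" if "x \<in> B" for x
      using B b that mdist_triangle[of a X b x] assms by force
    then show ?thesis by blast
  qed auto
  ultimately show ?thesis unfolding bounded_subset_iff by blast
qed

lemma coarse_embedding_imp_coarse_map:
  assumes "coarse_embedding X Y f"
  shows "coarse_map X Y f"
  using assms unfolding coarse_map_iff coarse_embedding_def bounded_subset_iff mem_Collect_eq by blast

lemma coarse_embedding_comp: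
  assumes f: "coarse_embedding X Y f" and g: "coarse_embedding Y Z g"
  shows "coarse_embedding X Z (g \<circ> f)"
proof -
  have "f x \<in> mspace Y" if "x \<in> mspace X" for x
    using f that by (auto simp: bornologous_def coarse_embedding_def)
  then have "\<exists>r. \<forall>x\<in>mspace X. \<forall>x'\<in>mspace X. mdist Z (g (f x)) (g (f x')) \<le> s \<longrightarrow> mdist X x x' \<le> r" for s
    using f g unfolding coarse_embedding_def by meson
  then show ?thesis using f g bornologous_comp unfolding coarse_embedding_def comp_apply by blast
qed

lemma coarse_equivalence_imp:
  assumes "coarse_equivalence X Y f"
  shows "coarse_embedding X Y f" "coarsely_onto X Y f"
proof -
  obtain g where f: "coarse_map X Y f" and g: "coarse_map Y X g"
    and gf: "close_maps X X (g \<circ> f) id" and fg: "close_maps Y Y (f \<circ> g) id"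
    using assms unfolding coarse_equivalence_def by blast
  have fY: "f x \<in> mspace Y" if "x \<in> mspace X" for x using that f by (auto simp: coarse_map_def)
  have gX: "g x \<in> mspace X" if "x \<in> mspace Y" for x using that g by (auto simp: coarse_map_def)
  obtain c where c: "\<And>x. x \<in> mspace X \<Longrightarrow> mdist X (g (f x)) x < c" using gf by (auto simp: close_maps_def)
  show "coarsely_onto X Y f"
    using fg gX unfolding coarsely_onto_def close_maps_def by (metis comp_apply id_apply less_imp_le)
  show "coarse_embedding X Y f"
    unfolding coarse_embedding_def
  proof (intro conjI allI)
    show "bornologous X Y f" using f by (simp add: coarse_map_iff)
    fix s
    have "bornologous Y X g" using g by (simp add: coarse_map_iff)
    then obtain r where r: "\<And>y y'. y \<in> mspace Y \<Longrightarrow> y' \<in> mspace Y \<Longrightarrow> mdist Y y y' \<le> s \<Longrightarrow> mdist X (g y) (g y') \<le> r"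
      using bornologousD by metis
    show "\<exists>r. \<forall>x\<in>mspace X. \<forall>x'\<in>mspace X. mdist Y (f x) (f x') \<le> s \<longrightarrow> mdist X x x' \<le> r"
    proof (intro exI ballI impI)
      fix x x' assume x: "x \<in> mspace X" "x' \<in> mspace X" "mdist Y (f x) (f x') \<le> s"
      have "mdist X x x' \<le> mdist X x (g (f x)) + mdist X (g (f x)) (g (f x')) + mdist X (g (f x')) x'"
        using x fY gX by (smt (verit) mdist_triangle)
      then show "mdist X x x' \<le> c + r + c"
        using r[OF fY fY] x c[of x] c[of x'] mdist_commute[of X x "g (f x)"] by fastforce
    qed
  qed
qed

text \<open>The inverse sends \<open>y\<close> to some point whose image is within \<open>c\<close>
  of \<open>y\<close>. The lower control of \<open>f\<close> turns estimates between images into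
  estimates between such preimages, at the price of \<open>c\<close> at each end.\<close>

lemma coarsely_equivalentI:
  assumes f: "coarse_embedding X Y f" and onto: "coarsely_onto X Y f"
  shows "coarsely_equivalent X Y"
proof -
  have fY: "f x \<in> mspace Y" if "x \<in> mspace X" for x
    using that f by (auto simp: coarse_embedding_def bornologous_def)
  obtain c where "\<forall>y\<in>mspace Y. \<exists>x\<in>mspace X. mdist Y (f x) y \<le> c" using onto by (auto simp: coarsely_onto_def)
  then obtain g where g: "\<And>y. y \<in> mspace Y \<Longrightarrow> g y \<in> mspace X" "\<And>y. y \<in> mspace Y \<Longrightarrow> mdist Y (f (g y)) y \<le> c"
    by metis
  have born: "bornologous Y X g"
    unfolding bornologous_def
  proof (intro conjI allI)
    fix r
    obtain s where s: "\<And>x x'. x\<in>mspace X \<Longrightarrow> x'\<in>mspace X \<Longrightarrow> mdist Y (f x) (f x') \<le> c + r + c \<Longrightarrow> mdist X x x' \<le> s"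
      using f unfolding coarse_embedding_def by meson
    show "\<exists>s. \<forall>x\<in>mspace Y. \<forall>x'\<in>mspace Y. mdist Y x x' \<le> r \<longrightarrow> mdist X (g x) (g x') \<le> s"
    proof (intro exI ballI impI)
      fix y y' assume y: "y \<in> mspace Y" "y' \<in> mspace Y" "mdist Y y y' \<le> r"
      have "mdist Y (f (g y)) (f (g y')) \<le> mdist Y (f (g y)) y + mdist Y y y' + mdist Y y' (f (g y'))"
        using y fY g(1) by (smt (verit) mdist_triangle)
      then show "mdist X (g y) (g y') \<le> s"
        using s[of "g y" "g y'"] g(1) g(2)[of y] g(2)[of y'] y mdist_commute[of Y y' "f (g y')"] by fastforce
    qed
  qed (use g in auto)
  have "bounded_subset Y {y \<in> mspace Y. g y \<in> B}" if B: "bounded_subset X B" for B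
  proof -
    obtain r where r: "B \<subseteq> mspace X" "\<forall>x\<in>B. \<forall>y\<in>B. mdist X x y \<le> r" using B by (auto simp: bounded_subset_iff)
    have "bornologous X Y f" using f by (simp add: coarse_embedding_def)
    then obtain s where s: "\<And>x x'. x\<in>mspace X \<Longrightarrow> x'\<in>mspace X \<Longrightarrow> mdist X x x' \<le> r \<Longrightarrow> mdist Y (f x) (f x') \<le> s"
      using bornologousD by metis
    have "mdist Y y y' \<le> c + s + c" if y: "y \<in> mspace Y" "y' \<in> mspace Y" "g y \<in> B" "g y' \<in> B" for y y'
    proof -
      have "mdist Y y y' \<le> mdist Y y (f (g y)) + mdist Y (f (g y)) (f (g y')) + mdist Y (f (g y')) y'"
        using y fY g(1) by (smt (verit) mdist_triangle)
      then show ?thesis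
        using s[of "g y" "g y'"] r g(1) g(2)[of y] g(2)[of y'] y mdist_commute[of Y y "f (g y)"] by fastforce
    qed
    then show ?thesis unfolding bounded_subset_iff by blast
  qed
  then have cg: "coarse_map Y X g" using born by (simp add: coarse_map_iff)
  have "\<exists>r. \<forall>x\<in>mspace X. \<forall>x'\<in>mspace X. mdist Y (f x) (f x') \<le> c \<longrightarrow> mdist X x x' \<le> r"
    using f unfolding coarse_embedding_def by blast
  then obtain r where r: "\<And>x x'. x \<in> mspace X \<Longrightarrow> x' \<in> mspace X \<Longrightarrow> mdist Y (f x) (f x') \<le> c \<Longrightarrow> mdist X x x' \<le> r"
    by blast
  have "close_maps X X (g \<circ> f) id"
    unfolding close_maps_def
  proof (intro exI conjI ballI)
    show "max 0 r + 1 > 0" by simp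
    fix x assume "x \<in> mspace X"
    then show "mdist X ((g \<circ> f) x) (id x) < max 0 r + 1"
      using r[of "g (f x)" x] g fY[of x] by force
  qed
  moreover have "close_maps Y Y (f \<circ> g) id"
    unfolding close_maps_def
  proof (intro exI conjI ballI)
    show "max 0 c + 1 > 0" by simp
    fix x assume "x \<in> mspace Y"
    then show "mdist Y ((f \<circ> g) x) (id x) < max 0 c + 1"
      using g by force
  qed
  ultimately show ?thesis
    using cg coarse_embedding_imp_coarse_map[OF f] unfolding coarsely_equivalent_def coarse_equivalence_def by blast
qed

lemma coarsely_equivalent_sym:
  "coarsely_equivalent X Y \<Longrightarrow> coarsely_equivalent Y X"
  unfolding coarsely_equivalent_def coarse_equivalence_def by blast

lemma coarsely_equivalent_trans:
  assumes "coarsely_equivalent X Y" "coarsely_equivalent Y Z"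
  shows "coarsely_equivalent X Z"
proof -
  obtain f g where f: "coarse_embedding X Y f" "coarsely_onto X Y f"
    and g: "coarse_embedding Y Z g" "coarsely_onto Y Z g"
    using assms coarse_equivalence_imp unfolding coarsely_equivalent_def by meson
  obtain c where c: "\<forall>y\<in>mspace Y. \<exists>x\<in>mspace X. mdist Y (f x) y \<le> c" using f by (auto simp: coarsely_onto_def)
  obtain e where e: "\<forall>z\<in>mspace Z. \<exists>y\<in>mspace Y. mdist Z (g y) z \<le> e" using g by (auto simp: coarsely_onto_def)
  have "bornologous Y Z g" using g by (simp add: coarse_embedding_def)
  then obtain s where s: "\<And>x x'. x\<in>mspace Y \<Longrightarrow> x'\<in>mspace Y \<Longrightarrow> mdist Y x x' \<le> c \<Longrightarrow> mdist Z (g x) (g x') \<le> s"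
    using bornologousD by metis
  have maps: "f x \<in> mspace Y" "g y \<in> mspace Z" if "x \<in> mspace X" "y \<in> mspace Y" for x y
    using that f g by (auto simp: coarse_embedding_def bornologous_def)
  have "coarsely_onto X Z (g \<circ> f)"
    unfolding coarsely_onto_def
  proof (intro exI ballI)
    fix z assume z: "z \<in> mspace Z"
    then obtain y where y: "y \<in> mspace Y" "mdist Z (g y) z \<le> e" using e by blast
    then obtain x where x: "x \<in> mspace X" "mdist Y (f x) y \<le> c" using c by blast
    have "mdist Z (g (f x)) z \<le> s + e"
      using mdist_triangle[of "g (f x)" Z "g y" z] s[of "f x" y] maps x y z by force
    then show "\<exists>x\<in>mspace X. mdist Z ((g \<circ> f) x) z \<le> s + e" using x by auto
  qed
  then show ?thesis using coarsely_equivalentI coarse_embedding_comp f(1) g(1) by blast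
qed

lemma mdist_refl [simp]: "x \<in> mspace X \<Longrightarrow> mdist X x x = 0"
  by (simp add: mdist_zero)

section \<open>Slowly oscillating functions\<close>

text \<open>Generated by complements of bounded sets, so no base point has to be chosen. For a
  proper space complements of compact sets give the same filter
  (\<open>eventually_at_inf_compact\<close>).\<close>

definition at_inf :: "'a metric \<Rightarrow> 'a filter" where
  "at_inf X = (INF B\<in>{B. bounded_subset X B}. principal (mspace X - B))"

text \<open>The condition defining Higson functions, freed from continuity and from extensionality;
  this class is stable under composition with coarse maps.\<close>

definition slowly_oscillating :: "'a metric \<Rightarrow> ('a \<Rightarrow> real) \<Rightarrow> bool" where
  "slowly_oscillating X f \<longleftrightarrow> bounded (f ` mspace X) \<and>
     (\<forall>r. \<forall>\<epsilon>>0. \<forall>\<^sub>F x in at_inf X. \<forall>y\<in>mspace X. mdist X x y \<le> r \<longrightarrow> \<bar>f x - f y\<bar> < \<epsilon>)"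

lemma bounded_subset_empty [simp]: "bounded_subset X {}"
  by (simp add: bounded_subset_iff)

lemma bounded_subset_subset: "bounded_subset X B \<Longrightarrow> A \<subseteq> B \<Longrightarrow> bounded_subset X A"
  unfolding bounded_subset_iff by blast

lemma bounded_subset_Un: "bounded_subset X (A \<union> B) \<longleftrightarrow> bounded_subset X A \<and> bounded_subset X B"
  by (simp add: bounded_subset_def Metric_space.mbounded_Un)

lemma bounded_subset_mcball: "bounded_subset X (mcball_of X x r)"
  by (simp add: bounded_subset_def mcball_of_def Metric_space.mbounded_mcball)

lemma eventually_at_inf:
  "eventually P (at_inf X) \<longleftrightarrow> (\<exists>B. bounded_subset X B \<and> (\<forall>x\<in>mspace X - B. P x))"
proof -
  have "eventually P (at_inf X) \<longleftrightarrow>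
    (\<exists>B\<in>{B. bounded_subset X B}. eventually P (principal (mspace X - B)))"
    unfolding at_inf_def
  proof (rule eventually_INF_base)
    show "{B. bounded_subset X B} \<noteq> {}" using bounded_subset_empty by blast
    fix A B assume "A \<in> {B. bounded_subset X B}" "B \<in> {B. bounded_subset X B}"
    then show "\<exists>C\<in>{B. bounded_subset X B}. principal (mspace X - C) \<le>
        inf (principal (mspace X - A)) (principal (mspace X - B))"
      by (intro bexI[of _ "A \<union> B"]) (auto simp: bounded_subset_Un)
  qed
  then show ?thesis by (simp add: eventually_principal)
qed

lemma eventually_at_inf_mspace: "\<forall>\<^sub>F x in at_inf X. x \<in> mspace X"
  by (auto simp: eventually_at_inf intro: exI[of _ "{}"])

lemma eventually_at_inf_dist:
  assumes "a \<in> mspace X"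
  shows "eventually P (at_inf X) \<longleftrightarrow> (\<exists>R. \<forall>x\<in>mspace X. mdist X a x > R \<longrightarrow> P x)"
proof
  assume "eventually P (at_inf X)"
  then obtain B where B: "bounded_subset X B" "\<forall>x\<in>mspace X - B. P x" by (auto simp: eventually_at_inf)
  then obtain r where "\<forall>x\<in>B. mdist X a x \<le> r" using bounded_subset_iff_center[OF assms] by blast
  then show "\<exists>R. \<forall>x\<in>mspace X. mdist X a x > R \<longrightarrow> P x" using B by (metis Diff_iff not_less)
next
  assume "\<exists>R. \<forall>x\<in>mspace X. mdist X a x > R \<longrightarrow> P x"
  then obtain R where "\<forall>x\<in>mspace X. mdist X a x > R \<longrightarrow> P x" by blast
  then show "eventually P (at_inf X)"
    unfolding eventually_at_inf using assms
    by (intro exI[of _ "mcball_of X a R"]) (auto simp: bounded_subset_mcball)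
qed

lemma bounded_subset_thicken:
  assumes "bounded_subset X B"
  shows "bounded_subset X {x \<in> mspace X. \<exists>y\<in>B. mdist X x y \<le> r}"
proof -
  obtain s where s: "B \<subseteq> mspace X" "\<forall>x\<in>B. \<forall>y\<in>B. mdist X x y \<le> s" using assms by (auto simp: bounded_subset_iff)
  have "mdist X x x' \<le> r + s + r" if "x \<in> mspace X" "y \<in> B" "mdist X x y \<le> r"
    "x' \<in> mspace X" "y' \<in> B" "mdist X x' y' \<le> r" for x y x' y'
  proof -
    have "mdist X x x' \<le> mdist X x y + mdist X y y' + mdist X y' x'"
      using that s by (smt (verit) mdist_triangle subsetD)
    then show ?thesis using that s mdist_commute[of X x' y'] by fastforce
  qed
  then show ?thesis unfolding bounded_subset_iff by blast
qed

lemma eventually_at_inf_thicken: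
  assumes "eventually P (at_inf X)"
  shows "\<forall>\<^sub>F x in at_inf X. \<forall>y\<in>mspace X. mdist X x y \<le> r \<longrightarrow> P y"
proof -
  obtain B where B: "bounded_subset X B" "\<forall>x\<in>mspace X - B. P x" using assms by (auto simp: eventually_at_inf)
  show ?thesis
    unfolding eventually_at_inf
    using bounded_subset_thicken[OF B(1), of r] B(2) by blast
qed

lemma coarse_map_filterlim:
  assumes "coarse_map X Y a"
  shows "filterlim a (at_inf Y) (at_inf X)"
  unfolding filterlim_iff
proof (intro allI impI)
  fix P assume "eventually P (at_inf Y)"
  then obtain B where B: "bounded_subset Y B" "\<forall>x\<in>mspace Y - B. P x" by (auto simp: eventually_at_inf)
  have "bounded_subset X {x \<in> mspace X. a x \<in> B}" using assms B by (auto simp: coarse_map_def)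
  moreover have "\<forall>x\<in>mspace X - {x \<in> mspace X. a x \<in> B}. P (a x)"
    using B assms by (auto simp: coarse_map_def)
  ultimately show "\<forall>\<^sub>F x in at_inf X. P (a x)" unfolding eventually_at_inf by blast
qed

lemma slowly_oscillatingD:
  "slowly_oscillating X f \<Longrightarrow> \<epsilon> > 0 \<Longrightarrow> \<forall>\<^sub>F x in at_inf X. \<forall>y\<in>mspace X. mdist X x y \<le> r \<longrightarrow> \<bar>f x - f y\<bar> < \<epsilon>"
  by (simp add: slowly_oscillating_def)

lemma slowly_oscillating_bound:
  assumes "slowly_oscillating X f"
  obtains M where "M > 0" "\<And>x. x \<in> mspace X \<Longrightarrow> \<bar>f x\<bar> \<le> M"
  using assms unfolding slowly_oscillating_def bounded_pos by auto

lemma slowly_oscillating_cong: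
  assumes "slowly_oscillating X f" "\<And>x. x \<in> mspace X \<Longrightarrow> f x = g x"
  shows "slowly_oscillating X g"
proof -
  have "f ` mspace X = g ` mspace X" using assms(2) by auto
  moreover have "\<forall>\<^sub>F x in at_inf X. \<forall>y\<in>mspace X. mdist X x y \<le> r \<longrightarrow> \<bar>g x - g y\<bar> < \<epsilon>" if "\<epsilon> > 0" for r \<epsilon>
    using slowly_oscillatingD[OF assms(1) that, of r] eventually_at_inf_mspace
    by eventually_elim (use assms(2) in auto)
  ultimately show ?thesis using assms(1) by (simp add: slowly_oscillating_def)
qed

lemma slowly_oscillating_const: "slowly_oscillating X (\<lambda>x. c)"
  by (auto simp: slowly_oscillating_def image_constant_conv)

text \<open>Boundedness confines the pair of values to a compact rectangle, where \<open>k\<close>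
  is uniformly continuous and bounded.\<close>

lemma slowly_oscillating_compose2:
  assumes f: "slowly_oscillating X f" and g: "slowly_oscillating X g"
    and k: "continuous_on UNIV (\<lambda>(u::real, v::real). k u v :: real)"
  shows "slowly_oscillating X (\<lambda>x. k (f x) (g x))"
proof -
  obtain M where M: "\<And>x. x \<in> mspace X \<Longrightarrow> \<bar>f x\<bar> \<le> M" using slowly_oscillating_bound[OF f] by metis
  obtain N where N: "\<And>x. x \<in> mspace X \<Longrightarrow> \<bar>g x\<bar> \<le> N" using slowly_oscillating_bound[OF g] by metis
  define S where "S = {-M..M} \<times> {-N..N}"
  have cS: "compact S" by (simp add: S_def compact_Times)
  have inS: "(f x, g x) \<in> S" if "x \<in> mspace X" for x using M[OF that] N[OF that] by (auto simp: S_def)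
  have kS: "continuous_on S (\<lambda>(u, v). k u v)" using k continuous_on_subset by blast
  have "bounded ((\<lambda>(u, v). k u v) ` S)" using compact_continuous_image[OF kS cS] compact_imp_bounded by blast
  moreover have "(\<lambda>x. k (f x) (g x)) ` mspace X \<subseteq> (\<lambda>(u, v). k u v) ` S"
    using inS by (force simp: image_iff)
  ultimately have "bounded ((\<lambda>x. k (f x) (g x)) ` mspace X)" using bounded_subset by blast
  moreover have "\<forall>\<^sub>F x in at_inf X. \<forall>y\<in>mspace X. mdist X x y \<le> r \<longrightarrow> \<bar>k (f x) (g x) - k (f y) (g y)\<bar> < \<epsilon>"
    if "\<epsilon> > 0" for r \<epsilon>
  proof -
    have "uniformly_continuous_on S (\<lambda>(u, v). k u v)" using compact_uniformly_continuous[OF kS cS] .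
    then obtain \<delta> where \<delta>: "\<delta> > 0" "\<forall>p\<in>S. \<forall>q\<in>S. dist q p < \<delta> \<longrightarrow> dist ((\<lambda>(u, v). k u v) q) ((\<lambda>(u, v). k u v) p) < \<epsilon>"
      using \<open>\<epsilon> > 0\<close> unfolding uniformly_continuous_on_def by blast
    then have \<delta>2: "\<delta>/2 > 0" by simp
    show ?thesis
      using slowly_oscillatingD[OF f \<delta>2, of r] slowly_oscillatingD[OF g \<delta>2, of r] eventually_at_inf_mspace
    proof eventually_elim
      case (elim x)
      show ?case
      proof (intro ballI impI)
        fix y assume y: "y \<in> mspace X" "mdist X x y \<le> r"
        have "dist (f x, g x) (f y, g y) \<le> \<bar>f x - f y\<bar> + \<bar>g x - g y\<bar>"
          using sqrt_sum_squares_le_sum_abs[of "f x - f y" "g x - g y"] by (simp add: dist_Pair_Pair dist_real_def)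
        also have "\<dots> < \<delta>" using elim y by fastforce
        finally show "\<bar>k (f x) (g x) - k (f y) (g y)\<bar> < \<epsilon>"
          using \<delta>(2) inS[OF elim(3)] inS[OF y(1)] by (auto simp: dist_real_def)
      qed
    qed
  qed
  ultimately show ?thesis by (simp add: slowly_oscillating_def)
qed

lemma slowly_oscillating_compose:
  assumes "slowly_oscillating X f" "continuous_on UNIV (k :: real \<Rightarrow> real)"
  shows "slowly_oscillating X (\<lambda>x. k (f x))"
proof -
  have "continuous_on UNIV (\<lambda>(u::real, v::real). k u)"
    unfolding split_def by (intro continuous_on_compose2[OF assms(2)] continuous_intros) auto
  from slowly_oscillating_compose2[OF assms(1) assms(1) this] show ?thesis .
qed

lemma slowly_oscillating_add:
  "slowly_oscillating X f \<Longrightarrow> slowly_oscillating X g \<Longrightarrow> slowly_oscillating X (\<lambda>x. f x + g x)"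
  by (rule slowly_oscillating_compose2[where k = "(+)"]) (auto simp: split_def intro!: continuous_intros)

lemma slowly_oscillating_diff:
  "slowly_oscillating X f \<Longrightarrow> slowly_oscillating X g \<Longrightarrow> slowly_oscillating X (\<lambda>x. f x - g x)"
  by (rule slowly_oscillating_compose2[where k = "(-)"]) (auto simp: split_def intro!: continuous_intros)

lemma slowly_oscillating_min:
  "slowly_oscillating X f \<Longrightarrow> slowly_oscillating X g \<Longrightarrow> slowly_oscillating X (\<lambda>x. min (f x) (g x))"
  by (rule slowly_oscillating_compose2[where k = min]) (auto simp: split_def intro!: continuous_intros)

lemma slowly_oscillating_sum:
  "finite I \<Longrightarrow> (\<And>i. i \<in> I \<Longrightarrow> slowly_oscillating X (f i)) \<Longrightarrow> slowly_oscillating X (\<lambda>x. \<Sum>i\<in>I. f i x)"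
  by (induction I rule: finite_induct) (auto intro: slowly_oscillating_const slowly_oscillating_add)

lemma slowly_oscillating_comp_coarse:
  assumes a: "coarse_map X Y a" and h: "slowly_oscillating Y h"
  shows "slowly_oscillating X (h \<circ> a)"
proof -
  have aY: "a x \<in> mspace Y" if "x \<in> mspace X" for x using a that by (auto simp: coarse_map_def)
  then have "(h \<circ> a) ` mspace X \<subseteq> h ` mspace Y" by auto
  then have "bounded ((h \<circ> a) ` mspace X)" using h bounded_subset unfolding slowly_oscillating_def by blast
  moreover have "\<forall>\<^sub>F x in at_inf X. \<forall>y\<in>mspace X. mdist X x y \<le> r \<longrightarrow> \<bar>(h \<circ> a) x - (h \<circ> a) y\<bar> < \<epsilon>"
    if \<epsilon>: "\<epsilon> > 0" for r \<epsilon>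
  proof -
    have "bornologous X Y a" using a by (simp add: coarse_map_iff)
    then obtain s where s: "\<And>x x'. x \<in> mspace X \<Longrightarrow> x' \<in> mspace X \<Longrightarrow> mdist X x x' \<le> r \<Longrightarrow> mdist Y (a x) (a x') \<le> s"
      using bornologousD by metis
    have "\<forall>\<^sub>F x in at_inf X. \<forall>y\<in>mspace Y. mdist Y (a x) y \<le> s \<longrightarrow> \<bar>h (a x) - h y\<bar> < \<epsilon>"
      using slowly_oscillatingD[OF h \<epsilon>, of s] by (rule eventually_compose_filterlim) (rule coarse_map_filterlim[OF a])
    then show ?thesis using eventually_at_inf_mspace
      by eventually_elim (use s aY in auto)
  qed
  ultimately show ?thesis by (simp add: slowly_oscillating_def)
qed

text \<open>A bounded displacement is invisible in the limit. The predicate \<open>s\<close>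
  restricts the displacement bound to a region that \<open>F\<close> eventually occupies; this is
  needed for maps that are close to the identity on one half of the space only.\<close>

lemma slowly_oscillating_comp_close:
  assumes h: "slowly_oscillating X h"
    and c: "\<forall>\<^sub>F x in at_inf X. s x \<longrightarrow> c x \<in> mspace X \<and> mdist X x (c x) \<le> r"
    and F: "F \<le> at_inf X" "eventually s F"
  shows "((\<lambda>x. h (c x) - h x) \<longlongrightarrow> 0) F"
proof (rule tendstoI)
  fix \<epsilon> :: real assume "\<epsilon> > 0"
  have "\<forall>\<^sub>F x in at_inf X. s x \<longrightarrow> \<bar>h x - h (c x)\<bar> < \<epsilon>"
    using slowly_oscillatingD[OF h \<open>\<epsilon> > 0\<close>, of r] c by eventually_elim auto
  then have "\<forall>\<^sub>F x in F. s x \<longrightarrow> \<bar>h x - h (c x)\<bar> < \<epsilon>" using F(1) le_filter_def by blast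
  then show "\<forall>\<^sub>F x in F. dist (h (c x) - h x) 0 < \<epsilon>"
    using F(2) by eventually_elim (auto simp: dist_real_def)
qed

section \<open>Higson functions among the slowly oscillating functions of a proper space\<close>

lemma proper_compactin_iff:
  assumes "proper_metric X"
  shows "bounded_subset X B \<longleftrightarrow> (\<exists>K. compactin (mtopology_of X) K \<and> B \<subseteq> K)"
proof
  assume B: "bounded_subset X B"
  show "\<exists>K. compactin (mtopology_of X) K \<and> B \<subseteq> K"
  proof (cases "B = {}")
    case False
    then obtain a where a: "a \<in> B" by blast
    obtain r where "B \<subseteq> mspace X" "\<forall>x\<in>B. \<forall>y\<in>B. mdist X x y \<le> r" using B by (auto simp: bounded_subset_iff)
    then have "a \<in> mspace X" "B \<subseteq> mcball_of X a r" using a by auto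
    then show ?thesis using assms by (meson proper_metric_def)
  qed auto
next
  assume "\<exists>K. compactin (mtopology_of X) K \<and> B \<subseteq> K"
  then obtain K where "compactin (mtopology_of X) K" "B \<subseteq> K" by blast
  then have "bounded_subset X K"
    by (simp add: bounded_subset_def mtopology_of_def Metric_space.compactin_imp_mbounded)
  then show "bounded_subset X B" using \<open>B \<subseteq> K\<close> bounded_subset_subset by blast
qed

lemma eventually_at_inf_compact:
  assumes "proper_metric X"
  shows "eventually P (at_inf X) \<longleftrightarrow> (\<exists>K. compactin (mtopology_of X) K \<and> (\<forall>x\<in>mspace X - K. P x))"
  unfolding eventually_at_inf
proof
  assume "\<exists>B. bounded_subset X B \<and> (\<forall>x\<in>mspace X - B. P x)"
  then obtain B where B: "bounded_subset X B" "\<forall>x\<in>mspace X - B. P x" by blast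
  then obtain K where "compactin (mtopology_of X) K" "B \<subseteq> K" using proper_compactin_iff[OF assms] by blast
  then show "\<exists>K. compactin (mtopology_of X) K \<and> (\<forall>x\<in>mspace X - K. P x)" using B(2) by blast
next
  assume "\<exists>K. compactin (mtopology_of X) K \<and> (\<forall>x\<in>mspace X - K. P x)"
  then obtain K where K: "compactin (mtopology_of X) K" "\<forall>x\<in>mspace X - K. P x" by blast
  then have "bounded_subset X K" using proper_compactin_iff[OF assms] by blast
  then show "\<exists>B. bounded_subset X B \<and> (\<forall>x\<in>mspace X - B. P x)" using K(2) by blast
qed

lemma higson_functions_iff:
  assumes "proper_metric X"
  shows "f \<in> higson_functions X \<longleftrightarrow> f \<in> extensional (mspace X) \<and>
     continuous_map (mtopology_of X) euclideanreal f \<and> slowly_oscillating X f"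
proof -
  have "(\<forall>r>0. \<forall>\<epsilon>>0. \<exists>K. compactin (mtopology_of X) K \<and> (\<forall>x\<in>mspace X - K. diameter (f ` mcball_of X x r) < \<epsilon>)) \<longleftrightarrow>
    (\<forall>r. \<forall>\<epsilon>>0. \<forall>\<^sub>F x in at_inf X. \<forall>y\<in>mspace X. mdist X x y \<le> r \<longrightarrow> \<bar>f x - f y\<bar> < \<epsilon>)" (is "?L \<longleftrightarrow> ?R")
    if bdd: "bounded (f ` mspace X)"
  proof
    have bb: "bounded (f ` mcball_of X x r)" for x r
      by (rule bounded_subset[OF bdd]) auto
    assume L: ?L
    show ?R
    proof (intro allI impI)
      fix r and \<epsilon> :: real assume "\<epsilon> > 0"
      \<comment> \<open>The diameter condition speaks of positive radii only, hence
        \<open>max r 1\<close> for arbitrary \<open>r\<close>.\<close>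
      then obtain K where K: "compactin (mtopology_of X) K" "\<forall>x\<in>mspace X - K. diameter (f ` mcball_of X x (max r 1)) < \<epsilon>"
        using L[rule_format, of "max r 1" \<epsilon>] by fastforce
      have "\<bar>f x - f y\<bar> < \<epsilon>" if x: "x \<in> mspace X - K" "y \<in> mspace X" "mdist X x y \<le> r" for x y
      proof -
        have "x \<in> mcball_of X x (max r 1)" "y \<in> mcball_of X x (max r 1)" using x by auto
        then have "dist (f x) (f y) \<le> diameter (f ` mcball_of X x (max r 1))"
          by (intro diameter_bounded_bound bb imageI)
        then show ?thesis using K(2) x by (force simp: dist_real_def)
      qed
      then show "\<forall>\<^sub>F x in at_inf X. \<forall>y\<in>mspace X. mdist X x y \<le> r \<longrightarrow> \<bar>f x - f y\<bar> < \<epsilon>"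
        unfolding eventually_at_inf_compact[OF assms] using K(1) by blast
    qed
  next
    assume R: ?R
    show ?L
    proof (intro allI impI)
      fix r \<epsilon> :: real assume r: "r > 0" and "\<epsilon> > 0"
      then have "\<epsilon>/3 > 0" by simp
      then obtain K where K: "compactin (mtopology_of X) K"
        "\<forall>x\<in>mspace X - K. \<forall>y\<in>mspace X. mdist X x y \<le> r \<longrightarrow> \<bar>f x - f y\<bar> < \<epsilon>/3"
        using R unfolding eventually_at_inf_compact[OF assms] by meson
      have "diameter (f ` mcball_of X x r) < \<epsilon>" if x: "x \<in> mspace X - K" for x
      proof -
        have "diameter (f ` mcball_of X x r) \<le> 2 * \<epsilon> / 3"
        proof (rule diameter_le)
          show "f ` mcball_of X x r \<noteq> {} \<or> 0 \<le> 2 * \<epsilon> / 3" using \<open>\<epsilon> > 0\<close> by simp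
          fix u v assume "u \<in> f ` mcball_of X x r" "v \<in> f ` mcball_of X x r"
          then obtain y z where yz: "y \<in> mspace X" "mdist X x y \<le> r" "u = f y"
            "z \<in> mspace X" "mdist X x z \<le> r" "v = f z" by auto
          then have "\<bar>f x - f y\<bar> < \<epsilon>/3" "\<bar>f x - f z\<bar> < \<epsilon>/3" using K(2) x by blast+
          then have "\<bar>f y - f z\<bar> \<le> 2 * \<epsilon> / 3" by linarith
          then show "norm (u - v) \<le> 2 * \<epsilon> / 3" using yz by (simp only: real_norm_def)
        qed
        then show ?thesis using \<open>\<epsilon> > 0\<close> by linarith
      qed
      then show "\<exists>K. compactin (mtopology_of X) K \<and> (\<forall>x\<in>mspace X - K. diameter (f ` mcball_of X x r) < \<epsilon>)"
        using K(1) by blast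
    qed
  qed
  then show ?thesis unfolding higson_functions_def slowly_oscillating_def by blast
qed

lemma continuous_map_real_Lipschitz:
  assumes "\<And>x y. x \<in> mspace X \<Longrightarrow> y \<in> mspace X \<Longrightarrow> \<bar>f x - f y\<bar> \<le> L * mdist X x y"
  shows "continuous_map (mtopology_of X) euclideanreal f"
proof -
  have "Lipschitz_continuous_map X euclidean_metric f"
    using assms by (auto simp: Lipschitz_continuous_map_def dist_real_def)
  from Lipschitz_continuous_imp_continuous_map[OF this] show ?thesis by simp
qed

text \<open>The regularisation is the inf-convolution with a large multiple of the metric; the slope
  is chosen so large that only points of the unit ball matter.\<close>
lemma higson_approximation:
  assumes P: "proper_metric X" and f: "slowly_oscillating X f"
  shows "\<exists>h\<in>higson_functions X. ((\<lambda>x. f x - h x) \<longlongrightarrow> 0) (at_inf X)"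
proof -
  obtain M where M: "M > 0" "\<And>x. x \<in> mspace X \<Longrightarrow> \<bar>f x\<bar> \<le> M" using slowly_oscillating_bound[OF f] by metis
  define h where "h = (\<lambda>x. INF y\<in>mspace X. f y + 2 * M * mdist X x y)"
  have lower: "f y + 2 * M * mdist X x y \<ge> -M" if "y \<in> mspace X" for x y
    using M(2)[OF that] M(1) mdist_nonneg[of X x y] by (smt (verit) mult_nonneg_nonneg)
  have bdd: "bdd_below ((\<lambda>y. f y + 2 * M * mdist X x y) ` mspace X)" for x
    using lower by (intro bdd_belowI2) auto
  have h_le: "h x \<le> f y + 2 * M * mdist X x y" if "y \<in> mspace X" for x y
    unfolding h_def using that by (intro cINF_lower[OF bdd]) auto
  have h_ge: "c \<le> h x" if "x \<in> mspace X" "\<And>y. y \<in> mspace X \<Longrightarrow> c \<le> f y + 2 * M * mdist X x y" for x c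
    unfolding h_def using that by (intro cINF_greatest) auto
  have hf: "h x \<le> f x" if "x \<in> mspace X" for x using h_le[of x x] that by simp
  have close: "\<bar>f x - h x\<bar> \<le> \<epsilon>" if x: "x \<in> mspace X" "\<epsilon> > 0"
    "\<forall>y\<in>mspace X. mdist X x y \<le> 1 \<longrightarrow> \<bar>f x - f y\<bar> < \<epsilon>" for x \<epsilon>
  proof -
    have "f x - \<epsilon> \<le> h x"
    proof (rule h_ge[OF x(1)])
      fix y assume y: "y \<in> mspace X"
      show "f x - \<epsilon> \<le> f y + 2 * M * mdist X x y"
      proof (cases "mdist X x y \<le> 1")
        case True
        then have "f x - \<epsilon> \<le> f y" using x y by force
        moreover have "0 \<le> 2 * M * mdist X x y" using M(1) by simp
        ultimately show ?thesis by linarith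
      next
        \<comment> \<open>Two values of \<open>f\<close> differ by at most \<open>2 * M\<close>, and
          beyond distance 1 the slope term alone already exceeds this.\<close>
        case False
        then have "2 * M * 1 \<le> 2 * M * mdist X x y" using M(1) by (intro mult_left_mono) auto
        then show ?thesis using M(2)[OF y] M(2)[OF x(1)] x(2) by linarith
      qed
    qed
    then show ?thesis using hf[OF x(1)] by simp
  qed
  have lip1: "h x \<le> h y + 2 * M * mdist X x y" if "x \<in> mspace X" "y \<in> mspace X" for x y
  proof -
    have "h x - 2 * M * mdist X x y \<le> h y"
    proof (rule h_ge[OF that(2)])
      fix z assume z: "z \<in> mspace X"
      have "2 * M * mdist X x z \<le> 2 * M * (mdist X x y + mdist X y z)"
        using M(1) mdist_triangle that z by (intro mult_left_mono) auto
      then show "h x - 2 * M * mdist X x y \<le> f z + 2 * M * mdist X y z"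
        using h_le[OF z, of x] by (simp add: algebra_simps)
    qed
    then show ?thesis by simp
  qed
  have lip: "\<bar>h x - h y\<bar> \<le> 2 * M * mdist X x y" if "x \<in> mspace X" "y \<in> mspace X" for x y
    using lip1[of x y] lip1[of y x] that mdist_commute[of X x y] by simp
  have "bounded (h ` mspace X)"
  proof (rule boundedI)
    fix u assume "u \<in> h ` mspace X"
    then obtain x where x: "x \<in> mspace X" "u = h x" by blast
    have "-M \<le> h x" by (rule h_ge[OF x(1)]) (use lower in auto)
    then show "norm u \<le> M" using hf[OF x(1)] M(2)[OF x(1)] x by auto
  qed
  have to0: "((\<lambda>x. f x - h x) \<longlongrightarrow> 0) (at_inf X)"
  proof (rule tendstoI)
    fix \<epsilon> :: real assume "\<epsilon> > 0"
    then have e: "\<epsilon>/2 > 0" by simp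
    show "\<forall>\<^sub>F x in at_inf X. dist (f x - h x) 0 < \<epsilon>"
      using slowly_oscillatingD[OF f e, of 1] eventually_at_inf_mspace
    proof eventually_elim
      case (elim x)
      then have "\<bar>f x - h x\<bar> \<le> \<epsilon>/2" using close e by blast
      then show ?case using \<open>\<epsilon> > 0\<close> by (simp add: dist_real_def)
    qed
  qed
  have "slowly_oscillating X h"
    unfolding slowly_oscillating_def
  proof (intro conjI allI impI)
    fix r \<epsilon> :: real assume \<epsilon>: "\<epsilon> > 0"
    then have e: "\<epsilon>/3 > 0" by simp
    have ev: "\<forall>\<^sub>F x in at_inf X. \<bar>f x - h x\<bar> < \<epsilon>/3"
      using tendstoD[OF to0 e] by (simp add: dist_real_def)
    show "\<forall>\<^sub>F x in at_inf X. \<forall>y\<in>mspace X. mdist X x y \<le> r \<longrightarrow> \<bar>h x - h y\<bar> < \<epsilon>"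
      using slowly_oscillatingD[OF f e, of r] ev eventually_at_inf_thicken[OF ev, of r]
    proof eventually_elim
      case (elim x)
      show ?case
      proof (intro ballI impI)
        fix y assume "y \<in> mspace X" "mdist X x y \<le> r"
        then have "\<bar>f x - f y\<bar> < \<epsilon>/3" "\<bar>f y - h y\<bar> < \<epsilon>/3" using elim by blast+
        then show "\<bar>h x - h y\<bar> < \<epsilon>" using elim(2) by linarith
      qed
    qed
  qed fact
  then have so: "slowly_oscillating X (restrict h (mspace X))"
    by (rule slowly_oscillating_cong) auto
  have "continuous_map (mtopology_of X) euclideanreal (restrict h (mspace X))"
    by (rule continuous_map_real_Lipschitz[of _ _ "2 * M"]) (use lip in auto)
  then have "restrict h (mspace X) \<in> higson_functions X"
    using so by (simp add: higson_functions_iff[OF P])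
  moreover have "((\<lambda>x. f x - restrict h (mspace X) x) \<longlongrightarrow> 0) (at_inf X)"
    using to0 by (rule Lim_transform_eventually)
       (use eventually_at_inf_mspace in \<open>eventually_elim, auto\<close>)
  ultimately show ?thesis by blast
qed

text \<open>Serves to tell points of \<open>X\<close> from points of the corona: along a filter at
  infinity this function tends to 0, while the evaluation at \<open>a\<close> has the coordinate
  1.\<close>

lemma higson_bump:
  assumes P: "proper_metric X" and a: "a \<in> mspace X"
  shows "\<exists>h\<in>higson_functions X. h a = 1 \<and> (\<forall>\<^sub>F x in at_inf X. h x = 0)"
proof -
  define h where "h = restrict (\<lambda>x. max 0 (1 - mdist X a x)) (mspace X)"
  have ev: "\<forall>\<^sub>F x in at_inf X. h x = 0"
    unfolding eventually_at_inf_dist[OF a] by (intro exI[of _ 1]) (auto simp: h_def)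
  have "slowly_oscillating X h"
    unfolding slowly_oscillating_def
  proof (intro conjI allI impI)
    show "bounded (h ` mspace X)"
      by (rule boundedI[of _ 1]) (auto simp: h_def)
    fix r \<epsilon> :: real assume "\<epsilon> > 0"
    show "\<forall>\<^sub>F x in at_inf X. \<forall>y\<in>mspace X. mdist X x y \<le> r \<longrightarrow> \<bar>h x - h y\<bar> < \<epsilon>"
      using ev eventually_at_inf_thicken[OF ev, of r] by eventually_elim (use \<open>\<epsilon> > 0\<close> in auto)
  qed
  moreover have "continuous_map (mtopology_of X) euclideanreal h"
  proof (rule continuous_map_real_Lipschitz[of _ _ 1])
    fix x y assume "x \<in> mspace X" "y \<in> mspace X"
    then show "\<bar>h x - h y\<bar> \<le> 1 * mdist X x y"
      using mdist_triangle[of a X x y] mdist_triangle[of a X y x] mdist_commute[of X x y] a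
      by (auto simp: h_def)
  qed
  ultimately have "h \<in> higson_functions X" by (simp add: higson_functions_iff[OF P] h_def)
  then show ?thesis using ev a by (auto simp: h_def intro!: bexI[of _ h])
qed

section \<open>Points of the Higson corona as filters\<close>

text \<open>A point \<^term>\<open>p\<close> of the corona is handled through the filter of its traces on \<^term>\<open>X\<close>: the coarsest
  filter at infinity along which every Higson function \<^term>\<open>h\<close> tends to \<^term>\<open>p h\<close>.\<close>
definition corona_filter :: "'a metric \<Rightarrow> (('a \<Rightarrow> real) \<Rightarrow> real) \<Rightarrow> 'a filter" where
  "corona_filter X p = inf (at_inf X) (INF h\<in>higson_functions X. filtercomap h (nhds (p h)))"

text \<open>The part at infinity of the closure of \<open>W\<close>: its points are those whose
  traces keep meeting \<open>W\<close>. Extensionality fixes one representative of each point of the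
  product.\<close>

definition corona_star :: "'a metric \<Rightarrow> 'a set \<Rightarrow> (('a \<Rightarrow> real) \<Rightarrow> real) set" where
  "corona_star X W = {p \<in> extensional (higson_functions X). \<exists>\<^sub>F x in corona_filter X p. x \<in> W}"

text \<open>For proper \<open>X\<close> this is the underlying set of the corona, see
  \<open>higson_corona_eq\<close>: a non-trivial filter says that \<open>p\<close> can be approached
  from \<open>X\<close> outside every bounded set.\<close>

definition corona_set :: "'a metric \<Rightarrow> (('a \<Rightarrow> real) \<Rightarrow> real) set" where
  "corona_set X = {p \<in> extensional (higson_functions X). corona_filter X p \<noteq> bot}"

text \<open>The value at \<open>p\<close> of the extension of \<open>f\<close> to the corona. It is
  defined by a limit because a slowly oscillating \<open>f\<close> need not be a coordinate of
  \<open>p\<close>.\<close>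

definition corona_value :: "'a metric \<Rightarrow> (('a \<Rightarrow> real) \<Rightarrow> real) \<Rightarrow> ('a \<Rightarrow> real) \<Rightarrow> real" where
  "corona_value X p f = Lim (corona_filter X p) f"

abbreviation higson_product :: "'a metric \<Rightarrow> (('a \<Rightarrow> real) \<Rightarrow> real) topology" where
  "higson_product X \<equiv> product_topology (\<lambda>_. euclideanreal) (higson_functions X)"

lemma corona_filter_le: "corona_filter X p \<le> at_inf X"
  by (simp add: corona_filter_def)

lemma eventually_corona_filter: "eventually P (at_inf X) \<Longrightarrow> eventually P (corona_filter X p)"
  using corona_filter_le filter_leD by blast

lemma corona_filter_tendsto: "h \<in> higson_functions X \<Longrightarrow> (h \<longlongrightarrow> p h) (corona_filter X p)"
  unfolding filterlim_iff_le_filtercomap corona_filter_def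
  by (rule order_trans[OF inf_le2]) (rule INF_lower)

lemma le_corona_filterI:
  assumes "F \<le> at_inf X" "\<And>h. h \<in> higson_functions X \<Longrightarrow> (h \<longlongrightarrow> p h) F"
  shows "F \<le> corona_filter X p"
  using assms unfolding filterlim_iff_le_filtercomap corona_filter_def by (auto intro!: INF_greatest)

lemma corona_filter_limitin:
  assumes "p \<in> extensional (higson_functions X)"
  shows "limitin (higson_product X) (higson_evaluation X) p (corona_filter X p)"
  using assms corona_filter_tendsto unfolding limitin_componentwise
  by (auto simp: higson_evaluation_def)

text \<open>Translates between the filter and the product topology: the traces of neighbourhoods of
  \<open>p\<close>, with bounded sets removed, form a base. An event along the infimum of filters
  involves only finitely many coordinates, and these span a basic open set.\<close>

lemma eventually_corona_filter_iff:
  assumes p: "p \<in> extensional (higson_functions X)"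
  shows "eventually P (corona_filter X p) \<longleftrightarrow>
    (\<exists>U B. openin (higson_product X) U \<and> p \<in> U \<and> bounded_subset X B \<and>
       (\<forall>x\<in>mspace X - B. higson_evaluation X x \<in> U \<longrightarrow> P x))"
proof
  assume "eventually P (corona_filter X p)"
  then obtain Q R where Q: "eventually Q (at_inf X)"
    and R: "eventually R (INF h\<in>higson_functions X. filtercomap h (nhds (p h)))"
    and P: "\<And>x. Q x \<Longrightarrow> R x \<Longrightarrow> P x"
    unfolding corona_filter_def eventually_inf by blast
  obtain B where B: "bounded_subset X B" "\<forall>x\<in>mspace X - B. Q x" using Q by (auto simp: eventually_at_inf)
  obtain H where H: "H \<subseteq> higson_functions X" "finite H" "eventually R (INF h\<in>H. filtercomap h (nhds (p h)))"
    using R unfolding eventually_INF[of _ _ "higson_functions X"] by blast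
  obtain S where S: "\<And>h. h \<in> H \<Longrightarrow> eventually (S h) (filtercomap h (nhds (p h)))"
    "\<And>y. \<forall>h\<in>H. S h y \<Longrightarrow> R y"
    using H(3) unfolding eventually_INF_finite[OF H(2)] by blast
  have "\<forall>h\<in>H. \<exists>V. open V \<and> p h \<in> V \<and> (\<forall>x. h x \<in> V \<longrightarrow> S h x)"
    using S(1) unfolding eventually_filtercomap_nhds by blast
  then obtain V where V: "\<And>h. h \<in> H \<Longrightarrow> open (V h) \<and> p h \<in> V h \<and> (\<forall>x. h x \<in> V h \<longrightarrow> S h x)" by metis
  define U where "U = PiE (higson_functions X) (\<lambda>h. if h \<in> H then V h else UNIV)"
  have "finite {h \<in> higson_functions X. (if h \<in> H then V h else UNIV) \<noteq> topspace euclideanreal}"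
    by (rule finite_subset[OF _ H(2)]) auto
  then have "openin (higson_product X) U"
    unfolding U_def openin_PiE_gen using V by auto
  moreover have "p \<in> U" using p V by (auto simp: U_def PiE_iff)
  moreover have "P x" if "x \<in> mspace X - B" "higson_evaluation X x \<in> U" for x
  proof -
    have "h x \<in> V h" if "h \<in> H" for h
      using \<open>higson_evaluation X x \<in> U\<close> H(1) that
      by (auto simp: U_def PiE_iff higson_evaluation_def dest!: bspec[of "higson_functions X" _ h])
    then have "\<forall>h\<in>H. S h x" using V by blast
    then have "R x" by (rule S(2))
    moreover have "Q x" using B(2) that(1) by blast
    ultimately show ?thesis using P by blast
  qed
  ultimately show "\<exists>U B. openin (higson_product X) U \<and> p \<in> U \<and> bounded_subset X B \<and>
       (\<forall>x\<in>mspace X - B. higson_evaluation X x \<in> U \<longrightarrow> P x)" using B(1) by blast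
next
  assume "\<exists>U B. openin (higson_product X) U \<and> p \<in> U \<and> bounded_subset X B \<and>
       (\<forall>x\<in>mspace X - B. higson_evaluation X x \<in> U \<longrightarrow> P x)"
  then obtain U B where U: "openin (higson_product X) U" "p \<in> U" "bounded_subset X B"
       "\<forall>x\<in>mspace X - B. higson_evaluation X x \<in> U \<longrightarrow> P x" by blast
  have "\<forall>\<^sub>F x in corona_filter X p. higson_evaluation X x \<in> U"
    using limitinD[OF corona_filter_limitin[OF p]] U by blast
  moreover have "\<forall>\<^sub>F x in corona_filter X p. x \<in> mspace X - B"
    by (rule eventually_corona_filter) (use U(3) in \<open>auto simp: eventually_at_inf\<close>)
  ultimately show "eventually P (corona_filter X p)" by eventually_elim (use U(4) in blast)
qed

text \<open>A pair \<open>U\<close>, \<open>B\<close> that keeps \<open>W\<close> away from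
  \<open>p\<close> keeps it away from every point of \<open>U\<close>, so the complement is
  open.\<close>

lemma closedin_corona_star: "closedin (higson_product X) (corona_star X W)"
proof -
  have "openin (higson_product X) (extensional (higson_functions X) - corona_star X W)"
    unfolding openin_subopen[of _ "extensional (higson_functions X) - corona_star X W"]
  proof
    fix p assume "p \<in> extensional (higson_functions X) - corona_star X W"
    then have p: "p \<in> extensional (higson_functions X)" "\<forall>\<^sub>F x in corona_filter X p. x \<notin> W"
      by (auto simp: corona_star_def frequently_def)
    then obtain U B where U: "openin (higson_product X) U" "p \<in> U" "bounded_subset X B"
       "\<forall>x\<in>mspace X - B. higson_evaluation X x \<in> U \<longrightarrow> x \<notin> W"
      using iffD1[OF eventually_corona_filter_iff[OF p(1)] p(2)] by blast
    have ext: "U \<subseteq> extensional (higson_functions X)" using openin_subset[OF U(1)] by (auto simp: PiE_iff)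
    have "U \<subseteq> extensional (higson_functions X) - corona_star X W"
    proof
      fix q assume q: "q \<in> U"
      then have "\<forall>\<^sub>F x in corona_filter X q. x \<notin> W"
        using ext U by (subst eventually_corona_filter_iff) auto
      then show "q \<in> extensional (higson_functions X) - corona_star X W"
        using q ext by (auto simp: corona_star_def frequently_def)
    qed
    then show "\<exists>T. openin (higson_product X) T \<and> p \<in> T \<and> T \<subseteq> extensional (higson_functions X) - corona_star X W"
      using U by blast
  qed
  then show ?thesis
    by (auto simp: closedin_def corona_star_def PiE_UNIV_domain PiE_def)
qed

lemma corona_star_UNIV: "corona_star X UNIV = corona_set X"
  by (auto simp: corona_star_def corona_set_def frequently_const_iff)

lemma corona_star_mono: "V \<subseteq> W \<Longrightarrow> corona_star X V \<subseteq> corona_star X W"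
  by (auto simp: corona_star_def elim!: frequently_elim1)

lemma corona_star_subset: "corona_star X W \<subseteq> corona_set X"
  using corona_star_mono[of W UNIV X] corona_star_UNIV by blast

text \<open>Only the behaviour of a set near infinity matters for its trace.\<close>

lemma corona_star_cong:
  assumes "\<forall>\<^sub>F x in at_inf X. x \<in> V \<longrightarrow> x \<in> W"
  shows "corona_star X V \<subseteq> corona_star X W"
  using eventually_corona_filter[OF assms] unfolding corona_star_def by (fast intro: frequently_mp)

lemma corona_star_eventually:
  assumes "p \<in> corona_set X" "\<forall>\<^sub>F x in corona_filter X p. x \<in> W"
  shows "p \<in> corona_star X W"
  using assms by (auto simp: corona_star_def corona_set_def intro: eventually_frequently)

section \<open>The corona as a compact Hausdorff subspace of a product of lines\<close>

lemma higson_cube_alt: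
  "higson_cube X = subtopology (higson_product X)
     (PiE (higson_functions X) (\<lambda>f. {(INF x\<in>mspace X. f x)..(SUP x\<in>mspace X. f x)}))"
  by (simp add: higson_cube_def subtopology_product_topology)

lemma topspace_higson_cube:
  "topspace (higson_cube X) = PiE (higson_functions X) (\<lambda>f. {(INF x\<in>mspace X. f x)..(SUP x\<in>mspace X. f x)})"
  by (simp add: higson_cube_def)

lemma subtopology_higson_product:
  "subtopology (higson_product X) (topspace (higson_cube X)) = higson_cube X"
  unfolding topspace_higson_cube by (rule higson_cube_alt[symmetric])

lemma compactin_higson_cube: "compactin (higson_product X) (topspace (higson_cube X))"
proof -
  have "compact_space (higson_cube X)"
    unfolding higson_cube_def compact_space_product_topology
    by (simp add: compact_space_subtopology)
  moreover have "topspace (higson_cube X) \<subseteq> topspace (higson_product X)"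
    by (auto simp: topspace_higson_cube PiE_iff)
  ultimately show ?thesis by (simp only: compactin_subspace subtopology_higson_product)
qed

lemma higson_function_bounds:
  assumes "f \<in> higson_functions X" "x \<in> mspace X"
  shows "f x \<in> {(INF x\<in>mspace X. f x)..(SUP x\<in>mspace X. f x)}"
proof -
  have "bounded (f ` mspace X)" using assms(1) by (simp add: higson_functions_def)
  then show ?thesis
    using assms(2) bounded_imp_bdd_above bounded_imp_bdd_below by (auto intro: cINF_lower cSUP_upper)
qed

lemma higson_evaluation_in_cube: "x \<in> mspace X \<Longrightarrow> higson_evaluation X x \<in> topspace (higson_cube X)"
  unfolding topspace_higson_cube higson_evaluation_def
  by (simp add: PiE_iff del: atLeastAtMost_iff) (blast intro: higson_function_bounds)

lemma corona_set_in_cube: "corona_set X \<subseteq> topspace (higson_cube X)"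
proof
  fix p assume p: "p \<in> corona_set X"
  have "p f \<in> {(INF x\<in>mspace X. f x)..(SUP x\<in>mspace X. f x)}" if f: "f \<in> higson_functions X" for f
  proof -
    have "\<forall>\<^sub>F x in corona_filter X p. f x \<in> {(INF x\<in>mspace X. f x)..(SUP x\<in>mspace X. f x)}"
      by (rule eventually_mono[OF eventually_corona_filter[OF eventually_at_inf_mspace]])
         (rule higson_function_bounds[OF f])
    then show ?thesis
      using corona_filter_tendsto[OF f] p by (intro Lim_in_closed_set[of _ f]) (auto simp: corona_set_def)
  qed
  then show "p \<in> topspace (higson_cube X)"
    using p by (auto simp: topspace_higson_cube PiE_iff corona_set_def)
qed

lemma continuous_map_higson_evaluation:
  "continuous_map (mtopology_of X) (higson_product X) (higson_evaluation X)"
  unfolding continuous_map_componentwise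
proof (intro conjI ballI)
  show "higson_evaluation X ` topspace (mtopology_of X) \<subseteq> extensional (higson_functions X)"
    by (auto simp: higson_evaluation_def)
  fix h assume "h \<in> higson_functions X"
  then show "continuous_map (mtopology_of X) euclideanreal (\<lambda>x. higson_evaluation X x h)"
    by (simp add: higson_evaluation_def higson_functions_def)
qed

lemma Hausdorff_higson_product: "Hausdorff_space (higson_product X)"
  by (simp add: Hausdorff_space_product_topology)

text \<open>If the filter of a point \<open>p\<close> of the closure were trivial, some
  neighbourhood of \<open>p\<close> would meet the image of \<open>X\<close> only over a bounded
  set. This lies in a compact \<open>K\<close>, whose image is closed and misses \<open>p\<close>,
  so it can be cut out of the neighbourhood, contradicting closure. Conversely the bump at
  \<open>a\<close> prevents a point with a non-trivial filter from being the evaluation at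
  \<open>a\<close>.\<close>

lemma higson_corona_eq:
  assumes P: "proper_metric X"
  shows "higson_corona X = subtopology (higson_product X) (corona_set X)"
proof -
  let ?e = "higson_evaluation X" and ?C = "topspace (higson_cube X)"
  let ?cl = "higson_cube X closure_of (?e ` mspace X)"
  have cl: "?cl - ?e ` mspace X = corona_set X"
  proof (intro equalityI subsetI)
    fix p assume p: "p \<in> ?cl - ?e ` mspace X"
    then have pC: "p \<in> ?C" using in_closure_of by fastforce
    then have ext: "p \<in> extensional (higson_functions X)" by (auto simp: topspace_higson_cube PiE_iff)
    have "corona_filter X p \<noteq> bot"
    proof
      assume "corona_filter X p = bot"
      then have bot: "eventually (\<lambda>_. False) (corona_filter X p)" by simp
      then obtain U B where U: "openin (higson_product X) U" "p \<in> U" "bounded_subset X B"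
        "\<forall>x\<in>mspace X - B. ?e x \<notin> U"
        using iffD1[OF eventually_corona_filter_iff[OF ext] bot] by blast
      obtain K where K: "compactin (mtopology_of X) K" "B \<subseteq> K"
        using proper_compactin_iff[OF P] U(3) by blast
      have "closedin (higson_product X) (?e ` K)"
        using image_compactin[OF K(1) continuous_map_higson_evaluation]
        by (rule compactin_imp_closedin[OF Hausdorff_higson_product])
      then have "openin (higson_product X) (U - ?e ` K)" using U(1) by (rule openin_diff[rotated])
      then have "openin (higson_cube X) ((U - ?e ` K) \<inter> ?C)"
        unfolding higson_cube_alt openin_subtopology by (auto simp: topspace_higson_cube)
      moreover have "K \<subseteq> mspace X" using compactin_subset_topspace[OF K(1)] by simp
      then have "p \<in> (U - ?e ` K) \<inter> ?C" using p U(2) pC by blast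
      ultimately obtain y where "y \<in> ?e ` mspace X" "y \<in> (U - ?e ` K) \<inter> ?C"
        using p unfolding in_closure_of Diff_iff by meson
      then show False using U(4) K(2) by blast
    qed
    then show "p \<in> corona_set X" using ext by (simp add: corona_set_def)
  next
    fix p assume p: "p \<in> corona_set X"
    then have ext: "p \<in> extensional (higson_functions X)" and nb: "corona_filter X p \<noteq> bot"
      by (auto simp: corona_set_def)
    have "p \<in> ?cl"
      unfolding in_closure_of
    proof (intro conjI allI impI)
      show "p \<in> ?C" using corona_set_in_cube p by blast
      fix T assume "p \<in> T \<and> openin (higson_cube X) T"
      then obtain U where U: "openin (higson_product X) U" "T = U \<inter> ?C" "p \<in> U"
        unfolding higson_cube_alt openin_subtopology by (auto simp: topspace_higson_cube)
      have "\<forall>\<^sub>F x in corona_filter X p. ?e x \<in> U"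
        using limitinD[OF corona_filter_limitin[OF ext]] U by blast
      then have "\<forall>\<^sub>F x in corona_filter X p. ?e x \<in> U \<and> x \<in> mspace X"
        using eventually_corona_filter[OF eventually_at_inf_mspace] by (rule eventually_conj)
      then obtain x where "?e x \<in> U" "x \<in> mspace X" using nb eventually_happens by blast
      then have "?e x \<in> T" using U(2) higson_evaluation_in_cube[of x X] by simp
      then show "\<exists>y. y \<in> ?e ` mspace X \<and> y \<in> T" using \<open>x \<in> mspace X\<close> by blast
    qed
    moreover have "p \<noteq> ?e a" if a: "a \<in> mspace X" for a
    proof
      assume eq: "p = ?e a"
      obtain h where h: "h \<in> higson_functions X" "h a = 1" "\<forall>\<^sub>F x in at_inf X. h x = 0"
        using higson_bump[OF P a] by blast
      have "(h \<longlongrightarrow> 0) (corona_filter X p)"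
        using eventually_corona_filter[OF h(3)] by (rule tendsto_eventually)
      then have "p h = 0" using tendsto_unique[OF nb corona_filter_tendsto[OF h(1)]] by simp
      then show False using eq h by (simp add: higson_evaluation_def)
    qed
    ultimately show "p \<in> ?cl - ?e ` mspace X" by blast
  qed
  have "?cl \<inter> ?C = ?cl" by (rule Int_absorb2) (rule closure_of_subset_topspace)
  then have top: "topspace (higson_compactification X) = ?cl"
    by (auto simp: higson_compactification_def)
  have "higson_corona X = subtopology (subtopology (higson_cube X) ?cl) (corona_set X)"
    unfolding higson_corona_def top cl unfolding higson_compactification_def ..
  also have "\<dots> = subtopology (subtopology (higson_product X) ?C) (?cl \<inter> corona_set X)"
    by (simp only: subtopology_subtopology subtopology_higson_product)
  also have "\<dots> = subtopology (higson_product X) (?C \<inter> (?cl \<inter> corona_set X))"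
    by (simp only: subtopology_subtopology)
  also have "?C \<inter> (?cl \<inter> corona_set X) = corona_set X"
    using cl corona_set_in_cube by blast
  finally show ?thesis .
qed

lemma topspace_higson_corona: "proper_metric X \<Longrightarrow> topspace (higson_corona X) = corona_set X"
  by (auto simp: higson_corona_eq corona_set_def PiE_def)

lemma Hausdorff_higson_corona: "proper_metric X \<Longrightarrow> Hausdorff_space (higson_corona X)"
  by (simp add: higson_corona_eq Hausdorff_space_subtopology Hausdorff_higson_product)

lemma closedin_higson_corona_star:
  "proper_metric X \<Longrightarrow> closedin (higson_corona X) (corona_star X W)"
  unfolding higson_corona_eq
  by (rule closedin_subset_topspace[OF closedin_corona_star corona_star_subset])

lemma compact_higson_corona:
  assumes "proper_metric X"
  shows "compact_space (higson_corona X)"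
  unfolding higson_corona_eq[OF assms]
proof (rule compact_space_subtopology)
  show "compactin (higson_product X) (corona_set X)"
    using closed_compactin[OF compactin_higson_cube corona_set_in_cube] closedin_corona_star[of X UNIV]
    by (simp add: corona_star_UNIV)
qed

text \<open>Compactness of the cube: if no point of the corona saw \<open>W\<close>, each point of
  the cube would have a neighbourhood meeting \<open>W\<close> in a bounded set only, and finitely
  many of these would exhaust \<open>W\<close>. It is the only source of corona points in the
  development.\<close>

lemma corona_star_nonempty:
  assumes W: "W \<subseteq> mspace X" "\<not> bounded_subset X W"
  shows "corona_star X W \<noteq> {}"
proof
  assume empty: "corona_star X W = {}"
  define good where "good = (\<lambda>U. openin (higson_product X) U \<and>
    (\<exists>B. bounded_subset X B \<and> (\<forall>x\<in>mspace X - B. higson_evaluation X x \<in> U \<longrightarrow> x \<notin> W)))"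
  have good: "\<exists>U. good U \<and> p \<in> U" if "p \<in> topspace (higson_cube X)" for p
  proof -
    have p: "p \<in> extensional (higson_functions X)" using that by (auto simp: topspace_higson_cube PiE_iff)
    then have "\<forall>\<^sub>F x in corona_filter X p. x \<notin> W"
      using empty by (auto simp: corona_star_def frequently_def)
    from iffD1[OF eventually_corona_filter_iff[OF p] this] show ?thesis unfolding good_def by blast
  qed
  have "topspace (higson_cube X) \<subseteq> \<Union>{U. good U}" using good by blast
  moreover have "\<forall>U\<in>{U. good U}. openin (higson_product X) U" by (auto simp: good_def)
  ultimately obtain \<V> where V: "finite \<V>" "\<V> \<subseteq> {U. good U}" "topspace (higson_cube X) \<subseteq> \<Union>\<V>"
    using compactin_higson_cube unfolding compactin_def by metis
  have "\<forall>U\<in>\<V>. \<exists>B. bounded_subset X B \<and> (\<forall>x\<in>mspace X - B. higson_evaluation X x \<in> U \<longrightarrow> x \<notin> W)"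
    using V(2) unfolding good_def by blast
  from bchoice[OF this] obtain B where B: "\<forall>U\<in>\<V>. bounded_subset X (B U) \<and>
      (\<forall>x\<in>mspace X - B U. higson_evaluation X x \<in> U \<longrightarrow> x \<notin> W)" ..
  have "W \<subseteq> (\<Union>U\<in>\<V>. B U)"
  proof
    fix x assume x: "x \<in> W"
    have "higson_evaluation X x \<in> \<Union>\<V>"
      by (rule subsetD[OF V(3) higson_evaluation_in_cube[OF subsetD[OF W(1) x]]])
    then obtain U where "U \<in> \<V>" "higson_evaluation X x \<in> U" by (rule UnionE)
    moreover from this have "\<forall>x\<in>mspace X - B U. higson_evaluation X x \<in> U \<longrightarrow> x \<notin> W" using B by blast
    ultimately have "x \<in> B U" using x W(1) by auto
    then show "x \<in> (\<Union>U\<in>\<V>. B U)" using \<open>U \<in> \<V>\<close> by blast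
  qed
  moreover have "bounded_subset X (\<Union>U\<in>\<V>. B U)"
    using V(1) B by (induction \<V> rule: finite_induct) (auto simp: bounded_subset_Un)
  ultimately show False using W(2) bounded_subset_subset by blast
qed

section \<open>Values of slowly oscillating functions and separation on the corona\<close>

lemma corona_set_extensional: "p \<in> corona_set X \<Longrightarrow> p \<in> extensional (higson_functions X)"
  by (simp add: corona_set_def)

lemma corona_filter_neq_bot: "p \<in> corona_set X \<Longrightarrow> corona_filter X p \<noteq> bot"
  by (simp add: corona_set_def)

lemma corona_value_unique:
  "p \<in> corona_set X \<Longrightarrow> (f \<longlongrightarrow> l) (corona_filter X p) \<Longrightarrow> corona_value X p f = l"
  unfolding corona_value_def by (rule tendsto_Lim[OF corona_filter_neq_bot])

lemma corona_tendsto_approx: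
  assumes "((\<lambda>x. f x - h x) \<longlongrightarrow> 0) (at_inf X)" "h \<in> higson_functions X"
  shows "(f \<longlongrightarrow> p h) (corona_filter X p)"
proof -
  have "((\<lambda>x. f x - h x) \<longlongrightarrow> 0) (corona_filter X p)"
    using tendsto_mono[OF corona_filter_le assms(1)] .
  from tendsto_add[OF this corona_filter_tendsto[OF assms(2)]] show ?thesis by simp
qed

lemma corona_value_tendsto:
  assumes P: "proper_metric X" and p: "p \<in> corona_set X" and f: "slowly_oscillating X f"
  shows "(f \<longlongrightarrow> corona_value X p f) (corona_filter X p)"
proof -
  obtain h where h: "h \<in> higson_functions X" "((\<lambda>x. f x - h x) \<longlongrightarrow> 0) (at_inf X)"
    using higson_approximation[OF P f] by blast
  show ?thesis using corona_tendsto_approx[OF h(2,1)] corona_value_unique[OF p] by metis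
qed

lemma continuous_map_corona_value:
  assumes P: "proper_metric X" and f: "slowly_oscillating X f"
  shows "continuous_map (higson_corona X) euclideanreal (\<lambda>p. corona_value X p f)"
proof -
  obtain h where h: "h \<in> higson_functions X" "((\<lambda>x. f x - h x) \<longlongrightarrow> 0) (at_inf X)"
    using higson_approximation[OF P f] by blast
  have "continuous_map (higson_corona X) euclideanreal (\<lambda>p. p h)"
    unfolding higson_corona_eq[OF P]
    by (rule continuous_map_from_subtopology[OF continuous_map_product_projection[OF h(1)]])
  then show ?thesis
    by (rule continuous_map_eq)
       (use corona_value_unique[OF _ corona_tendsto_approx[OF h(2,1)]] in \<open>simp add: topspace_higson_corona[OF P]\<close>)
qed

text \<open>Complete regularity, realised by a function on \<open>X\<close>. A basic neighbourhood
  of \<open>p\<close> constrains finitely many coordinates, each to within some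
  \<open>\<epsilon> i\<close>; the truncated sum of the scaled deviations vanishes at
  \<open>p\<close> and reaches 1 as soon as one constraint fails.\<close>

lemma corona_separate_point:
  assumes P: "proper_metric X" and p: "p \<in> corona_set X"
    and C: "closedin (higson_corona X) C" "p \<notin> C"
  shows "\<exists>\<phi>. slowly_oscillating X \<phi> \<and> (\<forall>x. 0 \<le> \<phi> x \<and> \<phi> x \<le> 1) \<and> corona_value X p \<phi> = 0 \<and>
    (\<forall>q\<in>C. corona_value X q \<phi> = 1)"
proof -
  have "openin (higson_corona X) (corona_set X - C)"
    using C(1) by (simp add: closedin_def topspace_higson_corona[OF P])
  then obtain U where U: "openin (higson_product X) U" "corona_set X - C = U \<inter> corona_set X"
    unfolding higson_corona_eq[OF P] openin_subtopology by blast
  then have "p \<in> U" using p C by blast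
  have "\<exists>V. finite {i \<in> higson_functions X. V i \<noteq> UNIV} \<and>
    (\<forall>i\<in>higson_functions X. open (V i)) \<and> p \<in> PiE (higson_functions X) V \<and> PiE (higson_functions X) V \<subseteq> U"
    using U(1)[unfolded openin_product_topology_alt, rule_format, OF \<open>p \<in> U\<close>]
    by (simp only: topspace_euclidean open_openin[symmetric])
  then obtain V where V: "finite {i \<in> higson_functions X. V i \<noteq> UNIV}"
    "\<forall>i\<in>higson_functions X. open (V i)" "p \<in> PiE (higson_functions X) V" "PiE (higson_functions X) V \<subseteq> U"
    by blast
  define H where "H = {i \<in> higson_functions X. V i \<noteq> UNIV}"
  have "\<forall>i\<in>H. \<exists>\<epsilon>>0. ball (p i) \<epsilon> \<subseteq> V i"
    using V(2,3) by (auto simp: H_def open_contains_ball PiE_iff)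
  then obtain \<epsilon> where \<epsilon>: "\<And>i. i \<in> H \<Longrightarrow> \<epsilon> i > 0 \<and> ball (p i) (\<epsilon> i) \<subseteq> V i" by metis
  have HH: "i \<in> higson_functions X" "slowly_oscillating X i" if "i \<in> H" for i
    using that higson_functions_iff[OF P] by (auto simp: H_def)
  have fH: "finite H" using V(1) by (simp add: H_def)
  define \<phi> where "\<phi> = (\<lambda>x. min 1 (\<Sum>i\<in>H. \<bar>i x - p i\<bar> / \<epsilon> i))"
  have "slowly_oscillating X (\<lambda>x. \<Sum>i\<in>H. \<bar>i x - p i\<bar> / \<epsilon> i)"
  proof (rule slowly_oscillating_sum[OF fH])
    fix i assume i: "i \<in> H"
    show "slowly_oscillating X (\<lambda>x. \<bar>i x - p i\<bar> / \<epsilon> i)"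
      using \<epsilon>[OF i] by (intro slowly_oscillating_compose[OF HH(2)[OF i], where k = "\<lambda>u. \<bar>u - p i\<bar> / \<epsilon> i"] continuous_intros) auto
  qed
  then have so: "slowly_oscillating X \<phi>"
    unfolding \<phi>_def by (intro slowly_oscillating_min slowly_oscillating_const)
  have val: "corona_value X q \<phi> = min 1 (\<Sum>i\<in>H. \<bar>q i - p i\<bar> / \<epsilon> i)" if q: "q \<in> corona_set X" for q
    unfolding \<phi>_def using \<epsilon> corona_filter_tendsto HH
    by (intro corona_value_unique[OF q] tendsto_intros) force+
  have "corona_value X q \<phi> = 1" if "q \<in> C" for q
  proof -
    have q: "q \<in> corona_set X" using closedin_subset[OF C(1)] that topspace_higson_corona[OF P] by blast
    then have "q \<notin> PiE (higson_functions X) V" using that U V(4) by blast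
    then obtain i where i: "i \<in> higson_functions X" "q i \<notin> V i"
      using corona_set_extensional[OF q] by (auto simp: PiE_iff)
    then have "i \<in> H" by (auto simp: H_def)
    then have "q i \<notin> ball (p i) (\<epsilon> i)" "\<epsilon> i > 0" using \<epsilon> i by blast+
    then have "1 \<le> \<bar>q i - p i\<bar> / \<epsilon> i" by (auto simp: dist_real_def)
    also have "\<dots> \<le> (\<Sum>i\<in>H. \<bar>q i - p i\<bar> / \<epsilon> i)"
      using \<epsilon> fH \<open>i \<in> H\<close> by (intro member_le_sum) (auto simp: less_imp_le)
    finally show ?thesis using val[OF q] by simp
  qed
  moreover have "corona_value X p \<phi> = 0" using val[OF p] by simp
  moreover have "0 \<le> \<phi> x \<and> \<phi> x \<le> 1" for x
    unfolding \<phi>_def using \<epsilon> by (auto intro!: sum_nonneg simp: less_imp_le)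
  ultimately show ?thesis using so by blast
qed

lemma corona_Urysohn:
  assumes P: "proper_metric X" and A: "closedin (higson_corona X) A"
    and C: "closedin (higson_corona X) C" and AC: "A \<inter> C = {}"
  obtains \<phi> where "slowly_oscillating X \<phi>" "\<And>x. 0 \<le> \<phi> x" "\<And>x. \<phi> x \<le> 1"
    "\<And>p. p \<in> A \<Longrightarrow> corona_value X p \<phi> = 0" "\<And>p. p \<in> C \<Longrightarrow> corona_value X p \<phi> = 1"
proof -
  have sub: "A \<subseteq> corona_set X" "C \<subseteq> corona_set X"
    using closedin_subset[OF A] closedin_subset[OF C] topspace_higson_corona[OF P] by auto
  have "\<exists>\<phi>. slowly_oscillating X \<phi> \<and> (\<forall>x. 0 \<le> \<phi> x \<and> \<phi> x \<le> 1) \<and> corona_value X p \<phi> = 0 \<and>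
    (\<forall>q\<in>C. corona_value X q \<phi> = 1)" if "p \<in> A" for p
    using corona_separate_point[OF P _ C] sub AC that by blast
  then obtain g where g: "\<And>p. p \<in> A \<Longrightarrow> slowly_oscillating X (g p)" "\<And>p. p \<in> A \<Longrightarrow> corona_value X p (g p) = 0"
    "\<And>p x. p \<in> A \<Longrightarrow> 0 \<le> g p x \<and> g p x \<le> 1" "\<And>p q. p \<in> A \<Longrightarrow> q \<in> C \<Longrightarrow> corona_value X q (g p) = 1"
    by metis
  define Nb where "Nb = (\<lambda>p. {q \<in> corona_set X. corona_value X q (g p) \<in> {..<1/2}})"
  have "openin (higson_corona X) (Nb p)" if "p \<in> A" for p
    using openin_continuous_map_preimage[OF continuous_map_corona_value[OF P g(1)[OF that]], of "{..<1/2}"]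
    by (simp add: Nb_def topspace_higson_corona[OF P] flip: open_openin)
  moreover have "A \<subseteq> \<Union>(Nb ` A)" using sub g(2) by (auto simp: Nb_def)
  moreover have "compactin (higson_corona X) A"
    using closedin_compact_space[OF compact_higson_corona[OF P] A] .
  ultimately have "\<exists>\<V>. finite \<V> \<and> \<V> \<subseteq> Nb ` A \<and> A \<subseteq> \<Union>\<V>"
    unfolding compactin_def by (metis (no_types, lifting) imageE)
  then obtain Q where Q: "finite Q" "Q \<subseteq> A" "A \<subseteq> \<Union>(Nb ` Q)"
    by (metis finite_subset_image)
  \<comment> \<open>Each point of \<open>A\<close> lies in some \<open>Nb p\<close>, where the term
    of \<open>p\<close> exceeds 1/2, so \<open>1 - 2 * s\<close> is negative in the limit and is cut
    off to 0. On \<open>C\<close> every term vanishes.\<close>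
  define s where "s = (\<lambda>x. \<Sum>p\<in>Q. 1 - g p x)"
  define \<phi> where "\<phi> = (\<lambda>x. max 0 (1 - 2 * s x))"
  have so_s: "slowly_oscillating X s"
    unfolding s_def using g(1) Q
    by (intro slowly_oscillating_sum slowly_oscillating_diff slowly_oscillating_const) auto
  have so: "slowly_oscillating X \<phi>"
    unfolding \<phi>_def
    by (rule slowly_oscillating_compose[OF so_s, where k = "\<lambda>u. max 0 (1 - 2 * u)"]) (intro continuous_intros)
  have val: "corona_value X q \<phi> = max 0 (1 - 2 * (\<Sum>p\<in>Q. 1 - corona_value X q (g p)))"
    if q: "q \<in> corona_set X" for q
    unfolding \<phi>_def s_def using corona_value_tendsto[OF P q] g(1) Q
    by (intro corona_value_unique[OF q] tendsto_intros) auto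
  show thesis
  proof (rule that[OF so])
    fix x
    show "0 \<le> \<phi> x" by (simp add: \<phi>_def)
    have "s x \<ge> 0" unfolding s_def using g(3) Q by (intro sum_nonneg) auto
    then show "\<phi> x \<le> 1" by (simp add: \<phi>_def)
  next
    fix q assume q: "q \<in> A"
    have le1: "corona_value X q (g p) \<le> 1" if "p \<in> A" for p
      using tendsto_upperbound[OF corona_value_tendsto[OF P _ g(1)[OF that]]] sub q g(3)[OF that]
        corona_filter_neq_bot by (metis (no_types, lifting) always_eventually subsetD)
    obtain p where p: "p \<in> Q" "q \<in> Nb p" using Q q by blast
    have "1 - corona_value X q (g p) \<le> (\<Sum>p\<in>Q. 1 - corona_value X q (g p))"
      using Q p le1 by (intro member_le_sum) auto
    then show "corona_value X q \<phi> = 0" using val p(2) by (auto simp: Nb_def)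
  next
    fix q assume q: "q \<in> C"
    then have "(\<Sum>p\<in>Q. 1 - corona_value X q (g p)) = 0" using g(4) Q by (intro sum.neutral) auto
    then show "corona_value X q \<phi> = 1" using val q sub by auto
  qed
qed

section \<open>Coarse maps act on coronas\<close>

text \<open>The coordinate at \<open>h\<close> is the extended value of \<open>h \<circ> a\<close>
  and not \<open>p (h \<circ> a)\<close>, because \<open>h \<circ> a\<close> need not be
  continuous.\<close>

definition corona_map ::
  "'a metric \<Rightarrow> 'b metric \<Rightarrow> ('a \<Rightarrow> 'b) \<Rightarrow> (('a \<Rightarrow> real) \<Rightarrow> real) \<Rightarrow> (('b \<Rightarrow> real) \<Rightarrow> real)" where
  "corona_map X Y a p = (\<lambda>h\<in>higson_functions Y. corona_value X p (h \<circ> a))"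

text \<open>\<open>corona_filter\<close> is the coarsest filter at infinity with prescribed limits,
  so the image filter lies below it once its limits are known; being non-trivial, it makes the
  larger filter non-trivial.\<close>

lemma corona_map_filter:
  assumes X: "proper_metric X" and Y: "proper_metric Y" and a: "coarse_map X Y a" and p: "p \<in> corona_set X"
  shows "corona_map X Y a p \<in> corona_set Y"
    and "filtermap a (corona_filter X p) \<le> corona_filter Y (corona_map X Y a p)"
proof -
  have "filtermap a (corona_filter X p) \<le> at_inf Y"
    using coarse_map_filterlim[OF a] filtermap_mono[OF corona_filter_le] unfolding filterlim_def
    by (rule order_trans[rotated])
  moreover have "(h \<longlongrightarrow> corona_map X Y a p h) (filtermap a (corona_filter X p))"
    if h: "h \<in> higson_functions Y" for h
  proof -
    have "slowly_oscillating Y h" using h by (simp add: higson_functions_iff[OF Y])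
    from corona_value_tendsto[OF X p slowly_oscillating_comp_coarse[OF a this]]
    show ?thesis using h by (simp add: corona_map_def filterlim_filtermap comp_def)
  qed
  ultimately show le: "filtermap a (corona_filter X p) \<le> corona_filter Y (corona_map X Y a p)"
    by (rule le_corona_filterI)
  have "filtermap a (corona_filter X p) \<noteq> bot"
    using corona_filter_neq_bot[OF p] by (simp add: filtermap_bot_iff)
  then show "corona_map X Y a p \<in> corona_set Y"
    using le by (auto simp: corona_set_def corona_map_def bot_unique)
qed

lemma corona_value_map:
  assumes X: "proper_metric X" and Y: "proper_metric Y" and a: "coarse_map X Y a" and p: "p \<in> corona_set X"
    and h: "slowly_oscillating Y h"
  shows "corona_value Y (corona_map X Y a p) h = corona_value X p (h \<circ> a)"
proof -
  note m = corona_map_filter[OF X Y a p]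
  have "(h \<longlongrightarrow> corona_value Y (corona_map X Y a p) h) (filtermap a (corona_filter X p))"
    using tendsto_mono[OF m(2) corona_value_tendsto[OF Y m(1) h]] .
  then have "((h \<circ> a) \<longlongrightarrow> corona_value Y (corona_map X Y a p) h) (corona_filter X p)"
    by (simp add: filterlim_filtermap comp_def)
  then show ?thesis using corona_value_unique[OF p] by metis
qed

lemma continuous_map_corona_map:
  assumes X: "proper_metric X" and Y: "proper_metric Y" and a: "coarse_map X Y a"
  shows "continuous_map (higson_corona X) (higson_corona Y) (corona_map X Y a)"
  unfolding higson_corona_eq[OF Y] continuous_map_in_subtopology continuous_map_componentwise
proof (intro conjI ballI)
  show "corona_map X Y a ` topspace (higson_corona X) \<subseteq> extensional (higson_functions Y)"
    by (auto simp: corona_map_def)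
  show "corona_map X Y a \<in> topspace (higson_corona X) \<rightarrow> corona_set Y"
    using corona_map_filter(1)[OF X Y a] by (simp add: topspace_higson_corona[OF X])
  fix h assume h: "h \<in> higson_functions Y"
  then have "slowly_oscillating Y h" by (simp add: higson_functions_iff[OF Y])
  from continuous_map_corona_value[OF X slowly_oscillating_comp_coarse[OF a this]]
  show "continuous_map (higson_corona X) euclideanreal (\<lambda>p. corona_map X Y a p h)"
    using h by (simp add: corona_map_def)
qed

text \<open>\<open>h \<circ> b \<circ> a\<close> and \<open>h\<close> have the same limit along the
  filter of \<open>p\<close>, since \<open>b \<circ> a\<close> displaces the points seen by
  \<open>p\<close> by at most \<open>r\<close>.\<close>

lemma corona_map_inverse:
  assumes X: "proper_metric X" and Y: "proper_metric Y" and a: "coarse_map X Y a" and b: "coarse_map Y X b"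
    and p: "p \<in> corona_set X" and s: "eventually s (corona_filter X p)"
    and c: "\<forall>\<^sub>F x in at_inf X. s x \<longrightarrow> mdist X x (b (a x)) \<le> r"
  shows "corona_map Y X b (corona_map X Y a p) = p"
proof (rule extensionalityI)
  show "corona_map Y X b (corona_map X Y a p) \<in> extensional (higson_functions X)" by (simp add: corona_map_def)
  show "p \<in> extensional (higson_functions X)" by (rule corona_set_extensional[OF p])
  fix h assume h: "h \<in> higson_functions X"
  then have so: "slowly_oscillating X h" by (simp add: higson_functions_iff[OF X])
  have "\<forall>\<^sub>F x in at_inf X. s x \<longrightarrow> b (a x) \<in> mspace X \<and> mdist X x (b (a x)) \<le> r"
    using c eventually_at_inf_mspace by eventually_elim (use a b in \<open>auto simp: coarse_map_def\<close>)
  from slowly_oscillating_comp_close[OF so this corona_filter_le s]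
  have "((\<lambda>x. h (b (a x)) - h x) \<longlongrightarrow> 0) (corona_filter X p)" .
  from tendsto_add[OF this corona_filter_tendsto[OF h]]
  have "((h \<circ> b \<circ> a) \<longlongrightarrow> p h) (corona_filter X p)" by (simp add: comp_def)
  then have "corona_value X p (h \<circ> b \<circ> a) = p h" by (rule corona_value_unique[OF p])
  then show "corona_map Y X b (corona_map X Y a p) h = p h"
    using h corona_value_map[OF X Y a p slowly_oscillating_comp_coarse[OF b so]]
    by (simp add: corona_map_def)
qed

text \<open>Serves two purposes: with \<open>s\<close> always true it gives invariance under coarse
  equivalences, and with \<open>s\<close> selecting a half-line it identifies one half of the corona
  of an integer-like space with the corona of the naturals.\<close>

lemma corona_part_homeomorphic:
  assumes X: "proper_metric X" and Y: "proper_metric Y" and a: "coarse_map X Y a" and b: "coarse_map Y X b"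
    and U: "U \<subseteq> corona_set X" "\<And>p. p \<in> U \<Longrightarrow> eventually s (corona_filter X p)"
    and bU: "\<And>q. q \<in> corona_set Y \<Longrightarrow> corona_map Y X b q \<in> U"
    and ba: "\<forall>\<^sub>F x in at_inf X. s x \<longrightarrow> mdist X x (b (a x)) \<le> r"
    and ab: "\<And>y. y \<in> mspace Y \<Longrightarrow> mdist Y y (a (b y)) \<le> r"
  shows "subtopology (higson_corona X) U homeomorphic_space higson_corona Y"
proof -
  have "homeomorphic_maps (subtopology (higson_corona X) U) (higson_corona Y) (corona_map X Y a) (corona_map Y X b)"
    unfolding homeomorphic_maps_def
  proof (intro conjI ballI)
    show "continuous_map (subtopology (higson_corona X) U) (higson_corona Y) (corona_map X Y a)"
      by (rule continuous_map_from_subtopology[OF continuous_map_corona_map[OF X Y a]])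
    show "continuous_map (higson_corona Y) (subtopology (higson_corona X) U) (corona_map Y X b)"
      unfolding continuous_map_in_subtopology
      using continuous_map_corona_map[OF Y X b] bU topspace_higson_corona[OF Y] by auto
    fix p assume "p \<in> topspace (subtopology (higson_corona X) U)"
    then have p: "p \<in> U" "p \<in> corona_set X" by (auto simp: topspace_higson_corona[OF X])
    show "corona_map Y X b (corona_map X Y a p) = p"
      by (rule corona_map_inverse[OF X Y a b p(2) U(2)[OF p(1)] ba])
  next
    fix q assume "q \<in> topspace (higson_corona Y)"
    then have q: "q \<in> corona_set Y" by (auto simp: topspace_higson_corona[OF Y])
    show "corona_map X Y a (corona_map Y X b q) = q"
    proof (rule corona_map_inverse[OF Y X b a q])
      show "\<forall>\<^sub>F x in corona_filter Y q. True" by simp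
      show "\<forall>\<^sub>F x in at_inf Y. True \<longrightarrow> mdist Y x (a (b x)) \<le> r"
        using eventually_at_inf_mspace by eventually_elim (use ab in auto)
    qed
  qed
  then show ?thesis unfolding homeomorphic_space_def by blast
qed

lemma higson_corona_coarse_invariant:
  assumes X: "proper_metric X" and Y: "proper_metric Y" and eq: "coarsely_equivalent X Y"
  shows "higson_corona X homeomorphic_space higson_corona Y"
proof -
  obtain f g where f: "coarse_map X Y f" and g: "coarse_map Y X g"
    and gf: "close_maps X X (g \<circ> f) id" and fg: "close_maps Y Y (f \<circ> g) id"
    using eq unfolding coarsely_equivalent_def coarse_equivalence_def by blast
  obtain r where r: "\<And>x. x \<in> mspace X \<Longrightarrow> mdist X (g (f x)) x < r" using gf by (auto simp: close_maps_def)
  obtain s where s: "\<And>y. y \<in> mspace Y \<Longrightarrow> mdist Y (f (g y)) y < s" using fg by (auto simp: close_maps_def)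
  have "subtopology (higson_corona X) (corona_set X) homeomorphic_space higson_corona Y"
  proof (rule corona_part_homeomorphic[OF X Y f g, where s = "\<lambda>_. True"])
    show "\<forall>\<^sub>F x in at_inf X. True \<longrightarrow> mdist X x (g (f x)) \<le> max r s"
      using eventually_at_inf_mspace
      by eventually_elim (use r in \<open>force simp: mdist_commute intro: less_imp_le max.strict_coboundedI1\<close>)
    show "mdist Y y (f (g y)) \<le> max r s" if "y \<in> mspace Y" for y
      using s[OF that] mdist_commute[of Y y] by (simp add: max.coboundedI2)
  qed (use corona_map_filter(1)[OF Y X g] in auto)
  then show ?thesis
    by (simp flip: topspace_higson_corona[OF X])
qed

section \<open>Connected subsets of the corona\<close>

lemma corona_value_eventually_less:
  assumes "proper_metric X" "p \<in> corona_set X" "slowly_oscillating X f" "corona_value X p f < c"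
  shows "\<forall>\<^sub>F x in corona_filter X p. f x < c"
  using order_tendstoD(2)[OF corona_value_tendsto[OF assms(1-3)] assms(4)] .

lemma corona_value_eventually_greater:
  assumes "proper_metric X" "p \<in> corona_set X" "slowly_oscillating X f" "corona_value X p f > c"
  shows "\<forall>\<^sub>F x in corona_filter X p. f x > c"
  using order_tendstoD(1)[OF corona_value_tendsto[OF assms(1-3)] assms(4)] .

text \<open>The hypothesis says that all points of \<^term>\<open>W\<close> far from \<^term>\<open>B\<close> are joined by
  \<^term>\<open>r\<close>-chains in \<^term>\<open>W - B\<close>, phrased through sets invariant under \<^term>\<open>r\<close>-steps.\<close>
lemma corona_star_connected:
  assumes X: "proper_metric X" and W: "W \<subseteq> mspace X"
    and chain: "\<And>B. bounded_subset X B \<Longrightarrow> \<exists>B'. bounded_subset X B' \<and>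
      (\<forall>Q. (\<forall>x\<in>W - B. \<forall>y\<in>W - B. mdist X x y \<le> r \<longrightarrow> Q x \<longrightarrow> Q y) \<longrightarrow> (\<forall>x\<in>W - B'. \<forall>y\<in>W - B'. Q x \<longrightarrow> Q y))"
  shows "connectedin (higson_corona X) (corona_star X W)"
  unfolding connectedin_closedin
proof (intro conjI notI)
  show "corona_star X W \<subseteq> topspace (higson_corona X)"
    by (simp add: topspace_higson_corona[OF X] corona_star_subset)
  let ?S = "corona_star X W"
  assume "\<exists>E1 E2. closedin (higson_corona X) E1 \<and> closedin (higson_corona X) E2 \<and> ?S \<subseteq> E1 \<union> E2 \<and>
    E1 \<inter> E2 \<inter> ?S = {} \<and> E1 \<inter> ?S \<noteq> {} \<and> E2 \<inter> ?S \<noteq> {}"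
  then obtain E1 E2 where E: "closedin (higson_corona X) E1" "closedin (higson_corona X) E2" "?S \<subseteq> E1 \<union> E2"
    "E1 \<inter> E2 \<inter> ?S = {}" "E1 \<inter> ?S \<noteq> {}" "E2 \<inter> ?S \<noteq> {}" by blast
  have cl: "closedin (higson_corona X) (E1 \<inter> ?S)" "closedin (higson_corona X) (E2 \<inter> ?S)"
    using E closedin_higson_corona_star[OF X] by auto
  have "(E1 \<inter> ?S) \<inter> (E2 \<inter> ?S) = {}" using E(4) by blast
  from corona_Urysohn[OF X cl this] obtain \<phi> where so: "slowly_oscillating X \<phi>"
    and \<phi>0: "\<And>p. p \<in> E1 \<inter> ?S \<Longrightarrow> corona_value X p \<phi> = 0" and \<phi>1: "\<And>p. p \<in> E2 \<inter> ?S \<Longrightarrow> corona_value X p \<phi> = 1"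
    by metis
  have near0: "\<forall>\<^sub>F x in corona_filter X p. \<phi> x < 1/3" if "p \<in> E1 \<inter> ?S" for p
    using \<phi>0[OF that] that corona_star_subset[of X W] by (intro corona_value_eventually_less[OF X _ so]) auto
  have near1: "\<forall>\<^sub>F x in corona_filter X p. \<phi> x > 2/3" if "p \<in> E2 \<inter> ?S" for p
    using \<phi>1[OF that] that corona_star_subset[of X W] by (intro corona_value_eventually_greater[OF X _ so]) auto
  \<comment> \<open>The gap between the two closed pieces. If it were unbounded it would be seen by
    some point of the star, but at such points \<open>\<phi>\<close> tends to 0 or to 1.\<close>
  define V where "V = {x \<in> W. 1/3 \<le> \<phi> x \<and> \<phi> x \<le> 2/3}"
  have "bounded_subset X V"
  proof (rule ccontr)
    assume "\<not> bounded_subset X V"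
    then obtain p where p: "p \<in> corona_star X V" using corona_star_nonempty[of V X] W by (auto simp: V_def)
    then have "p \<in> ?S" using corona_star_mono[of V W X] by (auto simp: V_def)
    then consider "p \<in> E1 \<inter> ?S" | "p \<in> E2 \<inter> ?S" using E(3) by blast
    then have "\<forall>\<^sub>F x in corona_filter X p. x \<notin> V"
    proof cases
      case 1
      from near0[OF this] show ?thesis by (rule eventually_mono) (simp add: V_def)
    next
      case 2
      from near1[OF this] show ?thesis by (rule eventually_mono) (simp add: V_def)
    qed
    then show False using p by (auto simp: corona_star_def frequently_def)
  qed
  then have ev1: "\<forall>\<^sub>F x in at_inf X. x \<notin> V" by (auto simp: eventually_at_inf)
  have ev2: "\<forall>\<^sub>F x in at_inf X. \<forall>y\<in>mspace X. mdist X x y \<le> r \<longrightarrow> \<bar>\<phi> x - \<phi> y\<bar> < 1/3"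
    by (rule slowly_oscillatingD[OF so]) simp
  obtain B where B: "bounded_subset X B" "\<forall>x\<in>mspace X - B. x \<notin> V \<and> (\<forall>y\<in>mspace X. mdist X x y \<le> r \<longrightarrow> \<bar>\<phi> x - \<phi> y\<bar> < 1/3)"
    using eventually_conj[OF ev1 ev2] unfolding eventually_at_inf by blast
  obtain B' where B': "bounded_subset X B'" "\<And>Q. (\<forall>x\<in>W - B. \<forall>y\<in>W - B. mdist X x y \<le> r \<longrightarrow> Q x \<longrightarrow> Q y) \<Longrightarrow>
      (\<forall>x\<in>W - B'. \<forall>y\<in>W - B'. Q x \<longrightarrow> Q y)" using chain[OF B(1)] by blast
  \<comment> \<open>A step changes \<open>\<phi>\<close> by less than the width 1/3 of the gap,
    which contains no point of \<open>W\<close> outside \<open>B\<close>; so being below 1/3 is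
    inherited along chains.\<close>
  have "\<forall>x\<in>W - B. \<forall>y\<in>W - B. mdist X x y \<le> r \<longrightarrow> \<phi> x < 1/3 \<longrightarrow> \<phi> y < 1/3"
  proof (intro ballI impI)
    fix x y assume xy: "x \<in> W - B" "y \<in> W - B" "mdist X x y \<le> r" "\<phi> x < 1/3"
    then have "\<bar>\<phi> x - \<phi> y\<bar> < 1/3" "y \<notin> V" using B(2) W by blast+
    then show "\<phi> y < 1/3" using xy by (auto simp: V_def)
  qed
  from B'(2)[OF this] have same: "\<forall>x\<in>W - B'. \<forall>y\<in>W - B'. \<phi> x < 1/3 \<longrightarrow> \<phi> y < 1/3" .
  have out: "\<forall>\<^sub>F x in corona_filter X p. x \<notin> B'" for p
    by (rule eventually_corona_filter) (use B'(1) in \<open>auto simp: eventually_at_inf\<close>)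
  obtain p q where pq: "p \<in> E1 \<inter> ?S" "q \<in> E2 \<inter> ?S" using E by blast
  have W': "\<exists>\<^sub>F x in corona_filter X p. x \<in> W" "\<exists>\<^sub>F x in corona_filter X q. x \<in> W"
    using pq by (auto simp: corona_star_def)
  obtain x where "x \<in> W - B'" "\<phi> x < 1/3"
    using frequently_ex[OF frequently_eventually_frequently[OF W'(1) eventually_conj[OF out near0[OF pq(1)]]]] by blast
  moreover obtain y where "y \<in> W - B'" "\<phi> y > 2/3"
    using frequently_ex[OF frequently_eventually_frequently[OF W'(2) eventually_conj[OF out near1[OF pq(2)]]]] by blast
  ultimately have "\<phi> y < 1/3" using same by blast
  with \<open>\<phi> y > 2/3\<close> show False by linarith
qed

section \<open>Continua\<close>

lemma continuum_space_homeomorphic: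
  assumes "S homeomorphic_space T"
  shows "continuum_space S \<longleftrightarrow> continuum_space T"
  unfolding continuum_space_def
  using homeomorphic_empty_space[OF assms] homeomorphic_compact_space[OF assms]
    homeomorphic_connected_space[OF assms] homeomorphic_Hausdorff_space[OF assms] by auto

lemma decomposable_space_homeomorphic_imp:
  assumes "S homeomorphic_space T" "decomposable_space S"
  shows "decomposable_space T"
proof -
  obtain f where f: "homeomorphic_map S T f" using assms(1) homeomorphic_space by blast
  obtain A B where A: "A \<subset> topspace S" "continuum_space (subtopology S A)"
    and B: "B \<subset> topspace S" "continuum_space (subtopology S B)" and AB: "A \<union> B = topspace S"
    using assms(2) unfolding decomposable_space_def by blast
  have fT: "f ` topspace S = topspace T" "inj_on f (topspace S)"
    using f by (auto simp: homeomorphic_eq_everything_map)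
  have part: "f ` C \<subset> topspace T \<and> continuum_space (subtopology T (f ` C))"
    if C: "C \<subset> topspace S" "continuum_space (subtopology S C)" for C
  proof
    show "f ` C \<subset> topspace T"
      using inj_on_image_eq_iff[OF fT(2), of C "topspace S"] C(1) fT(1) by blast
    have "homeomorphic_map (subtopology S C) (subtopology T (f ` C)) f"
      by (rule homeomorphic_map_subtopologies[OF f]) (use C(1) fT in auto)
    then show "continuum_space (subtopology T (f ` C))"
      using C(2) continuum_space_homeomorphic homeomorphic_map_imp_homeomorphic_space by blast
  qed
  have "f ` A \<union> f ` B = topspace T" using AB fT by blast
  then show ?thesis using part[OF A] part[OF B] unfolding decomposable_space_def by blast
qed

lemma indecomposable_continuum_homeomorphic:
  assumes "S homeomorphic_space T" "indecomposable_continuum S"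
  shows "indecomposable_continuum T"
  using assms continuum_space_homeomorphic decomposable_space_homeomorphic_imp
  unfolding indecomposable_continuum_def by (metis homeomorphic_space_sym)

text \<open>The classical fact that a connected set together with one piece of a separation of its
  complement is connected. In a splitting of \<open>K \<union> E1\<close> the connected
  \<open>K\<close> avoids one side, say \<open>F2\<close>; then \<open>F2 \<inter> E1\<close> is
  open, and so is its complement \<open>F1 \<union> E2\<close> in the connected space.\<close>

lemma connectedin_Un_open_part:
  assumes T: "connected_space T" and K: "connectedin T K"
    and E: "openin T E1" "openin T E2" "E1 \<inter> E2 = {}" "K \<union> E1 \<union> E2 = topspace T" "K \<inter> E2 = {}"
  shows "connectedin T (K \<union> E1)"
  unfolding connectedin
proof (intro conjI notI)
  show "K \<union> E1 \<subseteq> topspace T" using E(4) by blast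
  assume "\<exists>F1 F2. openin T F1 \<and> openin T F2 \<and> K \<union> E1 \<subseteq> F1 \<union> F2 \<and> F1 \<inter> F2 \<inter> (K \<union> E1) = {} \<and>
    F1 \<inter> (K \<union> E1) \<noteq> {} \<and> F2 \<inter> (K \<union> E1) \<noteq> {}"
  then obtain F1 F2 where F: "openin T F1" "openin T F2" "K \<union> E1 \<subseteq> F1 \<union> F2" "F1 \<inter> F2 \<inter> (K \<union> E1) = {}"
    "F1 \<inter> (K \<union> E1) \<noteq> {}" "F2 \<inter> (K \<union> E1) \<noteq> {}" by blast
  have *: False if F: "openin T F1" "openin T F2" "K \<union> E1 \<subseteq> F1 \<union> F2" "F1 \<inter> F2 \<inter> (K \<union> E1) = {}"
    "F1 \<inter> (K \<union> E1) \<noteq> {}" "F2 \<inter> (K \<union> E1) \<noteq> {}" and K2: "K \<inter> F2 = {}" for F1 F2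
  proof -
    have "openin T (F1 \<union> E2)" "openin T (F2 \<inter> E1)" using F E by auto
    moreover have "topspace T \<subseteq> (F1 \<union> E2) \<union> (F2 \<inter> E1)" using E(4) F(3) K2 by blast
    moreover have "(F1 \<union> E2) \<inter> (F2 \<inter> E1) = {}" using F(4) E(3) by blast
    moreover have "F1 \<union> E2 \<noteq> {}" using F(5) by blast
    moreover have "F2 \<inter> E1 \<noteq> {}" using F(6) K2 by blast
    ultimately show False using T unfolding connected_space_def by blast
  qed
  have "K \<inter> F1 = {} \<or> K \<inter> F2 = {}"
  proof (rule ccontr)
    assume "\<not> ?thesis"
    then have "F1 \<inter> K \<noteq> {}" "F2 \<inter> K \<noteq> {}" "K \<subseteq> F1 \<union> F2" "F1 \<inter> F2 \<inter> K = {}" using F by blast+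
    then show False using K F(1,2) unfolding connectedin by blast
  qed
  then show False
  proof
    assume "K \<inter> F2 = {}" then show False using * F by metis
  next
    assume "K \<inter> F1 = {}"
    moreover have "K \<union> E1 \<subseteq> F2 \<union> F1" "F2 \<inter> F1 \<inter> (K \<union> E1) = {}" using F by blast+
    ultimately show False using *[of F2 F1] F by metis
  qed
qed

lemma continuum_subspaceI:
  assumes "continuum_space T" "closedin T L" "connectedin T L" "L \<noteq> {}"
  shows "continuum_space (subtopology T L)"
proof -
  have "L \<subseteq> topspace T" using assms(2) closedin_subset by blast
  moreover have "compactin T L" using assms(1,2) closedin_compact_space unfolding continuum_space_def by blast
  ultimately show ?thesis
    using assms unfolding continuum_space_def connectedin_def compactin_subspace
    by (auto simp: Hausdorff_space_subtopology Int_absorb1)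
qed

text \<open>In an indecomposable continuum proper subcontinua have empty interior. If the complement
  of \<open>K\<close> is connected, its closure misses \<open>V\<close> and is the second piece. If
  it splits into \<open>E1\<close> and \<open>E2\<close>, the pieces are
  \<open>K \<union> E1\<close> and \<open>K \<union> E2\<close>.\<close>

lemma decomposable_spaceI:
  assumes T: "continuum_space T" and K: "closedin T K" "connectedin T K" "K \<noteq> topspace T"
    and V: "openin T V" "V \<noteq> {}" "V \<subseteq> K"
  shows "decomposable_space T"
proof -
  let ?W = "topspace T - K"
  have Kt: "K \<subset> topspace T" using K closedin_subset by blast
  have W: "openin T ?W" "?W \<noteq> {}" using K Kt by (auto simp: closedin_def)
  have conn: "connected_space T" using T by (simp add: continuum_space_def)
  show ?thesis
  proof (cases "connectedin T ?W")
    case True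
    let ?L = "T closure_of ?W"
    have Lt: "?L \<subseteq> topspace T" by (rule closure_of_subset_topspace)
    have WL: "?W \<subseteq> ?L" by (rule closure_of_subset) blast
    have "?L \<subseteq> topspace T - V" by (rule closure_of_minimal) (use V in auto)
    then have "?L \<subset> topspace T" using V openin_subset by blast
    moreover have "continuum_space (subtopology T ?L)"
      using W(2) WL by (intro continuum_subspaceI[OF T] connectedin_closure_of[OF True]) auto
    moreover have "continuum_space (subtopology T K)" by (rule continuum_subspaceI[OF T K(1,2)]) (use V in blast)
    moreover have "K \<union> ?L = topspace T" using WL Lt Kt by blast
    ultimately show ?thesis using Kt unfolding decomposable_space_def by blast
  next
    case False
    then obtain F1 F2 where F: "openin T F1" "openin T F2" "?W \<subseteq> F1 \<union> F2" "F1 \<inter> F2 \<inter> ?W = {}"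
      "F1 \<inter> ?W \<noteq> {}" "F2 \<inter> ?W \<noteq> {}"
      unfolding connectedin by blast
    define E1 where "E1 = F1 \<inter> ?W"
    define E2 where "E2 = F2 \<inter> ?W"
    have E: "openin T E1" "openin T E2" "E1 \<inter> E2 = {}" "K \<union> E1 \<union> E2 = topspace T" "K \<inter> E1 = {}" "K \<inter> E2 = {}"
      "E1 \<noteq> {}" "E2 \<noteq> {}"
      using F W Kt by (auto simp: E1_def E2_def)
    have c1: "connectedin T (K \<union> E1)" by (rule connectedin_Un_open_part[OF conn K(2) E(1-4,6)])
    have "E2 \<inter> E1 = {}" "K \<union> E2 \<union> E1 = topspace T" using E by blast+
    then have c2: "connectedin T (K \<union> E2)" using connectedin_Un_open_part[OF conn K(2) E(2,1)] E(5) by blast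
    have "K \<union> E1 = topspace T - E2" "K \<union> E2 = topspace T - E1"
      using E openin_subset[OF E(1)] openin_subset[OF E(2)] Kt by auto
    then have cl: "closedin T (K \<union> E1)" "closedin T (K \<union> E2)" "K \<union> E1 \<subset> topspace T" "K \<union> E2 \<subset> topspace T"
      using E openin_subset[OF E(1)] openin_subset[OF E(2)] by auto
    have "continuum_space (subtopology T (K \<union> E1))" "continuum_space (subtopology T (K \<union> E2))"
      using E by (auto intro!: continuum_subspaceI[OF T] cl c1 c2)
    moreover have "(K \<union> E1) \<union> (K \<union> E2) = topspace T" using E(4) by blast
    ultimately show ?thesis using cl(3,4) unfolding decomposable_space_def by blast
  qed
qed

lemma homeomorphic_sum_clopen:
  assumes "openin T U" "closedin T U"
  shows "T homeomorphic_space sum_topology (\<lambda>b. subtopology T (if b then U else topspace T - U)) UNIV"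
    (is "_ homeomorphic_space ?S")
proof -
  have U: "U \<subseteq> topspace T" using assms openin_subset by blast
  have op: "openin T (if b then U else topspace T - U)" for b
    using assms by (auto simp: closedin_def)
  have "homeomorphic_map ?S T snd"
  proof (rule bijective_open_imp_homeomorphic_map)
    show "continuous_map ?S T snd"
      unfolding continuous_map_def openin_sum_topology
    proof (intro conjI allI impI ballI)
      fix V and b :: bool assume V: "openin T V"
      have "{x. (b, x) \<in> {x \<in> topspace ?S. snd x \<in> V}} = (if b then U else topspace T - U) \<inter> V"
        using U by auto
      also have "openin (subtopology T (if b then U else topspace T - U)) \<dots>"
        using V by (simp add: openin_subtopology_Int2)
      finally show "openin (subtopology T (if b then U else topspace T - U)) {x. (b, x) \<in> {x \<in> topspace ?S. snd x \<in> V}}" .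
    qed auto
    show "open_map ?S T snd"
      unfolding open_map_def
    proof (intro allI impI)
      fix V assume V: "openin ?S V"
      have "openin T {x. (b, x) \<in> V}" for b
        using V op[of b] unfolding openin_sum_topology by (metis UNIV_I openin_trans_full)
      moreover have "snd ` V = (\<Union>b. {x. (b, x) \<in> V})" by force
      ultimately show "openin T (snd ` V)" by auto
    qed
    show "snd ` topspace ?S = topspace T"
    proof (intro equalityI subsetI)
      fix x assume "x \<in> topspace T"
      then have "(x \<in> U, x) \<in> topspace ?S" by auto
      then show "x \<in> snd ` topspace ?S" by force
    qed auto
    show "inj_on snd (topspace ?S)"
      by (auto simp: inj_on_def split: if_splits)
  qed
  then show ?thesis
    using homeomorphic_map_imp_homeomorphic_space homeomorphic_space_sym by blast
qed

text \<open>Turns an abstract sum decomposition into a clopen subset of the space itself, which can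
  then be described by a function on the underlying metric space.\<close>

lemma homeomorphic_sum_parts:
  assumes "T homeomorphic_space sum_topology C (UNIV :: bool set)"
  obtains U where "openin T U" "closedin T U" "subtopology T U homeomorphic_space C True"
    "subtopology T (topspace T - U) homeomorphic_space C False"
proof -
  let ?S = "sum_topology C (UNIV :: bool set)"
  obtain f where f: "homeomorphic_map ?S T f" using assms homeomorphic_space homeomorphic_space_sym by metis
  define P where "P = (\<lambda>b. Pair b ` topspace (C b))"
  have fT: "f ` topspace ?S = topspace T" "inj_on f (topspace ?S)"
    using f by (auto simp: homeomorphic_eq_everything_map)
  have top: "topspace ?S = P True \<union> P False"
  proof (intro equalityI subsetI)
    fix z assume "z \<in> topspace ?S"
    then show "z \<in> P True \<union> P False" by (cases z; cases "fst z") (auto simp: P_def)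
  qed (auto simp: P_def)
  have sub: "P b \<subseteq> topspace ?S" for b by (auto simp: P_def)
  have "openin ?S (P b)" "closedin ?S (P b)" for b
    using open_map_component_injection[of b UNIV C] closed_map_component_injection[of b UNIV C]
    by (auto simp: P_def open_map_def closed_map_def)
  then have "openin T (f ` P b)" "closedin T (f ` P b)" for b
    using f homeomorphic_imp_open_map homeomorphic_imp_closed_map unfolding open_map_def closed_map_def by metis+
  moreover have "subtopology T (f ` P b) homeomorphic_space C b" for b
  proof -
    have "homeomorphic_map (subtopology ?S (P b)) (subtopology T (f ` P b)) f"
      by (rule homeomorphic_map_subtopologies[OF f]) (use sub[of b] fT in auto)
    moreover have "homeomorphic_map (C b) (subtopology ?S (P b)) (Pair b)"
      using embedding_map_component_injection[of b UNIV C] by (simp add: embedding_map_def P_def)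
    ultimately show ?thesis
      using homeomorphic_map_imp_homeomorphic_space homeomorphic_space_sym homeomorphic_space_trans by metis
  qed
  moreover have "topspace T - f ` P True = f ` P False"
  proof -
    have "P True \<inter> P False = {}" by (auto simp: P_def)
    then have "f ` P True \<inter> f ` P False = {}" using inj_on_image_Int[OF fT(2) sub sub] by (metis image_empty)
    then show ?thesis using fT(1) unfolding top by blast
  qed
  ultimately show thesis using that[of "f ` P True"] by metis
qed

section \<open>Divergent sets\<close>

definition set_dist :: "'a metric \<Rightarrow> 'a set \<Rightarrow> 'a \<Rightarrow> real" where
  "set_dist X A x = (INF a\<in>A. mdist X x a)"

lemma set_dist_bdd: "bdd_below ((\<lambda>a. mdist X x a) ` A)"
  by (rule bdd_belowI2[of _ 0]) simp

lemma set_dist_le: "a \<in> A \<Longrightarrow> set_dist X A x \<le> mdist X x a"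
  unfolding set_dist_def by (rule cINF_lower[OF set_dist_bdd])

lemma set_dist_geI: "A \<noteq> {} \<Longrightarrow> (\<And>a. a \<in> A \<Longrightarrow> c \<le> mdist X x a) \<Longrightarrow> c \<le> set_dist X A x"
  unfolding set_dist_def by (rule cINF_greatest)

lemma set_dist_nonneg: "A \<noteq> {} \<Longrightarrow> 0 \<le> set_dist X A x"
  by (rule set_dist_geI) auto

lemma set_dist_lessE:
  assumes "A \<noteq> {}" "set_dist X A x < c"
  obtains a where "a \<in> A" "mdist X x a < c"
  using assms set_dist_geI[of A c X x] by (meson not_less)

lemma set_dist_Lipschitz:
  assumes A: "A \<noteq> {}" "A \<subseteq> mspace X" and x: "x \<in> mspace X" "y \<in> mspace X"
  shows "\<bar>set_dist X A x - set_dist X A y\<bar> \<le> mdist X x y"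
proof -
  have "set_dist X A x - mdist X x y \<le> set_dist X A y" if x: "x \<in> mspace X" "y \<in> mspace X" for x y
  proof (rule set_dist_geI[OF A(1)])
    fix a assume a: "a \<in> A"
    then have "mdist X x a \<le> mdist X x y + mdist X y a" using A(2) x by (intro mdist_triangle) auto
    then show "set_dist X A x - mdist X x y \<le> mdist X y a" using set_dist_le[OF a, of X x] by linarith
  qed
  from this[OF x] this[OF x(2,1)] show ?thesis using mdist_commute[of X x y] by linarith
qed

text \<open>The numerator of the difference is at most \<open>(a + b) * r\<close>, which cancels the
  first denominator. A bound on the other denominator alone therefore suffices.\<close>

lemma quotient_diff_le:
  fixes a b a' b' r :: real
  assumes "a \<ge> 0" "b \<ge> 0" "a + b > 0" "a' + b' > 0" "\<bar>a - a'\<bar> \<le> r" "\<bar>b - b'\<bar> \<le> r"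
  shows "\<bar>a / (a + b) - a' / (a' + b')\<bar> \<le> r / (a' + b')"
proof -
  have eq: "a / (a + b) - a' / (a' + b') = (a * (b' - b) + b * (a - a')) / ((a + b) * (a' + b'))"
    using assms(3,4) by (simp add: field_simps)
  have "\<bar>a * (b' - b) + b * (a - a')\<bar> \<le> a * \<bar>b' - b\<bar> + b * \<bar>a - a'\<bar>"
    using assms(1,2) abs_triangle_ineq[of "a * (b' - b)" "b * (a - a')"] by (simp add: abs_mult)
  also have "\<dots> \<le> a * r + b * r" using assms by (intro add_mono mult_left_mono) auto
  finally have *: "\<bar>a * (b' - b) + b * (a - a')\<bar> \<le> (a + b) * r" by (simp add: algebra_simps)
  have "\<bar>a / (a + b) - a' / (a' + b')\<bar> = \<bar>a * (b' - b) + b * (a - a')\<bar> / ((a + b) * (a' + b'))"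
    unfolding eq abs_divide using assms(3,4) by (simp only: abs_of_pos mult_pos_pos)
  also have "\<dots> \<le> ((a + b) * r) / ((a + b) * (a' + b'))"
    using * assms(3,4) by (intro divide_right_mono) auto
  also have "\<dots> = r / (a' + b')" using assms(3) by simp
  finally show ?thesis .
qed

text \<open>The Urysohn quotient of the two distance functions. Both are 1-Lipschitz, and divergence
  of the sets makes the denominator tend to infinity, so the quotient oscillates slowly.\<close>

lemma divergent_separation:
  assumes A: "A \<noteq> {}" "A \<subseteq> mspace X" and B: "B \<noteq> {}" "B \<subseteq> mspace X"
    and div: "\<And>R. bounded_subset X {x \<in> mspace X. (\<exists>a\<in>A. mdist X x a \<le> R) \<and> (\<exists>b\<in>B. mdist X x b \<le> R)}"
  obtains \<phi> where "slowly_oscillating X \<phi>" "\<forall>\<^sub>F x in at_inf X. (x \<in> A \<longrightarrow> \<phi> x = 0) \<and> (x \<in> B \<longrightarrow> \<phi> x = 1)"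
proof -
  let ?a = "set_dist X A" and ?b = "set_dist X B"
  define \<phi> where "\<phi> = (\<lambda>x. ?a x / (?a x + ?b x))"
  have large: "\<forall>\<^sub>F x in at_inf X. ?a x + ?b x > R" for R
    unfolding eventually_at_inf
  proof (intro exI conjI ballI)
    \<comment> \<open>The infimum in \<open>set_dist\<close> need not be attained; the additional 1
      provides actual points of \<open>A\<close> and \<open>B\<close>.\<close>
    show "bounded_subset X {x \<in> mspace X. (\<exists>a\<in>A. mdist X x a \<le> R + 1) \<and> (\<exists>b\<in>B. mdist X x b \<le> R + 1)}"
      by (rule div)
    fix x assume x: "x \<in> mspace X - {x \<in> mspace X. (\<exists>a\<in>A. mdist X x a \<le> R + 1) \<and> (\<exists>b\<in>B. mdist X x b \<le> R + 1)}"
    show "?a x + ?b x > R"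
    proof (rule ccontr)
      assume "\<not> ?a x + ?b x > R"
      then have "?a x < R + 1" "?b x < R + 1"
        using set_dist_nonneg[OF A(1), of X x] set_dist_nonneg[OF B(1), of X x] by linarith+
      then show False
        using x set_dist_lessE[OF A(1)] set_dist_lessE[OF B(1)] by (metis (mono_tags, lifting) DiffE less_imp_le mem_Collect_eq)
    qed
  qed
  have "slowly_oscillating X \<phi>"
    unfolding slowly_oscillating_def
  proof (intro conjI allI impI)
    show "bounded (\<phi> ` mspace X)"
    proof (rule boundedI)
      fix y assume "y \<in> \<phi> ` mspace X"
      then obtain x where "y = \<phi> x" by blast
      then show "norm y \<le> 1"
        using set_dist_nonneg[OF A(1), of X x] set_dist_nonneg[OF B(1), of X x]
        by (auto simp: \<phi>_def divide_le_eq_1)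
    qed
    fix r \<epsilon> :: real assume "\<epsilon> > 0"
    let ?R = "max 0 (r / \<epsilon>)"
    show "\<forall>\<^sub>F x in at_inf X. \<forall>y\<in>mspace X. mdist X x y \<le> r \<longrightarrow> \<bar>\<phi> x - \<phi> y\<bar> < \<epsilon>"
      using large[of 0] eventually_at_inf_thicken[OF large[of ?R], of r] eventually_at_inf_mspace
    proof eventually_elim
      case (elim x)
      show ?case
      proof (intro ballI impI)
        fix y assume y: "y \<in> mspace X" "mdist X x y \<le> r"
        then have s: "?a y + ?b y > 0" "?a y + ?b y > r / \<epsilon>" using elim(2) by auto
        have "\<bar>\<phi> x - \<phi> y\<bar> \<le> r / (?a y + ?b y)"
          unfolding \<phi>_def
          using set_dist_Lipschitz[OF A elim(3) y(1)] set_dist_Lipschitz[OF B elim(3) y(1)] y(2) elim(1) s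
          by (intro quotient_diff_le set_dist_nonneg A B) auto
        also have "\<dots> < \<epsilon>" using s \<open>\<epsilon> > 0\<close> by (simp add: field_simps)
        finally show "\<bar>\<phi> x - \<phi> y\<bar> < \<epsilon>" .
      qed
    qed
  qed
  moreover have "\<forall>\<^sub>F x in at_inf X. (x \<in> A \<longrightarrow> \<phi> x = 0) \<and> (x \<in> B \<longrightarrow> \<phi> x = 1)"
    using large[of 0] eventually_at_inf_mspace
  proof eventually_elim
    case (elim x)
    have "?a x = 0" if "x \<in> A" using set_dist_le[OF that, of X x] set_dist_nonneg[OF A(1), of X x] elim by simp
    moreover have "?b x = 0" if "x \<in> B" using set_dist_le[OF that, of X x] set_dist_nonneg[OF B(1), of X x] elim by simp
    ultimately show ?case using elim by (auto simp: \<phi>_def)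
  qed
  ultimately show thesis by (rule that)
qed

lemma corona_value_on_star:
  assumes X: "proper_metric X" and so: "slowly_oscillating X \<phi>"
    and c: "\<forall>\<^sub>F x in at_inf X. x \<in> A \<longrightarrow> \<phi> x = c" and p: "p \<in> corona_star X A"
  shows "corona_value X p \<phi> = c"
proof (rule ccontr)
  assume ne: "corona_value X p \<phi> \<noteq> c"
  have "p \<in> corona_set X" using p corona_star_subset by blast
  from corona_value_tendsto[OF X this so]
  have "\<forall>\<^sub>F x in corona_filter X p. dist (\<phi> x) (corona_value X p \<phi>) < dist c (corona_value X p \<phi>)"
    using ne by (intro tendstoD) auto
  then have "\<forall>\<^sub>F x in corona_filter X p. x \<notin> A"
    using eventually_corona_filter[OF c] by eventually_elim auto
  then show False using p by (auto simp: corona_star_def frequently_def)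
qed

text \<open>At a common point the separating function would have both values 0 and 1.\<close>

lemma corona_star_disjoint:
  assumes X: "proper_metric X" and A: "A \<noteq> {}" "A \<subseteq> mspace X" and B: "B \<noteq> {}" "B \<subseteq> mspace X"
    and div: "\<And>R. bounded_subset X {x \<in> mspace X. (\<exists>a\<in>A. mdist X x a \<le> R) \<and> (\<exists>b\<in>B. mdist X x b \<le> R)}"
  shows "corona_star X A \<inter> corona_star X B = {}"
proof -
  obtain \<phi> where \<phi>: "slowly_oscillating X \<phi>" "\<forall>\<^sub>F x in at_inf X. (x \<in> A \<longrightarrow> \<phi> x = 0) \<and> (x \<in> B \<longrightarrow> \<phi> x = 1)"
    by (rule divergent_separation[OF A B div])
  have "\<forall>\<^sub>F x in at_inf X. x \<in> A \<longrightarrow> \<phi> x = 0" "\<forall>\<^sub>F x in at_inf X. x \<in> B \<longrightarrow> \<phi> x = 1"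
    using \<phi>(2) by (auto elim: eventually_mono)
  then have "corona_value X p \<phi> = 0" "corona_value X p \<phi> = 1"
    if "p \<in> corona_star X A" "p \<in> corona_star X B" for p
    using that corona_value_on_star[OF X \<phi>(1)] by blast+
  then show ?thesis by fastforce
qed

section \<open>The corona of the natural numbers\<close>

lemma proper_metricI_finite:
  assumes "\<And>x r. x \<in> mspace X \<Longrightarrow> finite (mcball_of X x r)"
  shows "proper_metric X"
  unfolding proper_metric_def using assms by (auto intro!: finite_imp_compactin)

lemma finite_mcball_nat: "finite (mcball_of nat_metric n r)"
proof (rule finite_subset)
  show "mcball_of nat_metric n r \<subseteq> {..n + nat \<lceil>r\<rceil>}" by auto linarith
qed simp

lemma proper_nat_metric: "proper_metric nat_metric"
  by (rule proper_metricI_finite) (rule finite_mcball_nat)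

lemma bounded_subset_nat_iff: "bounded_subset nat_metric B \<longleftrightarrow> finite B"
proof
  assume "bounded_subset nat_metric B"
  then obtain r where "\<forall>x\<in>B. mdist nat_metric 0 x \<le> r" using bounded_subset_iff_center[of 0 nat_metric B] by auto
  then have "B \<subseteq> mcball_of nat_metric 0 r" by auto
  then show "finite B" using finite_mcball_nat finite_subset by blast
next
  assume "finite B"
  then have "mdist nat_metric 0 x \<le> real (Max B)" if "x \<in> B" for x using that by simp
  then have "\<exists>r. \<forall>x\<in>B. mdist nat_metric 0 x \<le> r" by blast
  then show "bounded_subset nat_metric B" using bounded_subset_iff_center[of 0 nat_metric B] by simp
qed

text \<open>Tails of the naturals are joined by unit steps that stay inside the tail, so
  \<open>corona_star_connected\<close> applies to the whole space.\<close>

lemma corona_nat_continuum: "continuum_space (higson_corona nat_metric)"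
proof -
  note N = proper_nat_metric
  have "corona_star nat_metric UNIV \<noteq> {}"
    by (rule corona_star_nonempty) (auto simp: bounded_subset_nat_iff)
  moreover have "connectedin (higson_corona nat_metric) (corona_star nat_metric UNIV)"
  proof (rule corona_star_connected[OF N, where r = 1])
    fix B assume "bounded_subset nat_metric B"
    then obtain n where n: "B \<subseteq> {..<n}" using finite_nat_bounded bounded_subset_nat_iff by blast
    have "\<forall>x\<in>UNIV - {..<n}. \<forall>y\<in>UNIV - {..<n}. Q x \<longrightarrow> Q y"
      if Q: "\<forall>x\<in>UNIV - B. \<forall>y\<in>UNIV - B. mdist nat_metric x y \<le> 1 \<longrightarrow> Q x \<longrightarrow> Q y" for Q
    proof -
      have "Q (n + k) \<longleftrightarrow> Q n" for k
      proof (induction k)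
        case (Suc k)
        have "n + k \<in> UNIV - B" "n + Suc k \<in> UNIV - B" using n by auto
        from Q[rule_format, OF this] Q[rule_format, OF this(2,1)]
        have "Q (n + k) \<longleftrightarrow> Q (n + Suc k)" by auto
        then show ?case using Suc by simp
      qed simp
      then have Qn: "Q x \<longleftrightarrow> Q n" if "x \<ge> n" for x using le_add_diff_inverse[OF that] by metis
      show ?thesis
      proof (intro ballI impI)
        fix x y assume "x \<in> UNIV - {..<n}" "y \<in> UNIV - {..<n}" "Q x"
        then show "Q y" using Qn[of x] Qn[of y] by simp
      qed
    qed
    moreover have "bounded_subset nat_metric {..<n}" by (simp add: bounded_subset_nat_iff)
    ultimately show "\<exists>B'. bounded_subset nat_metric B' \<and>
      (\<forall>Q. (\<forall>x\<in>UNIV - B. \<forall>y\<in>UNIV - B. mdist nat_metric x y \<le> 1 \<longrightarrow> Q x \<longrightarrow> Q y) \<longrightarrow>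
        (\<forall>x\<in>UNIV - B'. \<forall>y\<in>UNIV - B'. Q x \<longrightarrow> Q y))" by blast
  qed simp
  ultimately show ?thesis
    unfolding continuum_space_def
    using compact_higson_corona[OF N] Hausdorff_higson_corona[OF N]
    by (simp add: corona_star_UNIV topspace_higson_corona[OF N] flip: connectedin_topspace)
qed

lemma alternating_sequence:
  assumes "infinite (P :: nat set)" "infinite Q"
  obtains s :: "nat \<Rightarrow> nat" where "strict_mono s" "\<And>i. s (2 * i) \<in> Q" "\<And>i. s (Suc (2 * i)) \<in> P"
proof -
  have ex: "\<exists>y>x. y \<in> (if even n then Q else P)" for x n :: nat
    using assms by (auto simp: infinite_nat_iff_unbounded)
  have "\<exists>s. \<forall>n. s n \<in> (if even n then Q else P) \<and> s n < s (Suc n)"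
  proof (rule dependent_nat_choice)
    show "\<exists>x. x \<in> (if even (0::nat) then Q else P)" using ex[of 0 0] by blast
    show "\<exists>y. y \<in> (if even (Suc n) then Q else P) \<and> x < y" for x n using ex[of x "Suc n"] by blast
  qed
  then obtain s where s: "\<And>n. s n \<in> (if even n then Q else P)" "\<And>n. s n < s (Suc n)" by blast
  show thesis
  proof (rule that)
    show "strict_mono s" using s(2) by (simp add: strict_mono_Suc_iff)
    show "s (2 * i) \<in> Q" "s (Suc (2 * i)) \<in> P" for i
      using s(1)[of "2 * i"] s(1)[of "Suc (2 * i)"] by simp_all
  qed
qed

text \<open>If the corona were a union of proper subcontinua \<^term>\<open>A\<close> and \<^term>\<open>B\<close>, choose infinite sets \<^term>\<open>P\<close> and
  \<^term>\<open>Q\<close> staying away from \<^term>\<open>A\<close> and \<^term>\<open>B\<close>, and alternate between them. A function that jumps between 0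
  and 1 only at points of \<^term>\<open>Q\<close> is slowly oscillating near \<^term>\<open>B\<close>; as it takes both values on
  \<^term>\<open>P\<close>, whose limit points lie in \<^term>\<open>B\<close>, it disconnects \<^term>\<open>B\<close>.\<close>
lemma corona_nat_indecomposable: "indecomposable_continuum (higson_corona nat_metric)"
proof -
  note N = proper_nat_metric
  let ?T = "higson_corona nat_metric"
  have False if dec: "decomposable_space ?T"
  proof -
    obtain A B where A: "A \<subset> topspace ?T" "continuum_space (subtopology ?T A)"
      and B: "B \<subset> topspace ?T" "continuum_space (subtopology ?T B)" and AB: "A \<union> B = topspace ?T"
      using dec unfolding decomposable_space_def by blast
    have cl: "closedin ?T C" if "C \<subset> topspace ?T" "continuum_space (subtopology ?T C)" for C
      using that compactin_imp_closedin[OF Hausdorff_higson_corona[OF N]]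
      by (auto simp: continuum_space_def compactin_subspace)
    have conB: "connectedin ?T B" using B by (auto simp: continuum_space_def connectedin_def)
    have top: "topspace ?T = corona_set nat_metric" by (rule topspace_higson_corona[OF N])
    \<comment> \<open>A point outside the proper subcontinuum \<open>C\<close> yields a function
      that is 1 on \<open>C\<close> but below 1/2 infinitely often; these integers are the ones
      staying away from \<open>C\<close>.\<close>
    have far: "\<exists>\<phi>. slowly_oscillating nat_metric \<phi> \<and> infinite {n. \<phi> n < 1/2} \<and> (\<forall>q\<in>C. corona_value nat_metric q \<phi> = 1)"
      if C: "C \<subset> topspace ?T" "continuum_space (subtopology ?T C)" for C
    proof -
      obtain p where p: "p \<in> corona_set nat_metric" "p \<notin> C" using C(1) top by blast
      obtain \<phi> where \<phi>: "slowly_oscillating nat_metric \<phi>" "corona_value nat_metric p \<phi> = 0"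
        "\<forall>q\<in>C. corona_value nat_metric q \<phi> = 1"
        using corona_separate_point[OF N p(1) cl[OF C] p(2)] by blast
      have "infinite {n. \<phi> n < 1/2}"
      proof
        assume "finite {n. \<phi> n < 1/2}"
        then have "\<forall>\<^sub>F n in at_inf nat_metric. \<not> \<phi> n < 1/2"
          unfolding eventually_at_inf bounded_subset_nat_iff by blast
        then have "\<forall>\<^sub>F n in corona_filter nat_metric p. \<not> \<phi> n < 1/2" by (rule eventually_corona_filter)
        moreover have "\<forall>\<^sub>F n in corona_filter nat_metric p. \<phi> n < 1/2"
          using \<phi>(2) by (intro corona_value_eventually_less[OF N p(1) \<phi>(1)]) simp
        ultimately have "\<forall>\<^sub>F n in corona_filter nat_metric p. False" by eventually_elim simp
        then show False using corona_filter_neq_bot[OF p(1)] by simp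
      qed
      then show ?thesis using \<phi> by blast
    qed
    obtain \<phi> where \<phi>: "slowly_oscillating nat_metric \<phi>" "infinite {n. \<phi> n < 1/2}"
      "\<forall>q\<in>A. corona_value nat_metric q \<phi> = 1" using far[OF A] by blast
    obtain \<psi> where \<psi>: "slowly_oscillating nat_metric \<psi>" "infinite {n. \<psi> n < 1/2}"
      "\<forall>q\<in>B. corona_value nat_metric q \<psi> = 1" using far[OF B] by blast
    \<comment> \<open>Even indices give points staying away from \<open>B\<close>, odd indices
      points staying away from \<open>A\<close>.\<close>
    obtain s :: "nat \<Rightarrow> nat" where s: "strict_mono s" "\<And>i. \<psi> (s (2 * i)) < 1/2" "\<And>i. \<phi> (s (Suc (2 * i))) < 1/2"
      using alternating_sequence[OF \<phi>(2) \<psi>(2)] by auto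
    have starB: "p \<in> B" if "p \<in> corona_star nat_metric V" "V \<subseteq> {n. \<phi> n < 1/2}" for p V
    proof -
      have p: "p \<in> corona_set nat_metric" using that corona_star_subset by blast
      have "p \<notin> A"
      proof
        assume "p \<in> A"
        then have "\<forall>\<^sub>F n in corona_filter nat_metric p. \<phi> n > 1/2"
          using \<phi>(3) by (intro corona_value_eventually_greater[OF N p \<phi>(1)]) simp
        then have "\<forall>\<^sub>F n in corona_filter nat_metric p. n \<notin> V"
          by eventually_elim (use that(2) in force)
        then show False using that(1) by (auto simp: corona_star_def frequently_def)
      qed
      then show ?thesis using p AB top by blast
    qed
    \<comment> \<open>Blocks open at \<open>s (4 * i)\<close> and close at
      \<open>s (4 * i + 2)\<close>, that is only where \<open>\<psi>\<close> is below 1/2. The odd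
      points \<open>s (4 * i + 1)\<close> lie inside a block and \<open>s (4 * i + 3)\<close>
      outside all of them.\<close>
    define blk where "blk = (\<lambda>n. \<exists>i. s (4 * i) \<le> n \<and> n < s (4 * i + 2))"
    have s4: "\<psi> (s (4 * i)) < 1/2" "\<psi> (s (4 * i + 2)) < 1/2" for i
      using s(2)[of "2 * i"] s(2)[of "2 * i + 1"] by (simp_all add: algebra_simps)
    have blk_eq: "blk n \<longleftrightarrow> blk m" if nm: "n \<le> m" "\<And>k. n \<le> k \<Longrightarrow> k \<le> m \<Longrightarrow> \<psi> k \<ge> 1/2" for n m
      
    proof -
      have "n < s j \<longleftrightarrow> m < s j" if "\<psi> (s j) < 1/2" for j
        using nm(1) nm(2)[of "s j"] that by linarith
      then have "s (4 * i) \<le> n \<longleftrightarrow> s (4 * i) \<le> m" "n < s (4 * i + 2) \<longleftrightarrow> m < s (4 * i + 2)" for i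
        using s4[of i] by (simp_all add: not_less[symmetric])
      then show ?thesis unfolding blk_def by simp
    qed
    \<comment> \<open>A cut-off that is 1 where \<open>\<psi>\<close> is 1 and vanishes for
      \<open>\<psi>\<close> up to 3/4, well before the block boundaries are reached. Restricting it
      to the blocks therefore creates no jump. Its slope 4 is the reason for
      \<open>\<epsilon>/4\<close> below.\<close>
    define u where "u = (\<lambda>n. max 0 (4 * \<psi> n - 3))"
    define g where "g = (\<lambda>n. if blk n then u n else 0)"
    have gsmall: "g n = 0" if "\<psi> n \<le> 3/4" for n using that by (simp add: g_def u_def)
    have g01: "\<forall>n. \<bar>g n\<bar> \<le> u n" by (simp add: g_def u_def)
    have so_u: "slowly_oscillating nat_metric u"
      unfolding u_def
      by (rule slowly_oscillating_compose[OF \<psi>(1), where k = "\<lambda>v. max 0 (4 * v - 3)"]) (intro continuous_intros)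
    have so_g: "slowly_oscillating nat_metric g"
      unfolding slowly_oscillating_def
    proof (intro conjI allI impI)
      obtain M where M: "\<And>x. x \<in> mspace nat_metric \<Longrightarrow> \<bar>u x\<bar> \<le> M" using slowly_oscillating_bound[OF so_u] by metis
      show "bounded (g ` mspace nat_metric)"
      proof (rule boundedI)
        fix v assume "v \<in> g ` mspace nat_metric"
        then obtain n where "v = g n" by blast
        moreover have "\<bar>g n\<bar> \<le> M" using g01 M[of n] by (simp add: g_def u_def)
        ultimately show "norm v \<le> M" by simp
      qed
      fix r \<epsilon> :: real assume "\<epsilon> > 0"
      then have d: "min (\<epsilon>/4) (1/8) > 0" by simp
      show "\<forall>\<^sub>F x in at_inf nat_metric. \<forall>y\<in>mspace nat_metric. mdist nat_metric x y \<le> r \<longrightarrow> \<bar>g x - g y\<bar> < \<epsilon>"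
        using slowly_oscillatingD[OF \<psi>(1) d, of r]
      proof eventually_elim
        case (elim x)
        show ?case
        proof (intro ballI impI)
          fix y assume y: "mdist nat_metric x y \<le> r"
          show "\<bar>g x - g y\<bar> < \<epsilon>"
          proof (cases "\<psi> x \<le> 3/4 \<and> \<psi> y \<le> 3/4")
            case True then show ?thesis using gsmall \<open>\<epsilon> > 0\<close> by simp
          next
            case False
            \<comment> \<open>All integers between \<open>x\<close> and \<open>y\<close> are
              covered. If \<open>\<psi>\<close> exceeds 3/4 at \<open>x\<close> or at
              \<open>y\<close>, at most two steps of 1/8 keep it above 1/2 in between, so no block
              boundary intervenes.\<close>
            have near: "\<bar>\<psi> x - \<psi> k\<bar> < \<epsilon>/4" "\<bar>\<psi> x - \<psi> k\<bar> < 1/8" if "min x y \<le> k" "k \<le> max x y" for k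
            proof -
              have "mdist nat_metric x k \<le> r" using that y by auto
              then show "\<bar>\<psi> x - \<psi> k\<bar> < \<epsilon>/4" "\<bar>\<psi> x - \<psi> k\<bar> < 1/8" using elim by auto
            qed
            have "\<psi> k \<ge> 1/2" if "min x y \<le> k" "k \<le> max x y" for k
              using near(2)[OF that] near(2)[of y] False by (auto simp: abs_if split: if_splits)
            then have "blk (min x y) \<longleftrightarrow> blk (max x y)" by (intro blk_eq) auto
            then have "blk x \<longleftrightarrow> blk y" by (auto simp: min_def max_def split: if_splits)
            moreover have "\<bar>\<psi> x - \<psi> y\<bar> < \<epsilon>/4" by (rule near) auto
            ultimately show ?thesis using \<open>\<epsilon> > 0\<close> by (auto simp: g_def u_def abs_if max_def split: if_splits)
          qed
        qed
      qed
    qed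
    have uB: "corona_value nat_metric q u = 1" if "q \<in> B" for q
    proof -
      have q: "q \<in> corona_set nat_metric" using that B top by blast
      have "(u \<longlongrightarrow> max 0 (4 * 1 - 3)) (corona_filter nat_metric q)"
        unfolding u_def using corona_value_tendsto[OF N q \<psi>(1)] \<psi>(3) that by (intro tendsto_intros) auto
      then show ?thesis using corona_value_unique[OF q] by force
    qed
    have gB: "corona_value nat_metric q g \<in> {0, 1}" if qB: "q \<in> B" for q
    proof -
      have q: "q \<in> corona_set nat_metric" using qB B top by blast
      note tg = corona_value_tendsto[OF N q so_g] and tu = corona_value_tendsto[OF N q so_u, unfolded uB[OF qB]]
      \<comment> \<open>At each integer \<open>g\<close> is either \<open>u\<close> or 0, so
        \<open>g * (1 - g)\<close> is dominated by \<open>u * (1 - u)\<close>, which tends to 0 on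
        \<open>B\<close>; hence the limit of \<open>g\<close> is an idempotent.\<close>
      have "((\<lambda>n. u n * (1 - u n)) \<longlongrightarrow> 1 * (1 - 1)) (corona_filter nat_metric q)"
        by (intro tendsto_intros tu)
      then have "((\<lambda>n. \<bar>u n * (1 - u n)\<bar>) \<longlongrightarrow> 0) (corona_filter nat_metric q)"
        using tendsto_rabs_zero by simp
      then have "((\<lambda>n. g n * (1 - g n)) \<longlongrightarrow> 0) (corona_filter nat_metric q)"
        by (rule Lim_null_comparison[rotated]) (auto simp: g_def)
      moreover have "((\<lambda>n. g n * (1 - g n)) \<longlongrightarrow> corona_value nat_metric q g * (1 - corona_value nat_metric q g)) (corona_filter nat_metric q)"
        by (intro tendsto_intros tg)
      ultimately have "corona_value nat_metric q g * (1 - corona_value nat_metric q g) = 0"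
        using tendsto_unique[OF corona_filter_neq_bot[OF q]] by blast
      then show ?thesis by auto
    qed
    have inf: "infinite (range (\<lambda>i. s (4 * i + c)))" for c
      using s(1) by (intro range_inj_infinite injI) (auto simp: strict_mono_eq)
    have starne: "\<exists>p. p \<in> corona_star nat_metric (range (\<lambda>i. s (4 * i + c)))" for c
      using corona_star_nonempty[of "range (\<lambda>i. s (4 * i + c))" nat_metric] inf[of c]
      by (auto simp: bounded_subset_nat_iff)
    have sub: "range (\<lambda>i. s (4 * i + 1)) \<subseteq> {n. \<phi> n < 1/2}" "range (\<lambda>i. s (4 * i + 3)) \<subseteq> {n. \<phi> n < 1/2}"
    proof -
      have "\<phi> (s (4 * i + 1)) < 1/2" "\<phi> (s (4 * i + 3)) < 1/2" for i
        using s(3)[of "2 * i"] s(3)[of "2 * i + 1"] by (simp_all add: algebra_simps numeral_3_eq_3)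
      then show "range (\<lambda>i. s (4 * i + 1)) \<subseteq> {n. \<phi> n < 1/2}" "range (\<lambda>i. s (4 * i + 3)) \<subseteq> {n. \<phi> n < 1/2}" by auto
    qed
    obtain p1 where p1: "p1 \<in> corona_star nat_metric (range (\<lambda>i. s (4 * i + 1)))" using starne by blast
    obtain p3 where p3: "p3 \<in> corona_star nat_metric (range (\<lambda>i. s (4 * i + 3)))" using starne by blast
    have pB: "p1 \<in> B" "p3 \<in> B" using starB p1 p3 sub by blast+
    \<comment> \<open>On these points \<open>g\<close> agrees with \<open>u\<close>, whose value on
      \<open>B\<close> is 1; on the points \<open>s (4 * i + 3)\<close> it is 0. Both sets have
      limit points in \<open>B\<close>, so the connected image of \<open>B\<close> would contain
      exactly 0 and 1.\<close>
    have "blk (s (4 * i + 1))" for i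
      unfolding blk_def using s(1) by (intro exI[of _ i]) (auto simp: strict_mono_less strict_mono_less_eq)
    then have "corona_value nat_metric p1 (\<lambda>n. u n - g n) = 0"
      by (intro corona_value_on_star[OF N _ _ p1] slowly_oscillating_diff so_u so_g) (auto simp: g_def intro!: always_eventually)
    moreover have p1c: "p1 \<in> corona_set nat_metric" using pB B top by blast
    have "corona_value nat_metric p1 (\<lambda>n. u n - g n) = 1 - corona_value nat_metric p1 g"
      using corona_value_tendsto[OF N p1c so_g] corona_value_tendsto[OF N p1c so_u] uB[OF pB(1)]
      by (intro corona_value_unique[OF p1c] tendsto_intros) auto
    ultimately have v1: "corona_value nat_metric p1 g = 1" by simp
    have "\<not> blk (s (4 * i + 3))" for i
    proof
      assume "blk (s (4 * i + 3))"
      then obtain j where "4 * j \<le> 4 * i + 3" "4 * i + 3 < 4 * j + 2"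
        unfolding blk_def using s(1) by (auto simp: strict_mono_less strict_mono_less_eq)
      then show False by presburger
    qed
    then have v3: "corona_value nat_metric p3 g = 0"
      by (intro corona_value_on_star[OF N so_g _ p3]) (auto simp: g_def intro!: always_eventually)
    let ?I = "(\<lambda>p. corona_value nat_metric p g) ` B"
    have "connected ?I"
      using connectedin_continuous_map_image[OF continuous_map_corona_value[OF N so_g] conB] by simp
    moreover have "finite ?I" using gB finite_subset[of ?I "{0, 1}"] by blast
    ultimately have "?I = {} \<or> (\<exists>x. ?I = {x})" by (simp add: connected_finite_iff_sing)
    moreover have "0 \<in> ?I" by (rule image_eqI[where x = p3]) (simp_all add: v3 pB)
    moreover have "1 \<in> ?I" by (rule image_eqI[where x = p1]) (simp_all add: v1 pB)
    ultimately show False by (metis empty_iff singletonD zero_neq_one)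
  qed
  then show ?thesis using corona_nat_continuum unfolding indecomposable_continuum_def by blast
qed

section \<open>Spaces coarsely equivalent to the integers\<close>

lemma coarsely_geodesic_if_int:
  assumes "coarsely_equivalent X int_metric"
  shows "coarsely_geodesic X"
proof (rule coarsely_geodesicI)
  show "geodesic_metric (euclidean_metric :: real metric)"
    unfolding geodesic_metric_def
  proof (intro ballI)
    fix x y :: real
    show "\<exists>\<gamma>\<in>{0..mdist euclidean_metric x y} \<rightarrow> mspace euclidean_metric.
        \<gamma> 0 = x \<and> \<gamma> (mdist euclidean_metric x y) = y \<and>
        (\<forall>s\<in>{0..mdist euclidean_metric x y}. \<forall>t\<in>{0..mdist euclidean_metric x y}.
          mdist euclidean_metric (\<gamma> s) (\<gamma> t) = \<bar>s - t\<bar>)"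
      by (rule bexI[of _ "\<lambda>t. if x \<le> y then x + t else x - t"]) (auto simp: dist_real_def)
  qed
  have "coarse_embedding int_metric euclidean_metric real_of_int"
    by (auto simp: coarse_embedding_def bornologous_def dist_real_def)
  moreover have "coarsely_onto int_metric euclidean_metric real_of_int"
    unfolding coarsely_onto_def
  proof (intro exI ballI)
    fix y :: real
    show "\<exists>x\<in>mspace int_metric. mdist euclidean_metric (real_of_int x) y \<le> 1"
      by (rule bexI[of _ "\<lfloor>y\<rfloor>"]) (auto simp: dist_real_def, linarith)
  qed
  ultimately show "coarsely_equivalent X (euclidean_metric :: real metric)"
    using coarsely_equivalent_trans[OF assms] coarsely_equivalentI by blast
qed

lemma coarse_bounded_geometry_if_int:
  assumes "coarsely_equivalent X int_metric"
  shows "coarse_bounded_geometry X"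
proof -
  obtain g where g: "coarse_embedding int_metric X g" "coarsely_onto int_metric X g"
    using assms coarsely_equivalent_sym coarse_equivalence_imp unfolding coarsely_equivalent_def by metis
  have "\<forall>s. \<exists>r. \<forall>m n. mdist X (g m) (g n) \<le> s \<longrightarrow> \<bar>real_of_int m - real_of_int n\<bar> \<le> r"
    using g(1) by (simp add: coarse_embedding_def)
  then obtain \<rho> where \<rho>: "\<And>s m n. mdist X (g m) (g n) \<le> s \<Longrightarrow> \<bar>real_of_int m - real_of_int n\<bar> \<le> \<rho> s" by metis
  have gX: "g n \<in> mspace X" for n using g(1) by (auto simp: coarse_embedding_def bornologous_def)
  define N where "N = (\<lambda>t. real (card {-\<lceil>\<rho> (2 * t)\<rceil>..\<lceil>\<rho> (2 * t)\<rceil>}))"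
  have fin: "finite (range g \<inter> mcball_of X x t) \<and> real (card (range g \<inter> mcball_of X x t)) \<le> N t"
    if x: "x \<in> mspace X" for x t
  proof (cases "range g \<inter> mcball_of X x t = {}")
    case False
    then obtain m where m: "mdist X x (g m) \<le> t" by auto
    \<comment> \<open>Once one index \<open>m\<close> is known, every other point of the net in the
      ball is within \<open>2 * t\<close> of \<open>g m\<close>, so its index lies in an interval
      around \<open>m\<close> whose length depends on \<open>t\<close> only.\<close>
    have "range g \<inter> mcball_of X x t \<subseteq> (\<lambda>k. g (m + k)) ` {-\<lceil>\<rho> (2 * t)\<rceil>..\<lceil>\<rho> (2 * t)\<rceil>}" (is "_ \<subseteq> ?f ` ?I")
    proof
      fix y assume "y \<in> range g \<inter> mcball_of X x t"
      then obtain n where n: "y = g n" "mdist X x (g n) \<le> t" by auto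
      have "mdist X (g n) (g m) \<le> mdist X (g n) x + mdist X x (g m)" by (rule mdist_triangle) (auto simp: gX x)
      then have "mdist X (g n) (g m) \<le> 2 * t" using m n mdist_commute[of X x "g n"] by linarith
      from \<rho>[OF this] have "n - m \<in> ?I" by simp linarith
      then show "y \<in> ?f ` ?I" using n by (intro image_eqI[of _ _ "n - m"]) auto
    qed
    moreover have "finite (?f ` ?I)" "card (?f ` ?I) \<le> card ?I" by (simp, rule card_image_le, simp)
    ultimately show ?thesis unfolding N_def
      by (meson card_mono finite_subset le_trans of_nat_mono)
  qed (simp add: N_def)
  have "metric_net X (range g)"
  proof -
    obtain c where c: "\<forall>y\<in>mspace X. \<exists>n\<in>UNIV. mdist X (g n) y \<le> c" using g(2) by (auto simp: coarsely_onto_def)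
    have "\<forall>x\<in>mspace X. \<exists>a\<in>range g. mdist X x a < max 0 c + 1"
    proof
      fix x assume "x \<in> mspace X"
      then obtain n where "mdist X (g n) x \<le> c" using c by blast
      then show "\<exists>a\<in>range g. mdist X x a < max 0 c + 1"
        by (intro bexI[of _ "g n"]) (auto simp: mdist_commute)
    qed
    then show ?thesis unfolding metric_net_def using gX by (intro conjI exI[of _ "max 0 c + 1"]) auto
  qed
  moreover have "N \<in> {0..} \<rightarrow> {0..}" by (simp add: N_def)
  ultimately show ?thesis using fin unfolding coarse_bounded_geometry_def by blast
qed

lemma coarse_map_comp:
  assumes "coarse_map X Y f" "coarse_map Y Z g"
  shows "coarse_map X Z (g \<circ> f)"
proof -
  have "bounded_subset X {x \<in> mspace X. (g \<circ> f) x \<in> B}" if "bounded_subset Z B" for B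
  proof -
    have "bounded_subset Y {y \<in> mspace Y. g y \<in> B}" using assms(2) that by (simp add: coarse_map_def)
    then have "bounded_subset X {x \<in> mspace X. f x \<in> {y \<in> mspace Y. g y \<in> B}}"
      using assms(1) unfolding coarse_map_def by blast
    then show ?thesis by (rule bounded_subset_subset) (use assms(1) in \<open>auto simp: coarse_map_def\<close>)
  qed
  then show ?thesis using assms bornologous_comp unfolding coarse_map_iff by blast
qed

lemma coarse_map_nat_int: "coarse_map nat_metric int_metric (\<lambda>n. e * int n)" if "\<bar>e\<bar> = 1" for e
proof (rule coarse_embedding_imp_coarse_map)
  have "\<bar>real_of_int (e * int m) - real_of_int (e * int n)\<bar> = \<bar>real m - real n\<bar>" for m n
    using that by (simp add: abs_if split: if_splits)
  then show "coarse_embedding nat_metric int_metric (\<lambda>n. e * int n)"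
    by (auto simp: coarse_embedding_def bornologous_def simp del: of_int_mult)
qed

lemma coarse_map_nat_abs: "coarse_map int_metric nat_metric (\<lambda>m. nat \<bar>m\<bar>)"
proof -
  have "bornologous int_metric nat_metric (\<lambda>m. nat \<bar>m\<bar>)"
    unfolding bornologous_def
  proof (intro conjI allI)
    fix r show "\<exists>s. \<forall>x\<in>mspace int_metric. \<forall>x'\<in>mspace int_metric. mdist int_metric x x' \<le> r \<longrightarrow>
        mdist nat_metric (nat \<bar>x\<bar>) (nat \<bar>x'\<bar>) \<le> s"
    proof (intro exI ballI impI)
      fix x x' assume "mdist int_metric x x' \<le> r"
      then show "mdist nat_metric (nat \<bar>x\<bar>) (nat \<bar>x'\<bar>) \<le> r" by (simp add: abs_if split: if_splits)
    qed
  qed simp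
  moreover have "bounded_subset int_metric {x \<in> mspace int_metric. nat \<bar>x\<bar> \<in> B}" if bB: "bounded_subset nat_metric B" for B
  proof -
    obtain r where "\<forall>n\<in>B. mdist nat_metric 0 n \<le> r"
      using bB bounded_subset_iff_center[of 0 nat_metric B] by auto
    then have "\<forall>x\<in>{x \<in> mspace int_metric. nat \<bar>x\<bar> \<in> B}. mdist int_metric 0 x \<le> r" by auto
    then show ?thesis using bounded_subset_iff_center[of 0 int_metric "{x \<in> mspace int_metric. nat \<bar>x\<bar> \<in> B}"] by auto
  qed
  ultimately show ?thesis by (simp add: coarse_map_iff)
qed

lemma slowly_oscillating_int_sign: "slowly_oscillating int_metric (\<lambda>m. if m \<ge> 0 then 1 else 0)"
  unfolding slowly_oscillating_def
proof (intro conjI allI impI)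
  show "bounded ((\<lambda>m. if m \<ge> 0 then 1 else 0 :: real) ` mspace int_metric)"
    by (rule boundedI[of _ 1]) auto
  fix r \<epsilon> :: real assume "\<epsilon> > 0"
  then show "\<forall>\<^sub>F x in at_inf int_metric. \<forall>y\<in>mspace int_metric. mdist int_metric x y \<le> r \<longrightarrow>
      \<bar>(if x \<ge> 0 then 1 else 0) - (if y \<ge> 0 then 1 else 0)\<bar> < \<epsilon>"
    by (subst eventually_at_inf_dist[of 0]) (auto intro!: exI[of _ r])
qed

text \<open>The sign of the integer coordinate is slowly oscillating, as it changes only near 0; its
  extension splits the corona into two clopen halves. Each half is identified with the corona of the
  naturals by folding the integers with the absolute value and unfolding with the sign
  \<open>e\<close>.\<close>

lemma higson_corona_if_int:
  fixes X :: "'a metric"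
  assumes X: "proper_metric X" and eq: "coarsely_equivalent X int_metric"
  obtains C :: "bool \<Rightarrow> (('a \<Rightarrow> real) \<Rightarrow> real) topology"
  where "higson_corona X homeomorphic_space sum_topology C UNIV"
    "\<And>i. C i homeomorphic_space higson_corona nat_metric"
proof -
  note N = proper_nat_metric
  obtain f g where f: "coarse_map X int_metric f" and g: "coarse_map int_metric X g"
    and gf: "close_maps X X (g \<circ> f) id" and fg: "close_maps int_metric int_metric (f \<circ> g) id"
    using eq unfolding coarsely_equivalent_def coarse_equivalence_def by blast
  obtain c where c: "\<And>x. x \<in> mspace X \<Longrightarrow> mdist X (g (f x)) x < c" using gf by (auto simp: close_maps_def)
  obtain d where d: "\<And>m. \<bar>real_of_int (f (g m)) - real_of_int m\<bar> < d" using fg by (auto simp: close_maps_def)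
  define \<sigma> where "\<sigma> = (\<lambda>x. if f x \<ge> 0 then 1 else 0 :: real)"
  have so: "slowly_oscillating X \<sigma>"
    using slowly_oscillating_comp_coarse[OF f slowly_oscillating_int_sign] by (simp add: \<sigma>_def comp_def)
  define a where "a = (\<lambda>m. nat \<bar>m\<bar>) \<circ> f"
  define b where "b = (\<lambda>e n. g (e * int n))"
  have a: "coarse_map X nat_metric a" unfolding a_def by (rule coarse_map_comp[OF f coarse_map_nat_abs])
  have b: "coarse_map nat_metric X (b e)" if "\<bar>e\<bar> = 1" for e
    using coarse_map_comp[OF coarse_map_nat_int[OF that] g] by (simp add: b_def comp_def)
  define U where "U = {p \<in> corona_set X. corona_value X p \<sigma> > 1/2}"
  \<comment> \<open>\<open>\<sigma>\<close> takes only the values 0 and 1, so 1/2 is never a limit.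
    The strict and the weak inequality thus define the same set, which makes it both open and
    closed.\<close>
  have U_alt: "U = {p \<in> corona_set X. corona_value X p \<sigma> \<ge> 1/2}"
  proof -
    have "corona_value X p \<sigma> \<noteq> 1/2" if p: "p \<in> corona_set X" for p
    proof
      assume half: "corona_value X p \<sigma> = 1/2"
      have "\<forall>\<^sub>F x in corona_filter X p. dist (\<sigma> x) (1/2) < 1/2"
        using tendstoD[OF corona_value_tendsto[OF X p so], of "1/2"] unfolding half by simp
      then have "\<forall>\<^sub>F x in corona_filter X p. False"
        by eventually_elim (auto simp: \<sigma>_def dist_real_def split: if_splits)
      then show False using corona_filter_neq_bot[OF p] by simp
    qed
    then show ?thesis by (force simp: U_def)
  qed
  have top: "topspace (higson_corona X) = corona_set X" by (rule topspace_higson_corona[OF X])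
  note cont = continuous_map_corona_value[OF X so]
  have "openin (higson_corona X) U"
    using openin_continuous_map_preimage[OF cont, of "{1/2<..}"]
    by (simp add: U_def top flip: open_openin)
  moreover have "closedin (higson_corona X) U"
    using closedin_continuous_map_preimage[OF cont, of "{1/2..}"]
    by (simp add: U_alt top flip: closed_closedin)
  ultimately have sum: "higson_corona X homeomorphic_space
      sum_topology (\<lambda>i. subtopology (higson_corona X) (if i then U else topspace (higson_corona X) - U)) UNIV"
    by (rule homeomorphic_sum_clopen)
  \<comment> \<open>The composite of folding and unfolding is close to the identity only where
    \<open>f\<close> has the sign \<open>e\<close>; the hypothesis on \<open>V\<close> says that its
    points see nothing else.\<close>
  have part: "subtopology (higson_corona X) V homeomorphic_space higson_corona nat_metric"
    if e: "\<bar>e\<bar> = 1" and V: "V \<subseteq> corona_set X" "\<And>p. p \<in> V \<Longrightarrow> \<forall>\<^sub>F x in corona_filter X p. e * f x \<ge> 0"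
      "\<And>q. q \<in> corona_set nat_metric \<Longrightarrow> corona_map nat_metric X (b e) q \<in> V" for e V
  proof (rule corona_part_homeomorphic[OF X N a b[OF e] V])
    have "mdist X x (b e (a x)) \<le> max c d" if "x \<in> mspace X" "e * f x \<ge> 0" for x
    proof -
      have "e * int (a x) = f x" using e that(2) by (auto simp: a_def abs_if split: if_splits)
      then show ?thesis using c[OF that(1)] by (simp add: b_def mdist_commute)
    qed
    then show "\<forall>\<^sub>F x in at_inf X. e * f x \<ge> 0 \<longrightarrow> mdist X x (b e (a x)) \<le> max c d"
      by (intro eventually_mono[OF eventually_at_inf_mspace] impI)
    show "mdist nat_metric n (a (b e n)) \<le> max c d" for n
      using d[of "e * int n"] e by (auto simp: a_def b_def abs_if split: if_splits)
  qed
  have val: "corona_value X (corona_map nat_metric X (b e) q) \<sigma> = (if e = 1 then 1 else 0)"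
    if e: "\<bar>e\<bar> = 1" and q: "q \<in> corona_set nat_metric" for e q
  proof -
    \<comment> \<open>\<open>f (g (e * int n))\<close> differs from \<open>e * int n\<close> by less
      than \<open>d\<close>, hence has the sign \<open>e\<close> as soon as \<open>n\<close> exceeds
      \<open>d\<close>.\<close>
    have "\<forall>\<^sub>F n in at_inf nat_metric. (\<sigma> \<circ> b e) n = (if e = 1 then 1 else 0)"
      unfolding eventually_at_inf_dist[of 0 nat_metric, simplified]
    proof (intro exI allI impI)
      fix n assume n: "real n > d"
      then show "(\<sigma> \<circ> b e) n = (if e = 1 then 1 else 0)"
        using d[of "e * int n"] e by (auto simp: \<sigma>_def b_def abs_if split: if_splits)
    qed
    then have "((\<sigma> \<circ> b e) \<longlongrightarrow> (if e = 1 then 1 else 0)) (corona_filter nat_metric q)"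
      by (intro tendsto_eventually eventually_corona_filter)
    then show ?thesis
      unfolding corona_value_map[OF N X b[OF e] q so] by (rule corona_value_unique[OF q])
  qed
  have "subtopology (higson_corona X) (if i then U else topspace (higson_corona X) - U)
      homeomorphic_space higson_corona nat_metric" for i
  proof (cases i)
    case True
    have "\<forall>\<^sub>F x in corona_filter X p. 1 * f x \<ge> 0" if "p \<in> U" for p
      using corona_value_eventually_greater[OF X _ so, of p "1/2"] that
      by (auto simp: U_def \<sigma>_def elim!: eventually_mono split: if_splits)
    then have "subtopology (higson_corona X) U homeomorphic_space higson_corona nat_metric"
      using val[of 1] corona_map_filter(1)[OF N X b[of 1]]
      by (intro part[of 1]) (auto simp: U_def)
    then show ?thesis using True by simp
  next
    case False
    have "\<forall>\<^sub>F x in corona_filter X p. -1 * f x \<ge> 0" if "p \<in> corona_set X - U" for p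
      using corona_value_eventually_less[OF X _ so, of p "1/2"] that
      by (auto simp: U_alt \<sigma>_def elim!: eventually_mono split: if_splits)
    then have "subtopology (higson_corona X) (corona_set X - U) homeomorphic_space higson_corona nat_metric"
      using val[of "-1"] corona_map_filter(1)[OF N X b[of "-1"]]
      by (intro part[of "-1"]) (auto simp: U_def)
    then show ?thesis using False by (simp add: top)
  qed
  then show thesis using that[OF sum] by blast
qed

section \<open>Discretisation of coarsely geodesic spaces\<close>

text \<open>The path metric on the vertices of a connected graph, expressed without edges: distances
  are natural numbers, and from any vertex one unit step leads closer to any other.\<close>

definition discretely_geodesic :: "'a metric \<Rightarrow> bool" where
  "discretely_geodesic G \<longleftrightarrow> (\<forall>x\<in>mspace G. \<forall>y\<in>mspace G. mdist G x y \<in> \<nat> \<and>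
     (x \<noteq> y \<longrightarrow> (\<exists>z\<in>mspace G. mdist G x z = 1 \<and> mdist G z y = mdist G x y - 1)))"

text \<open>The path metric of the graph \<open>E\<close>; the locale below guarantees that the
  minimum is taken over a non-empty set.\<close>

definition chain_dist :: "('a \<times> 'a) set \<Rightarrow> 'a \<Rightarrow> 'a \<Rightarrow> nat" where
  "chain_dist E a b = (LEAST n. (a, b) \<in> E ^^ n)"

locale chain_space =
  fixes A :: "'a set" and E :: "('a \<times> 'a) set"
  assumes sub: "E \<subseteq> A \<times> A" and sym: "sym E"
    and connected: "\<And>a b. a \<in> A \<Longrightarrow> b \<in> A \<Longrightarrow> \<exists>n. (a, b) \<in> E ^^ n"
begin

lemma chain_dist_relpow: "a \<in> A \<Longrightarrow> b \<in> A \<Longrightarrow> (a, b) \<in> E ^^ chain_dist E a b"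
  unfolding chain_dist_def using connected by (rule LeastI_ex)

lemma chain_dist_le: "(a, b) \<in> E ^^ n \<Longrightarrow> chain_dist E a b \<le> n"
  unfolding chain_dist_def by (rule Least_le)

lemma relpow_sym: "(a, b) \<in> E ^^ n \<Longrightarrow> (b, a) \<in> E ^^ n"
proof (induction n arbitrary: b)
  case (Suc n)
  then obtain c where "(a, c) \<in> E ^^ n" "(c, b) \<in> E" by auto
  then have "(c, a) \<in> E ^^ n" "(b, c) \<in> E" using Suc.IH sym by (auto dest: symD)
  then show ?case by (rule relpow_Suc_I2[rotated])
qed simp

lemma chain_dist_commute: "chain_dist E a b = chain_dist E b a"
  unfolding chain_dist_def using relpow_sym by (intro arg_cong[of _ _ Least]) blast

lemma chain_dist_triangle:
  assumes "a \<in> A" "b \<in> A" "c \<in> A"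
  shows "chain_dist E a c \<le> chain_dist E a b + chain_dist E b c"
proof (rule chain_dist_le)
  show "(a, c) \<in> E ^^ (chain_dist E a b + chain_dist E b c)"
    unfolding relpow_add using chain_dist_relpow assms by blast
qed

lemma chain_dist_eq_0: "a \<in> A \<Longrightarrow> b \<in> A \<Longrightarrow> chain_dist E a b = 0 \<longleftrightarrow> a = b"
  using chain_dist_relpow[of a b] chain_dist_le[of a a 0] by auto

definition chain_metric :: "'a metric" where
  "chain_metric = metric (A, \<lambda>a b. real (chain_dist E a b))"

lemma chain_metric_simps:
  shows mspace_chain_metric: "mspace chain_metric = A"
    and mdist_chain_metric: "mdist chain_metric a b = real (chain_dist E a b)"
proof -
  interpret Metric_space A "\<lambda>a b. real (chain_dist E a b)"
  proof
    fix a b c assume "a \<in> A" "b \<in> A" "c \<in> A"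
    from chain_dist_triangle[OF this]
    show "real (chain_dist E a c) \<le> real (chain_dist E a b) + real (chain_dist E b c)" by linarith
  qed (auto simp: chain_dist_commute chain_dist_eq_0)
  show "mspace chain_metric = A" "mdist chain_metric a b = real (chain_dist E a b)"
    by (simp_all add: chain_metric_def)
qed

lemma discretely_geodesic_chain_metric: "discretely_geodesic chain_metric"
  unfolding discretely_geodesic_def chain_metric_simps
proof (intro ballI conjI impI)
  fix a b assume ab: "a \<in> A" "b \<in> A" "a \<noteq> b"
  then obtain n where n: "chain_dist E a b = Suc n" using chain_dist_eq_0 by (metis not0_implies_Suc)
  then have "(a, b) \<in> E ^^ Suc n" using chain_dist_relpow[OF ab(1,2)] by simp
  then obtain z where z: "(a, z) \<in> E" "(z, b) \<in> E ^^ n" by (rule relpow_Suc_E2)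
  then have zA: "z \<in> A" using sub by auto
  have "chain_dist E a z \<le> 1" using z(1) by (intro chain_dist_le) simp
  moreover have "chain_dist E z b \<le> n" using z(2) by (rule chain_dist_le)
  ultimately have "chain_dist E a z = 1" "chain_dist E z b = n"
    using chain_dist_triangle[OF ab(1) zA ab(2)] n by linarith+
  then show "\<exists>z\<in>A. real (chain_dist E a z) = 1 \<and> real (chain_dist E z b) = real (chain_dist E a b) - 1"
    using zA n by (intro bexI[of _ z]) auto
qed simp

end

text \<open>The graph lives on a net of \<open>X\<close>, so it keeps the carrier type; its edges
  join net points at distance at most \<open>R\<close>. Bounded geometry makes balls finite.
  Geodesics of the model space \<open>Y\<close>, sampled at integer times and moved to the net, show
  that the path metric is controlled by that of \<open>X\<close>.\<close>

lemma coarsely_geodesic_discretisation: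
  fixes X :: "'a metric"
  assumes geo: "coarsely_geodesic X" and bg: "coarse_bounded_geometry X"
  obtains G :: "'a metric"
  where "\<And>x r. finite (mcball_of G x r)" "discretely_geodesic G" "coarsely_equivalent X G"
proof -
  obtain Y :: "('a \<times> real) metric" where Y: "geodesic_metric Y" "coarsely_equivalent X Y"
    using geo by (auto simp: coarsely_geodesic_def)
  obtain f g where f: "coarse_map X Y f" and g: "coarse_map Y X g" and gf: "close_maps X X (g \<circ> f) id"
    using Y(2) unfolding coarsely_equivalent_def coarse_equivalence_def by blast
  have fY: "f x \<in> mspace Y" if "x \<in> mspace X" for x using f that by (auto simp: coarse_map_def)
  have gX: "g y \<in> mspace X" if "y \<in> mspace Y" for y using g that by (auto simp: coarse_map_def)
  obtain c where c: "\<And>x. x \<in> mspace X \<Longrightarrow> mdist X (g (f x)) x < c" using gf by (auto simp: close_maps_def)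
  have bf: "bornologous X Y f" and bg': "bornologous Y X g" using f g by (auto simp: coarse_map_iff)
  obtain s where s: "\<And>y y'. y \<in> mspace Y \<Longrightarrow> y' \<in> mspace Y \<Longrightarrow> mdist Y y y' \<le> 1 \<Longrightarrow> mdist X (g y) (g y') \<le> s"
    using bornologousD[OF bg'] by metis
  obtain A and N :: "real \<Rightarrow> real" where net: "metric_net X A"
    and finA: "\<And>x t. x \<in> mspace X \<Longrightarrow> t > 0 \<Longrightarrow> finite (A \<inter> mcball_of X x t)"
    using bg unfolding coarse_bounded_geometry_def by blast
  have AX: "A \<subseteq> mspace X" using net by (simp add: metric_net_def)
  obtain \<rho> where \<rho>: "\<forall>x\<in>mspace X. \<exists>a\<in>A. mdist X x a < \<rho>" using net by (auto simp: metric_net_def)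
  then obtain nn where nn: "\<And>x. x \<in> mspace X \<Longrightarrow> nn x \<in> A" "\<And>x. x \<in> mspace X \<Longrightarrow> mdist X x (nn x) < \<rho>" by metis
  \<comment> \<open>A unit step in \<open>Y\<close> becomes a step of at most \<open>s\<close> in
    \<open>X\<close>, and rounding both ends to the net costs \<open>2 * \<rho>\<close>. The term
    with \<open>c\<close> serves the first and last edge, where \<open>g (f a)\<close> replaces
    \<open>a\<close>.\<close>
  define R where "R = max 1 (2 * \<rho> + max 0 s + max 0 c)"
  define E where "E = {(a, b). a \<in> A \<and> b \<in> A \<and> mdist X a b \<le> R}"
  have \<rho>0: "\<rho> > 0" if "x \<in> mspace X" for x using nn(2)[OF that] mdist_nonneg[of X x "nn x"] by linarith
  have chain: "\<exists>n\<le>N. (a, b) \<in> E ^^ n"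
    if N: "\<And>a b. a \<in> A \<Longrightarrow> b \<in> A \<Longrightarrow> mdist X a b \<le> t \<Longrightarrow> mdist Y (f a) (f b) \<le> real N'" "N = N' + 2"
      and ab: "a \<in> A" "b \<in> A" "mdist X a b \<le> t" for t N N' a b
  proof -
    let ?D = "mdist Y (f a) (f b)"
    have abX: "a \<in> mspace X" "b \<in> mspace X" using ab AX by auto
    obtain \<gamma> where \<gamma>: "\<gamma> \<in> {0..?D} \<rightarrow> mspace Y" "\<gamma> 0 = f a" "\<gamma> ?D = f b"
      "\<And>u v. u \<in> {0..?D} \<Longrightarrow> v \<in> {0..?D} \<Longrightarrow> mdist Y (\<gamma> u) (\<gamma> v) = \<bar>u - v\<bar>"
      using Y(1) fY abX unfolding geodesic_metric_def by meson
    \<comment> \<open>The minimum lets the last sample stop exactly at the end of the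
      geodesic.\<close>
    define y where "y = (\<lambda>i::nat. \<gamma> (min (real i) ?D))"
    define x where "x = (\<lambda>i. nn (g (y i)))"
    have yY: "y i \<in> mspace Y" for i using \<gamma>(1) by (auto simp: y_def Pi_iff)
    have xA: "x i \<in> A" "x i \<in> mspace X" for i
      using nn(1)[OF gX[OF yY[of i]]] subsetD[OF AX] by (simp_all add: x_def)
    have xg: "mdist X (g (y i)) (x i) < \<rho>" "mdist X (x i) (g (y i)) < \<rho>" for i
      using nn(2)[OF gX[OF yY]] by (auto simp: x_def mdist_commute)
    have step: "(x i, x (Suc i)) \<in> E" for i
    proof -
      have "mdist Y (y i) (y (Suc i)) \<le> 1"
        unfolding y_def using \<gamma>(4)[of "min (real i) ?D" "min (real (Suc i)) ?D"] by auto
      then have "mdist X (g (y i)) (g (y (Suc i))) \<le> s" using s yY by blast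
      moreover have "mdist X (x i) (x (Suc i)) \<le> mdist X (x i) (g (y i)) + mdist X (g (y i)) (x (Suc i))"
        by (intro mdist_triangle xA gX yY)
      moreover have "mdist X (g (y i)) (x (Suc i)) \<le> mdist X (g (y i)) (g (y (Suc i))) + mdist X (g (y (Suc i))) (x (Suc i))"
        by (intro mdist_triangle xA gX yY)
      ultimately have "mdist X (x i) (x (Suc i)) \<le> R"
        using xg(2)[of i] xg(1)[of "Suc i"] by (simp add: R_def)
      then show ?thesis using xA by (simp add: E_def)
    qed
    have path: "(x 0, x k) \<in> E ^^ k" for k
      by (induction k) (use step in auto)
    have end0: "mdist X a (x 0) \<le> R"
    proof -
      have "y 0 = f a" using \<gamma>(2) by (simp add: y_def)
      then have "mdist X a (x 0) \<le> mdist X a (g (f a)) + mdist X (g (y 0)) (x 0)"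
        using mdist_triangle[of a X "g (f a)" "x 0"] abX xA gX fY by simp
      then show ?thesis using c[OF abX(1)] xg(1)[of 0] \<rho>0[OF abX(1)] by (simp add: R_def mdist_commute)
    qed
    define n where "n = nat \<lceil>?D\<rceil>"
    have "min (real n) ?D = ?D" unfolding n_def using of_nat_ceiling[of ?D] by simp
    then have "y n = f b" using \<gamma>(3) by (simp add: y_def)
    then have "mdist X (x n) b \<le> mdist X (x n) (g (y n)) + mdist X (g (f b)) b"
      using mdist_triangle[of "x n" X "g (f b)" b] abX xA gX fY by simp
    then have end1: "mdist X (x n) b \<le> R"
      using c[OF abX(2)] xg(2)[of n] \<rho>0[OF abX(1)] by (simp add: R_def)
    \<comment> \<open>These two edges at the ends of the walk are the 2 in
      \<open>N = N' + 2\<close>.\<close>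
    have "(a, x 0) \<in> E" "(x n, b) \<in> E" using end0 end1 ab xA by (auto simp: E_def)
    then have "(a, b) \<in> E ^^ Suc (Suc n)"
      using path[of n] by (intro relpow_Suc_I[OF relpow_Suc_I2])
    moreover have "Suc (Suc n) \<le> N"
      using N(1)[OF ab] by (simp add: n_def N(2) ceiling_le_iff nat_le_iff)
    ultimately show ?thesis by blast
  qed
  \<comment> \<open>The number of steps depends on the distance \<open>t\<close> only. This is the
    lower control that makes the inclusion of the net a coarse embedding.\<close>
  have bound: "\<exists>N. \<forall>a\<in>A. \<forall>b\<in>A. mdist X a b \<le> t \<longrightarrow> (\<exists>n\<le>N. (a, b) \<in> E ^^ n)" for t
  proof -
    obtain S where S: "\<And>x x'. x \<in> mspace X \<Longrightarrow> x' \<in> mspace X \<Longrightarrow> mdist X x x' \<le> t \<Longrightarrow> mdist Y (f x) (f x') \<le> S"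
      using bornologousD[OF bf] by metis
    have "mdist Y (f a) (f b) \<le> real (nat \<lceil>S\<rceil>)" if "a \<in> A" "b \<in> A" "mdist X a b \<le> t" for a b
      using S[of a b] that AX of_nat_ceiling[of S] by fastforce
    then show ?thesis using chain[of t "nat \<lceil>S\<rceil>"] by blast
  qed
  interpret chain_space A E
  proof
    show "E \<subseteq> A \<times> A" by (auto simp: E_def)
    show "sym E" by (auto simp: sym_def E_def mdist_commute)
    show "\<exists>n. (a, b) \<in> E ^^ n" if "a \<in> A" "b \<in> A" for a b
      using bound[of "mdist X a b"] that by blast
  qed
  let ?G = chain_metric
  have upper: "mdist X a b \<le> R * real n" if "(a, b) \<in> E ^^ n" "a \<in> A" for a b n
    using that
  proof (induction n arbitrary: b)
    case (Suc n)
    then obtain z where z: "(a, z) \<in> E ^^ n" "(z, b) \<in> E" by auto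
    then have zb: "z \<in> mspace X" "b \<in> mspace X" "mdist X z b \<le> R" using AX by (auto simp: E_def)
    have "mdist X a b \<le> mdist X a z + mdist X z b" using Suc.prems AX zb by (intro mdist_triangle) auto
    then show ?case using Suc.IH[OF z(1)] Suc.prems zb(3) by (simp add: algebra_simps)
  qed (use AX in auto)
  have R1: "R \<ge> 1" by (simp add: R_def)
  show thesis
  proof (rule that[of ?G])
    fix a r
    show "finite (mcball_of ?G a r)"
    proof (cases "a \<in> A")
      case True
      \<comment> \<open>The finiteness assumption concerns positive radii, hence
        \<open>max r 1\<close>.\<close>
      have "mcball_of ?G a r \<subseteq> A \<inter> mcball_of X a (R * max r 1)"
      proof
        fix b assume "b \<in> mcball_of ?G a r"
        then have b: "b \<in> A" "real (chain_dist E a b) \<le> r" by (auto simp: chain_metric_simps)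
        have "mdist X a b \<le> R * real (chain_dist E a b)"
          by (rule upper[OF chain_dist_relpow[OF True b(1)] True])
        also have "\<dots> \<le> R * max r 1" using b(2) R1 by (intro mult_left_mono) auto
        finally show "b \<in> A \<inter> mcball_of X a (R * max r 1)" using b AX True by auto
      qed
      moreover have "finite (A \<inter> mcball_of X a (R * max r 1))"
        using True AX R1 by (intro finA) (auto intro!: mult_pos_pos)
      ultimately show ?thesis by (rule finite_subset)
    next
      case False
      then have "mcball_of ?G a r = {}" by (auto simp: chain_metric_simps)
      then show ?thesis by simp
    qed
  next
    show "discretely_geodesic ?G" by (rule discretely_geodesic_chain_metric)
    have "coarse_embedding ?G X (\<lambda>x. x)"
      unfolding coarse_embedding_def bornologous_def chain_metric_simps
    proof (intro conjI allI)
      show "(\<lambda>x. x) \<in> A \<rightarrow> mspace X" using AX by auto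
      show "\<exists>s. \<forall>x\<in>A. \<forall>x'\<in>A. real (chain_dist E x x') \<le> r \<longrightarrow> mdist X x x' \<le> s" for r
      proof (intro exI ballI impI)
        fix a b assume ab: "a \<in> A" "b \<in> A" "real (chain_dist E a b) \<le> r"
        have "mdist X a b \<le> R * real (chain_dist E a b)"
          by (rule upper[OF chain_dist_relpow[OF ab(1,2)] ab(1)])
        also have "\<dots> \<le> R * r" using ab(3) R1 by (intro mult_left_mono) auto
        finally show "mdist X a b \<le> R * r" .
      qed
      show "\<exists>r. \<forall>x\<in>A. \<forall>x'\<in>A. mdist X x x' \<le> t \<longrightarrow> real (chain_dist E x x') \<le> r" for t
      proof -
        obtain N where "\<forall>a\<in>A. \<forall>b\<in>A. mdist X a b \<le> t \<longrightarrow> (\<exists>n\<le>N. (a, b) \<in> E ^^ n)" using bound by blast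
        then show ?thesis using chain_dist_le by (intro exI[of _ "real N"]) (meson le_trans of_nat_mono)
      qed
    qed
    moreover have "coarsely_onto ?G X (\<lambda>x. x)"
      unfolding coarsely_onto_def chain_metric_simps
      using nn by (intro exI[of _ \<rho>]) (metis less_imp_le mdist_commute)
    ultimately show "coarsely_equivalent X ?G"
      using coarsely_equivalentI coarsely_equivalent_sym by blast
  qed
qed

section \<open>Locally finite geodesic graphs\<close>

locale geodesic_graph =
  fixes G :: "'a metric" and base :: 'a
  assumes finite_ball: "\<And>x r. finite (mcball_of G x r)"
    and geodesic: "discretely_geodesic G"
    and base: "base \<in> mspace G"
begin

lemma proper: "proper_metric G"
  by (rule proper_metricI_finite) (rule finite_ball)

lemma bounded_subset_iff_finite: "bounded_subset G B \<longleftrightarrow> B \<subseteq> mspace G \<and> finite B"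
proof
  assume "bounded_subset G B"
  then obtain r where "B \<subseteq> mspace G" "\<forall>x\<in>B. mdist G base x \<le> r"
    using bounded_subset_iff_center[OF base] by blast
  then have "B \<subseteq> mcball_of G base r" using base by auto
  then show "B \<subseteq> mspace G \<and> finite B" using finite_ball finite_subset \<open>B \<subseteq> mspace G\<close> by blast
next
  assume B: "B \<subseteq> mspace G \<and> finite B"
  then have "\<forall>x\<in>B. mdist G base x \<le> Max (mdist G base ` B)" by simp
  then show "bounded_subset G B" using B bounded_subset_iff_center[OF base] by blast
qed

lemma dist_nat:
  assumes "x \<in> mspace G" "y \<in> mspace G"
  obtains k :: nat where "mdist G x y = real k"
  using assms geodesic unfolding discretely_geodesic_def Nats_def by blast

lemma dist_step:
  assumes "x \<in> mspace G" "y \<in> mspace G" "x \<noteq> y"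
  obtains z where "z \<in> mspace G" "mdist G x z = 1" "mdist G z y = mdist G x y - 1"
  using assms geodesic unfolding discretely_geodesic_def by blast

definition ray :: "(nat \<Rightarrow> 'a) \<Rightarrow> bool" where
  "ray \<gamma> \<longleftrightarrow> \<gamma> 0 = base \<and> (\<forall>n. \<gamma> n \<in> mspace G \<and> mdist G base (\<gamma> n) = real n \<and> mdist G (\<gamma> n) (\<gamma> (Suc n)) = 1)"

text \<open>Unit steps bound the distance from above; the heights over the base point bound it from
  below.\<close>

lemma ray_dist:
  assumes "ray \<gamma>"
  shows "mdist G (\<gamma> m) (\<gamma> n) = \<bar>real m - real n\<bar>"
proof -
  have \<gamma>: "\<gamma> n \<in> mspace G" "mdist G base (\<gamma> n) = real n" "mdist G (\<gamma> n) (\<gamma> (Suc n)) = 1" for n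
    using assms by (auto simp: ray_def)
  have up: "mdist G (\<gamma> m) (\<gamma> (m + k)) \<le> real k" for m k
  proof (induction k)
    case (Suc k)
    have "mdist G (\<gamma> m) (\<gamma> (m + Suc k)) \<le> mdist G (\<gamma> m) (\<gamma> (m + k)) + mdist G (\<gamma> (m + k)) (\<gamma> (m + Suc k))"
      by (intro mdist_triangle \<gamma>)
    then show ?case using Suc \<gamma>(3)[of "m + k"] by simp
  qed (simp add: \<gamma>)
  have eq: "mdist G (\<gamma> m) (\<gamma> n) = real n - real m" if "m \<le> n" for m n
  proof -
    have "mdist G base (\<gamma> n) \<le> mdist G base (\<gamma> m) + mdist G (\<gamma> m) (\<gamma> n)" by (intro mdist_triangle base \<gamma>)
    then show ?thesis using up[of m "n - m"] that \<gamma>(2) by (simp add: of_nat_diff)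
  qed
  show ?thesis using eq[of m n] eq[of n m] mdist_commute[of G "\<gamma> m" "\<gamma> n"] by (cases "m \<le> n") auto
qed

text \<open>The points of \<open>S\<close> that some geodesic from the base point reaches through
  \<open>z\<close>.\<close>

definition shadow :: "'a set \<Rightarrow> 'a \<Rightarrow> 'a set" where
  "shadow S z = {x \<in> S. mdist G base x = mdist G base z + mdist G z x}"

text \<open>The branching step of Koenig's lemma: the first vertex after \<open>z\<close> on a
  geodesic towards a point of the shadow is one of finitely many neighbours one level further out,
  so one of their shadows is infinite.\<close>

lemma shadow_step:
  assumes S: "S \<subseteq> mspace G" and z: "z \<in> mspace G" "infinite (shadow S z)"
  shows "\<exists>z'\<in>mspace G. mdist G z z' = 1 \<and> mdist G base z' = mdist G base z + 1 \<and> infinite (shadow S z')"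
proof (rule ccontr)
  assume contra: "\<not> ?thesis"
  define N where "N = {z' \<in> mcball_of G z 1. mdist G z z' = 1 \<and> mdist G base z' = mdist G base z + 1}"
  have "finite N" unfolding N_def by (rule finite_subset[OF _ finite_ball[of z 1]]) blast
  moreover have "finite (shadow S z')" if "z' \<in> N" for z' using contra that by (auto simp: N_def)
  ultimately have "finite (insert z (\<Union>z'\<in>N. shadow S z'))" by auto
  moreover have "shadow S z \<subseteq> insert z (\<Union>z'\<in>N. shadow S z')"
  proof
    fix x assume "x \<in> shadow S z"
    then have x: "x \<in> S" "x \<in> mspace G" "mdist G base x = mdist G base z + mdist G z x"
      using S by (auto simp: shadow_def)
    show "x \<in> insert z (\<Union>z'\<in>N. shadow S z')"
    proof (cases "x = z")
      case False
      then obtain z' where z': "z' \<in> mspace G" "mdist G z z' = 1" "mdist G z' x = mdist G z x - 1"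
        using dist_step[OF z(1) x(2)] by metis
      have "mdist G base z' \<le> mdist G base z + mdist G z z'" by (intro mdist_triangle base z z')
      moreover have "mdist G base x \<le> mdist G base z' + mdist G z' x" by (intro mdist_triangle base x z')
      ultimately have "mdist G base z' = mdist G base z + 1" using z' x(3) by linarith
      then have "z' \<in> N" "x \<in> shadow S z'" using z' z x by (auto simp: N_def shadow_def)
      then show ?thesis by blast
    qed simp
  qed
  ultimately show False using z(2) finite_subset by blast
qed

lemma ray_exists:
  assumes S: "S \<subseteq> mspace G" "infinite S"
  obtains \<gamma> where "ray \<gamma>" "\<And>n. shadow S (\<gamma> n) \<noteq> {}"
proof -
  have "\<exists>\<gamma>. \<forall>n. (\<gamma> n \<in> mspace G \<and> mdist G base (\<gamma> n) = real n \<and> infinite (shadow S (\<gamma> n)) \<and> (n = 0 \<longrightarrow> \<gamma> n = base)) \<and>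
    mdist G (\<gamma> n) (\<gamma> (Suc n)) = 1"
  proof (rule dependent_nat_choice)
    have "shadow S base = S" using S base by (auto simp: shadow_def)
    then show "\<exists>z. z \<in> mspace G \<and> mdist G base z = real 0 \<and> infinite (shadow S z) \<and> (0 = (0::nat) \<longrightarrow> z = base)"
      using base S(2) by (intro exI[of _ base]) auto
    fix z n
    assume "z \<in> mspace G \<and> mdist G base z = real n \<and> infinite (shadow S z) \<and> (n = 0 \<longrightarrow> z = base)"
    then show "\<exists>z'. (z' \<in> mspace G \<and> mdist G base z' = real (Suc n) \<and> infinite (shadow S z') \<and>
        (Suc n = 0 \<longrightarrow> z' = base)) \<and> mdist G z z' = 1"
      using shadow_step[OF S(1), of z] by auto
  qed
  then obtain \<gamma> where \<gamma>: "\<And>n. \<gamma> n \<in> mspace G" "\<And>n. mdist G base (\<gamma> n) = real n" "\<And>n. infinite (shadow S (\<gamma> n))"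
    "\<gamma> 0 = base" "\<And>n. mdist G (\<gamma> n) (\<gamma> (Suc n)) = 1" by metis
  show thesis
  proof (rule that)
    show "ray \<gamma>" using \<gamma>(1,2,4,5) by (simp add: ray_def)
    show "shadow S (\<gamma> n) \<noteq> {}" for n using \<gamma>(3)[of n] by auto
  qed
qed

text \<open>Outside the ball of radius \<open>R\<close> no edge leads out of \<open>S\<close>; there
  \<open>S\<close> is a union of components of the graph.\<close>

definition coherent :: "real \<Rightarrow> 'a set \<Rightarrow> bool" where
  "coherent R S \<longleftrightarrow> S \<subseteq> mspace G \<and>
     (\<forall>x\<in>S. \<forall>y\<in>mspace G. mdist G base x > R \<longrightarrow> mdist G base y > R \<longrightarrow> mdist G x y \<le> 1 \<longrightarrow> y \<in> S)"

text \<open>Walking back from \<open>x\<close> to \<open>z\<close> along a geodesic through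
  \<open>z\<close>, the height over the base point never falls below that of \<open>z\<close>; so
  the walk stays outside the ball and cannot leave \<open>S\<close>.\<close>

lemma coherent_back:
  assumes S: "coherent R S" and z: "z \<in> mspace G" "mdist G base z > R" and x: "x \<in> shadow S z"
  shows "z \<in> S"
proof -
  have SG: "S \<subseteq> mspace G" using S by (simp add: coherent_def)
  have "z \<in> S" if "x \<in> S" "mdist G base x = mdist G base z + mdist G z x" "mdist G z x = real k" for k x
    using that
  proof (induction k arbitrary: x)
    case 0
    then have "x \<in> mspace G" using SG by blast
    then have "z = x" using 0(3) z(1) by simp
    then show ?case using 0(1) by simp
  next
    case (Suc k)
    then have xG: "x \<in> mspace G" "x \<noteq> z" using SG z by auto
    obtain w where w: "w \<in> mspace G" "mdist G x w = 1" "mdist G w z = mdist G x z - 1"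
      using dist_step[OF xG(1) z(1) xG(2)] by metis
    have d: "mdist G z w = real k" using w(3) Suc.prems(3) mdist_commute[of G w z] mdist_commute[of G x z] by simp
    have "mdist G base x \<le> mdist G base w + mdist G w x" by (intro mdist_triangle base xG w)
    moreover have "mdist G base w \<le> mdist G base z + mdist G z w" by (intro mdist_triangle base z w)
    ultimately have e: "mdist G base w = mdist G base z + mdist G z w"
      using d Suc.prems(2,3) w(2) mdist_commute[of G x w] by simp
    have "mdist G base x > R" "mdist G base w > R" using e d Suc.prems(2,3) z(2) by simp_all
    then have "w \<in> S" using S Suc.prems(1) w(1,2) unfolding coherent_def by force
    then show ?case using Suc.IH[OF _ e d] by simp
  qed
  moreover obtain k where "mdist G z x = real k" using dist_nat[OF z(1)] x SG by (auto simp: shadow_def)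
  ultimately show ?thesis using x by (auto simp: shadow_def)
qed

lemma coherent_ray_exists:
  assumes S: "coherent R S" "infinite S"
  obtains \<gamma> where "ray \<gamma>" "\<And>n. real n > R \<Longrightarrow> \<gamma> n \<in> S"
proof -
  obtain \<gamma> where \<gamma>: "ray \<gamma>" "\<And>n. shadow S (\<gamma> n) \<noteq> {}"
    using ray_exists S unfolding coherent_def by metis
  have "\<gamma> n \<in> S" if "real n > R" for n
  proof -
    obtain x where "x \<in> shadow S (\<gamma> n)" using \<gamma>(2) by blast
    then show ?thesis using coherent_back[OF S(1)] \<gamma>(1) that by (auto simp: ray_def)
  qed
  then show thesis using that \<gamma>(1) by blast
qed

text \<open>A geodesic from \<open>S\<close> to the disjoint set \<open>T\<close> has to enter the
  ball of radius \<open>R\<close>, so it descends from the height of \<open>x\<close> and climbs to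
  that of \<open>y\<close>.\<close>

lemma coherent_disjoint_dist:
  assumes S: "coherent R S" and T: "S \<inter> T = {}" "T \<subseteq> mspace G"
    and x: "x \<in> S" "mdist G base x > R" and y: "y \<in> T" "mdist G base y > R"
  shows "mdist G base x + mdist G base y - 2 * R - 2 \<le> mdist G x y"
proof -
  have SG: "S \<subseteq> mspace G" using S by (simp add: coherent_def)
  have yG: "y \<in> mspace G" using y T by auto
  have "mdist G base x + mdist G base y - 2 * R - 2 \<le> mdist G x y"
    if "x \<in> S" "mdist G base x > R" "mdist G x y = real k" for x k
    using that
  proof (induction k arbitrary: x)
    case 0
    then have "x \<in> mspace G" using SG by blast
    then have "x = y" using 0(3) yG by simp
    then show ?case using 0(1) y(1) T(1) by blast
  next
    case (Suc k)
    then have xG: "x \<in> mspace G" "x \<noteq> y" using SG yG by auto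
    obtain w where w: "w \<in> mspace G" "mdist G x w = 1" "mdist G w y = mdist G x y - 1"
      using dist_step[OF xG(1) yG xG(2)] by metis
    have bx: "mdist G base x \<le> mdist G base w + mdist G w x" by (intro mdist_triangle base xG w)
    show ?case
    proof (cases "mdist G base w > R")
      case True
      then have "w \<in> S" using S Suc.prems w unfolding coherent_def by force
      then show ?thesis
        using Suc.IH[OF _ True] Suc.prems(3) w bx mdist_commute[of G x w] by simp
    next
      \<comment> \<open>The next vertex is already in the ball, so \<open>x\<close> has height at
        most \<open>R + 1\<close>; subtracting this height from that of \<open>y\<close> rather than
        adding it costs \<open>2 * R + 2\<close>.\<close>
      case False
      have "mdist G base y \<le> mdist G base x + mdist G x y" by (intro mdist_triangle base xG yG)
      then show ?thesis using False bx w(2) mdist_commute[of G x w] by linarith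
    qed
  qed
  moreover obtain k where "mdist G x y = real k" using dist_nat[OF _ yG] x SG by blast
  ultimately show ?thesis using x by blast
qed

text \<open>A geodesic from \<open>y\<close> to \<open>x\<close> only comes closer to
  \<open>x\<close>, hence stays in the ball of radius \<open>k\<close> around it and thus in
  \<open>W\<close>, where \<open>Q\<close> is passed on along edges in both directions.\<close>

lemma tube_step:
  assumes y: "y \<in> mspace G" and x: "x \<in> mspace G" and k: "mdist G y x = real k"
    and W: "\<And>z. z \<in> mspace G \<Longrightarrow> mdist G z x \<le> real k \<Longrightarrow> z \<in> W"
    and Q: "\<And>u v. u \<in> W \<Longrightarrow> v \<in> W \<Longrightarrow> mdist G u v \<le> 1 \<Longrightarrow> Q u \<Longrightarrow> Q v"
  shows "Q y \<longleftrightarrow> Q x"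
  using y k W
proof (induction k arbitrary: y)
  case 0
  then show ?case using x by auto
next
  case (Suc k)
  then obtain z where z: "z \<in> mspace G" "mdist G y z = 1" "mdist G z x = real k"
    using dist_step[OF Suc.prems(1) x] by (metis add_diff_cancel_right' mdist_refl of_nat_Suc of_nat_eq_0_iff
      add.commute nat.distinct(1))
  have W: "y \<in> W" "z \<in> W" using Suc.prems z by auto
  have "Q z \<longleftrightarrow> Q x" using Suc.prems(3) by (intro Suc.IH z) auto
  moreover have "Q y \<longleftrightarrow> Q z"
    using Q[OF W] Q[OF W(2,1)] z(2) mdist_commute[of G y z] by auto
  ultimately show ?case by simp
qed

text \<open>If a ray \<^term>\<open>\<gamma>\<close> running in an end \<^term>\<open>S\<close> missed points \<^term>\<open>t k\<close> of \<^term>\<open>S\<close> by arbitrarily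
  large distances, the tube around \<^term>\<open>\<gamma>\<close> whose radius grows slowly, but without bound, would trace out a
  proper subcontinuum with interior points of the part of the corona belonging to \<^term>\<open>S\<close>.\<close>
lemma ray_coarsely_dense:
  assumes S: "S \<subseteq> mspace G" and ind: "indecomposable_continuum (subtopology (higson_corona G) (corona_star G S))"
    and clopen: "openin (higson_corona G) (corona_star G S)"
    and \<gamma>: "ray \<gamma>" "\<And>n. real n > R \<Longrightarrow> \<gamma> n \<in> S"
  shows "\<exists>r. \<forall>x\<in>S. \<exists>n. mdist G x (\<gamma> n) \<le> r"
proof (rule ccontr)
  assume "\<not> ?thesis"
  then have "\<forall>k::nat. \<exists>x. x \<in> S \<and> (\<forall>n. mdist G x (\<gamma> n) > real k)" by (metis not_le)
  then obtain t where t: "\<And>k. t k \<in> S" "\<And>k n. mdist G (t k) (\<gamma> n) > real k" by metis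
  note P = proper
  have \<gamma>G: "\<gamma> n \<in> mspace G" "mdist G base (\<gamma> n) = real n" "mdist G (\<gamma> n) (\<gamma> (Suc n)) = 1" for n
    using \<gamma>(1) by (auto simp: ray_def)
  have tG: "t k \<in> mspace G" for k using t S by auto
  define T where "T = range t"
  define D where "D = (\<lambda>n. set_dist G T (\<gamma> n))"
  have T0: "T \<noteq> {}" and TG: "T \<subseteq> mspace G" and TS: "T \<subseteq> S" using tG t by (auto simp: T_def)
  have D_le: "D n \<le> mdist G (\<gamma> n) (t k)" for n k unfolding D_def by (rule set_dist_le) (simp add: T_def)
  have D0: "D n \<ge> 0" for n unfolding D_def by (rule set_dist_nonneg[OF T0])
  \<comment> \<open>\<open>t k\<close> is further than \<open>k\<close> from the whole ray, so only
    finitely many of these points can be close to it, and from those the ray moves away.\<close>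
  have D_large: "\<exists>N. \<forall>n\<ge>N. D n \<ge> c" for c
  proof -
    define K where "K = nat \<lceil>c\<rceil>"
    define L where "L = Max (insert 0 ((\<lambda>k. mdist G base (t k)) ` {..K}))"
    have "D n \<ge> c" if n: "n \<ge> nat \<lceil>c + L\<rceil>" for n
      unfolding D_def
    proof (rule set_dist_geI[OF T0])
      fix a assume "a \<in> T"
      then obtain k where k: "a = t k" by (auto simp: T_def)
      show "c \<le> mdist G (\<gamma> n) a"
      proof (cases "k \<le> K")
        case True
        then have "mdist G base (t k) \<le> L" unfolding L_def by (intro Max_ge) auto
        moreover have "mdist G base (\<gamma> n) \<le> mdist G base (t k) + mdist G (t k) (\<gamma> n)" by (intro mdist_triangle base tG \<gamma>G)
        moreover have "real n \<ge> c + L" using n by linarith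
        ultimately show ?thesis using k \<gamma>G(2) mdist_commute[of G "t k"] by simp
      next
        case False
        then have "real k \<ge> c" unfolding K_def by linarith
        then show ?thesis using t(2)[of k n] k mdist_commute[of G "t k"] by simp
      qed
    qed
    then show ?thesis by blast
  qed
  \<comment> \<open>The bound by \<open>D n\<close> keeps the tube away from the missed points, the
    bound by \<open>n\<close> keeps its far part away from bounded sets; the factor 1/3 leaves room
    in both estimates. The radius still tends to infinity.\<close>
  define r where "r = (\<lambda>n. min (real n) (D n) / 3)"
  have r0: "r n \<ge> 0" and r_n: "3 * r n \<le> real n" and r_D: "3 * r n \<le> D n" for n
    using D0[of n] by (auto simp: r_def)
  have r_large: "\<exists>N. \<forall>n\<ge>N. r n \<ge> c" for c
  proof -
    obtain N where N: "\<forall>n\<ge>N. D n \<ge> 3 * c" using D_large by blast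
    have "r n \<ge> c" if "n \<ge> max N (nat \<lceil>3 * c\<rceil>)" for n
    proof -
      have "real n \<ge> 3 * c" "D n \<ge> 3 * c" using that N by (linarith, auto)
      then show ?thesis by (simp add: r_def)
    qed
    then show ?thesis by blast
  qed
  define W where "W = {y \<in> mspace G. \<exists>n. mdist G y (\<gamma> n) \<le> r n}"
  define \<Gamma> where "\<Gamma> = range \<gamma>"
  have WG: "W \<subseteq> mspace G" and \<Gamma>G: "\<Gamma> \<subseteq> mspace G" and \<Gamma>0: "\<Gamma> \<noteq> {}" using \<gamma>G by (auto simp: W_def \<Gamma>_def)
  have \<Gamma>W: "\<Gamma> \<subseteq> W" 
  proof
    fix x assume "x \<in> \<Gamma>"
    then obtain n where "x = \<gamma> n" by (auto simp: \<Gamma>_def)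
    then show "x \<in> W" using r0[of n] \<gamma>G(1)[of n] by (auto simp: W_def intro!: exI[of _ n])
  qed
  have TW: "T \<inter> W = {}"
  proof -
    have False if "mdist G (t k) (\<gamma> n) \<le> r n" for k n
      using that r_D[of n] r0[of n] D_le[of n k] t(2)[of k n] mdist_commute[of G "t k" "\<gamma> n"] by linarith
    then show ?thesis by (auto simp: T_def W_def)
  qed
  let ?T = "higson_corona G" and ?K = "corona_star G W" and ?U = "corona_star G S"
  have conK: "connectedin ?T ?K"
  proof (rule corona_star_connected[OF P WG, where r = 1])
    fix B assume "bounded_subset G B"
    then obtain b0 where b0: "\<forall>x\<in>B. mdist G base x \<le> b0" using bounded_subset_iff_center[OF base] by blast
    define b where "b = max 0 b0"
    have b: "b \<ge> 0" "\<forall>x\<in>B. mdist G base x \<le> b" using b0 by (auto simp: b_def)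
    have main: "Q x \<longrightarrow> Q y"
      if Q: "\<forall>x\<in>W - B. \<forall>y\<in>W - B. mdist G x y \<le> 1 \<longrightarrow> Q x \<longrightarrow> Q y"
        and xy: "x \<in> W - mcball_of G base (2 * b)" "y \<in> W - mcball_of G base (2 * b)" for Q x y
    proof -
      have to_ray: "\<exists>n. real n > b \<and> (Q x \<longleftrightarrow> Q (\<gamma> n))" if x: "x \<in> W - mcball_of G base (2 * b)" for x
      proof -
        obtain n where n: "x \<in> mspace G" "mdist G x (\<gamma> n) \<le> r n" using x by (auto simp: W_def)
        have "mdist G base x > 2 * b" using x n base by auto
        moreover have "mdist G base x \<le> mdist G base (\<gamma> n) + mdist G (\<gamma> n) x" by (intro mdist_triangle base \<gamma>G n)
        ultimately have nb: "real n + r n > 2 * b" using n \<gamma>G(2) mdist_commute[of G x] by simp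
        obtain k where k: "mdist G x (\<gamma> n) = real k" using dist_nat[OF n(1) \<gamma>G(1)] by blast
        \<comment> \<open>From \<open>n + r n > 2 * b\<close> and \<open>r n \<le> n / 3\<close>
          follows \<open>n > 3 * b / 2\<close>, so everything within \<open>r n\<close> of
          \<open>\<gamma> n\<close> has height at least \<open>2 * n / 3 > b\<close> and avoids
          \<open>B\<close>. This is why the radius \<open>2 * b\<close> is removed.\<close>
        have "Q x \<longleftrightarrow> Q (\<gamma> n)"
        proof (rule tube_step[OF n(1) \<gamma>G(1) k, where W = "W - B"])
          fix z assume z: "z \<in> mspace G" "mdist G z (\<gamma> n) \<le> real k"
          have "mdist G base (\<gamma> n) \<le> mdist G base z + mdist G z (\<gamma> n)" by (intro mdist_triangle base \<gamma>G z)
          then have "mdist G base z > b" using z(2) k n(2) nb r_n[of n] \<gamma>G(2) b(1) by simp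
          then show "z \<in> W - B" using z k n(2) b(2) by (auto simp: W_def intro!: exI[of _ n])
        qed (use Q in blast)
        moreover have "real n > b" using nb r_n[of n] b(1) by linarith
        ultimately show ?thesis by blast
      qed
      have along: "Q (\<gamma> (n + k)) \<longleftrightarrow> Q (\<gamma> n)" if n: "real n > b" for n k
      proof (induction k)
        case (Suc k)
        have in_WB: "\<gamma> m \<in> W - B" if "real m > b" for m
          using \<Gamma>W b(2) \<gamma>G(2)[of m] that by (force simp: \<Gamma>_def)
        have "\<gamma> (n + k) \<in> W - B" "\<gamma> (n + Suc k) \<in> W - B" by (rule in_WB, use n in simp)+
        from Q[rule_format, OF this] Q[rule_format, OF this(2,1)]
        show ?case using Suc \<gamma>G(3)[of "n + k"] mdist_commute[of G "\<gamma> (n + k)"] by auto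
      qed simp
      obtain m where m: "real m > b" "Q x \<longleftrightarrow> Q (\<gamma> m)" using to_ray[OF xy(1)] by blast
      obtain n where n: "real n > b" "Q y \<longleftrightarrow> Q (\<gamma> n)" using to_ray[OF xy(2)] by blast
      have "Q (\<gamma> m) \<longleftrightarrow> Q (\<gamma> n)"
        using along[OF m(1), of "n - m"] along[OF n(1), of "m - n"] by (cases "m \<le> n") auto
      then show ?thesis using m n by blast
    qed
    show "\<exists>B'. bounded_subset G B' \<and>
      (\<forall>Q. (\<forall>x\<in>W - B. \<forall>y\<in>W - B. mdist G x y \<le> 1 \<longrightarrow> Q x \<longrightarrow> Q y) \<longrightarrow> (\<forall>x\<in>W - B'. \<forall>y\<in>W - B'. Q x \<longrightarrow> Q y))"
      by (intro exI[of _ "mcball_of G base (2 * b)"] conjI allI impI ballI bounded_subset_mcball)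
         (use main in blast)
  qed
  have bddG: "bounded_subset G A" if "A \<subseteq> mspace G" "\<And>x. x \<in> A \<Longrightarrow> mdist G base x \<le> c" for A c
    using that bounded_subset_iff_center[OF base] by blast
  have \<Gamma>_inf: "\<not> bounded_subset G \<Gamma>"
  proof
    assume "bounded_subset G \<Gamma>"
    then obtain c where "\<forall>x\<in>\<Gamma>. mdist G base x \<le> c" using bounded_subset_iff_center[OF base] by blast
    then have "real n \<le> c" for n using \<gamma>G(2) by (auto simp: \<Gamma>_def)
    then show False by (metis not_le reals_Archimedean2)
  qed
  have T_inf: "\<not> bounded_subset G T"
  proof
    assume "bounded_subset G T"
    then obtain c where "\<forall>x\<in>T. mdist G base x \<le> c" using bounded_subset_iff_center[OF base] by blast
    moreover have "real n < mdist G base (t n)" "t n \<in> T" for n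
      using t(2)[of n 0] \<gamma>(1) mdist_commute[of G base] by (auto simp: ray_def T_def)
    ultimately have "real n \<le> c" for n by (meson less_imp_le order_trans)
    then show False by (metis not_le reals_Archimedean2)
  qed
  \<comment> \<open>The unbounded radius makes the ray and the complement of the tube divergent; the
    separating function then yields interior points.\<close>
  have out: "bounded_subset G {x \<in> mspace G. (\<exists>a\<in>\<Gamma>. mdist G x a \<le> c) \<and> (\<exists>b\<in>mspace G - W. mdist G x b \<le> c)}" for c
  proof -
    obtain N where N: "\<forall>n\<ge>N. r n \<ge> 2 * c" using r_large by blast
    show ?thesis
    proof (rule bddG[where c = "real N + c"])
      fix x assume "x \<in> {x \<in> mspace G. (\<exists>a\<in>\<Gamma>. mdist G x a \<le> c) \<and> (\<exists>b\<in>mspace G - W. mdist G x b \<le> c)}"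
      then obtain n y where x: "x \<in> mspace G" "mdist G x (\<gamma> n) \<le> c" "y \<in> mspace G" "y \<notin> W" "mdist G x y \<le> c"
        by (auto simp: \<Gamma>_def)
      have "mdist G y (\<gamma> n) \<le> mdist G y x + mdist G x (\<gamma> n)" by (intro mdist_triangle x \<gamma>G)
      then have "mdist G y (\<gamma> n) \<le> 2 * c" using x mdist_commute[of G x y] by linarith
      moreover have "mdist G y (\<gamma> n) > r n" using x(3,4) unfolding W_def not_le[symmetric] by blast
      ultimately have "n < N" using N by (metis less_le_trans not_le)
      moreover have "mdist G base x \<le> mdist G base (\<gamma> n) + mdist G (\<gamma> n) x" by (intro mdist_triangle base x \<gamma>G)
      ultimately show "mdist G base x \<le> real N + c" using x(2) \<gamma>G(2)[of n] mdist_commute[of G x] by simp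
    qed auto
  qed
  \<comment> \<open>A point within \<open>c\<close> of both sets would give
    \<open>D n \<le> r n + 2 * c\<close> with \<open>r n \<le> D n / 3\<close>, hence
    \<open>D n \<le> 3 * c\<close>, which fails for large \<open>n\<close>.\<close>
  have div: "bounded_subset G {x \<in> mspace G. (\<exists>a\<in>W. mdist G x a \<le> c) \<and> (\<exists>b\<in>T. mdist G x b \<le> c)}" for c
  proof -
    obtain N where N: "\<forall>n\<ge>N. D n \<ge> 3 * c + 1" using D_large by blast
    show ?thesis
    proof (rule bddG[where c = "2 * real N + c"])
      fix x assume "x \<in> {x \<in> mspace G. (\<exists>a\<in>W. mdist G x a \<le> c) \<and> (\<exists>b\<in>T. mdist G x b \<le> c)}"
      then obtain w u where "x \<in> mspace G" "w \<in> W" "mdist G x w \<le> c" "u \<in> T" "mdist G x u \<le> c" by blast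
      moreover from \<open>w \<in> W\<close> obtain n where "w \<in> mspace G" "mdist G w (\<gamma> n) \<le> r n" by (auto simp: W_def)
      moreover from \<open>u \<in> T\<close> obtain k where "u = t k" by (auto simp: T_def)
      ultimately have x: "x \<in> mspace G" "w \<in> mspace G" "mdist G w (\<gamma> n) \<le> r n" "mdist G x w \<le> c"
        "mdist G x (t k) \<le> c" by simp_all
      have xg: "mdist G (\<gamma> n) x \<le> mdist G (\<gamma> n) w + mdist G w x" by (intro mdist_triangle x \<gamma>G)
      have "mdist G (\<gamma> n) (t k) \<le> mdist G (\<gamma> n) x + mdist G x (t k)" by (intro mdist_triangle x \<gamma>G tG)
      then have "D n \<le> r n + 2 * c"
        using xg D_le[of n k] x mdist_commute[of G x w] mdist_commute[of G w "\<gamma> n"] by linarith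
      then have "D n < 3 * c + 1" using r_D[of n] by linarith
      then have "n < N" using N by (metis not_le)
      moreover have "mdist G base x \<le> mdist G base (\<gamma> n) + mdist G (\<gamma> n) x" by (intro mdist_triangle base x \<gamma>G)
      ultimately show "mdist G base x \<le> 2 * real N + c"
        using xg x(3,4) r_n[of n] \<gamma>G(2)[of n] mdist_commute[of G x w] mdist_commute[of G w "\<gamma> n"] by linarith
    qed auto
  qed
  obtain \<phi> where so: "slowly_oscillating G \<phi>"
    and \<phi>: "\<forall>\<^sub>F x in at_inf G. (x \<in> \<Gamma> \<longrightarrow> \<phi> x = 0) \<and> (x \<in> mspace G - W \<longrightarrow> \<phi> x = 1)"
    using TW TG T0 by (rule_tac divergent_separation[OF \<Gamma>0 \<Gamma>G _ _ out]) auto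
  have \<phi>0: "\<forall>\<^sub>F x in at_inf G. x \<in> \<Gamma> \<longrightarrow> \<phi> x = 0" using \<phi> by (auto elim: eventually_mono)
  \<comment> \<open>Below 1/2 the function cannot come from the complement of \<open>W\<close>,
    where it is 1; so \<open>V\<close> is an open subset of the trace of the tube, and it contains
    the limit points of the ray.\<close>
  define V where "V = {p \<in> corona_set G. corona_value G p \<phi> \<in> {..<1/2}}"
  have opV: "openin ?T V"
    using openin_continuous_map_preimage[OF continuous_map_corona_value[OF P so], of "{..<1/2}"]
    by (simp add: V_def topspace_higson_corona[OF P] flip: open_openin)
  have VK: "V \<subseteq> ?K"
  proof
    fix p assume "p \<in> V"
    then have p: "p \<in> corona_set G" "corona_value G p \<phi> < 1/2" by (auto simp: V_def)
    have "\<forall>\<^sub>F x in corona_filter G p. x \<in> W"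
      using corona_value_eventually_less[OF P p(1) so p(2)] eventually_corona_filter[OF \<phi>]
        eventually_corona_filter[OF eventually_at_inf_mspace]
      by eventually_elim auto
    then show "p \<in> ?K" by (rule corona_star_eventually[OF p(1)])
  qed
  obtain p where p: "p \<in> corona_star G \<Gamma>" using corona_star_nonempty[OF \<Gamma>G \<Gamma>_inf] by blast
  have pV: "p \<in> V"
    using corona_value_on_star[OF P so \<phi>0 p] p corona_star_subset by (force simp: V_def)
  have pU: "p \<in> ?U"
  proof -
    have "\<forall>\<^sub>F x in at_inf G. x \<in> \<Gamma> \<longrightarrow> x \<in> S"
      unfolding eventually_at_inf_dist[OF base] using \<gamma>(2) \<gamma>G(2) by (intro exI[of _ R]) (auto simp: \<Gamma>_def)
    from corona_star_cong[OF this] show ?thesis using p by blast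
  qed
  obtain q where q: "q \<in> corona_star G T" using corona_star_nonempty[OF TG T_inf] by blast
  have qU: "q \<in> ?U" using q corona_star_mono[OF TS] by blast
  \<comment> \<open>A limit point of the missed points lies in the part of \<open>S\<close> but
    outside the trace of the tube, which is therefore a proper subset.\<close>
  have qK: "q \<notin> ?K"
    using corona_star_disjoint[OF P _ WG T0 TG div] \<Gamma>W \<Gamma>0 q by blast
  have "closedin ?T ?U" by (rule closedin_higson_corona_star[OF P])
  \<comment> \<open>The trace of the tube is connected and meets the clopen part belonging to
    \<open>S\<close>, so it cannot leave that part.\<close>
  then have KU: "?K \<subseteq> ?U"
    using connectedin_clopen_cases[OF conK _ clopen] pV VK pU by (auto simp: disjnt_def)
  have Utop: "?U \<subseteq> topspace ?T" by (simp add: topspace_higson_corona[OF P] corona_star_subset)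
  have "decomposable_space (subtopology ?T ?U)"
  proof (rule decomposable_spaceI)
    show "continuum_space (subtopology ?T ?U)" using ind by (simp add: indecomposable_continuum_def)
    show "closedin (subtopology ?T ?U) ?K"
      using KU closedin_higson_corona_star[OF P] by (auto intro: closedin_subset_topspace)
    show "connectedin (subtopology ?T ?U) ?K" using conK KU by (simp add: connectedin_subtopology)
    show "?K \<noteq> topspace (subtopology ?T ?U)" using qU qK Utop by auto
    show "openin (subtopology ?T ?U) (V \<inter> ?U)" using opV by (simp add: openin_subtopology_Int)
    show "V \<inter> ?U \<noteq> {}" using pV pU by blast
    show "V \<inter> ?U \<subseteq> ?K" using VK by blast
  qed
  then show False using ind by (simp add: indecomposable_continuum_def)
qed

text \<open>The function separating the two clopen parts provides two disjoint coherent sets that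
  cover the graph outside a ball. A coarsely dense ray in each of them gives one half of the
  integers.\<close>

lemma coarsely_equivalent_int:
  assumes U: "openin (higson_corona G) U" "closedin (higson_corona G) U"
    and ind: "indecomposable_continuum (subtopology (higson_corona G) U)"
      "indecomposable_continuum (subtopology (higson_corona G) (topspace (higson_corona G) - U))"
  shows "coarsely_equivalent int_metric G"
proof -
  note P = proper
  let ?T = "higson_corona G"
  have top: "topspace ?T = corona_set G" by (rule topspace_higson_corona[OF P])
  have UT: "U \<subseteq> corona_set G" using openin_subset[OF U(1)] top by simp
  have cl: "closedin ?T (corona_set G - U)" using closedin_diff[OF closedin_topspace U(1)] by (simp only: top)
  have op: "openin ?T (corona_set G - U)" using U(2) by (simp add: closedin_def flip: top)
  have "U \<inter> (corona_set G - U) = {}" by blast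
  from corona_Urysohn[OF P U(2) cl this]
  obtain \<phi> where so: "slowly_oscillating G \<phi>" and \<phi>U: "\<And>p. p \<in> U \<Longrightarrow> corona_value G p \<phi> = 0"
    and \<phi>V: "\<And>p. p \<in> corona_set G - U \<Longrightarrow> corona_value G p \<phi> = 1"
    by metis
  \<comment> \<open>The gap of width 1/3 between the two sets is what a single edge far out cannot
    bridge.\<close>
  define S0 where "S0 = {x \<in> mspace G. \<phi> x < 1/3}"
  define S1 where "S1 = {x \<in> mspace G. \<phi> x > 2/3}"
  have near0: "\<forall>\<^sub>F x in corona_filter G p. x \<in> S0" if "p \<in> U" for p
    using corona_value_eventually_less[OF P _ so, where p = p and c = "1/3"] \<phi>U[OF that] that UT
      eventually_corona_filter[OF eventually_at_inf_mspace, where p = p]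
    by (auto simp: S0_def intro!: eventually_conj)
  have near1: "\<forall>\<^sub>F x in corona_filter G p. x \<in> S1" if "p \<in> corona_set G - U" for p
    using corona_value_eventually_greater[OF P _ so, where p = p and c = "2/3"] \<phi>V[OF that] that
      eventually_corona_filter[OF eventually_at_inf_mspace, where p = p]
    by (auto simp: S1_def intro!: eventually_conj)
  have S0G: "S0 \<subseteq> mspace G" and S1G: "S1 \<subseteq> mspace G" by (auto simp: S0_def S1_def)
  have disj: "S0 \<inter> S1 = {}" by (auto simp: S0_def S1_def)
  have notin: "p \<notin> corona_star G A" if ev: "\<forall>\<^sub>F x in corona_filter G p. x \<in> B" and AB: "A \<inter> B = {}" for p A B
  proof -
    have "\<forall>\<^sub>F x in corona_filter G p. x \<notin> A" using ev by (rule eventually_mono) (use AB in blast)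
    then show ?thesis by (simp add: corona_star_def frequently_def)
  qed
  have star0: "corona_star G S0 = U"
  proof (intro equalityI subsetI)
    fix p assume p: "p \<in> corona_star G S0"
    show "p \<in> U"
    proof (rule ccontr)
      assume "p \<notin> U"
      then have "p \<in> corona_set G - U" using p corona_star_subset by blast
      from notin[OF near1[OF this] disj] show False using p by blast
    qed
  qed (use UT near0 corona_star_eventually in blast)
  have star1: "corona_star G S1 = corona_set G - U"
  proof (intro equalityI subsetI)
    fix p assume p: "p \<in> corona_star G S1"
    have "S1 \<inter> S0 = {}" using disj by blast
    then have "p \<notin> U" using notin[OF near0 _] p by metis
    then show "p \<in> corona_set G - U" using p corona_star_subset by blast
  qed (use near1 corona_star_eventually in blast)
  have ne: "U \<noteq> {}" "corona_set G - U \<noteq> {}"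
    using ind by (auto simp: indecomposable_continuum_def continuum_space_def top)
  have inf: "infinite S0" "infinite S1"
  proof -
    have "corona_star G A = {}" if "A \<subseteq> mspace G" "finite A" for A
    proof -
      have "\<forall>\<^sub>F x in at_inf G. x \<notin> A"
        using that by (auto simp: eventually_at_inf bounded_subset_iff_finite)
      then have "\<forall>\<^sub>F x in corona_filter G p. x \<notin> A" for p by (rule eventually_corona_filter)
      then show ?thesis by (auto simp: corona_star_def frequently_def)
    qed
    then show "infinite S0" "infinite S1" using star0 star1 ne by (auto simp: S0_def S1_def)
  qed
  \<comment> \<open>Every corona point eventually sees one of the two sets, so no point sees the
    remaining vertices; a set without trace is bounded.\<close>
  have "\<forall>\<^sub>F x in at_inf G. x \<in> S0 \<union> S1"
  proof -
    have "corona_star G (mspace G - (S0 \<union> S1)) = {}"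
    proof -
      have "p \<notin> corona_star G (mspace G - (S0 \<union> S1))" if "p \<in> corona_set G" for p
      proof (cases "p \<in> U")
        case True
        show ?thesis by (rule notin[OF near0[OF True]]) blast
      next
        case False
        with that have "p \<in> corona_set G - U" by blast
        then show ?thesis by (intro notin[OF near1]) blast+
      qed
      then show ?thesis using corona_star_subset[of G "mspace G - (S0 \<union> S1)"] by auto
    qed
    then have "bounded_subset G (mspace G - (S0 \<union> S1))"
      using corona_star_nonempty[of "mspace G - (S0 \<union> S1)" G] by auto
    then show ?thesis unfolding eventually_at_inf by (intro exI conjI) auto
  qed
  moreover have "\<forall>\<^sub>F x in at_inf G. \<forall>y\<in>mspace G. mdist G x y \<le> 1 \<longrightarrow> \<bar>\<phi> x - \<phi> y\<bar> < 1/3"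
    by (rule slowly_oscillatingD[OF so]) simp
  ultimately have "\<forall>\<^sub>F x in at_inf G. x \<in> S0 \<union> S1 \<and> (\<forall>y\<in>mspace G. mdist G x y \<le> 1 \<longrightarrow> \<bar>\<phi> x - \<phi> y\<bar> < 1/3)"
    by (rule eventually_conj)
  then obtain R0 where R0: "\<forall>x\<in>mspace G. mdist G base x > R0 \<longrightarrow>
      x \<in> S0 \<union> S1 \<and> (\<forall>y\<in>mspace G. mdist G x y \<le> 1 \<longrightarrow> \<bar>\<phi> x - \<phi> y\<bar> < 1/3)"
    unfolding eventually_at_inf_dist[OF base] by blast
  define R where "R = max 0 R0"
  have R: "R \<ge> 0" "\<And>x. x \<in> mspace G \<Longrightarrow> mdist G base x > R \<Longrightarrow> x \<in> S0 \<union> S1"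
    "\<And>x y. x \<in> mspace G \<Longrightarrow> mdist G base x > R \<Longrightarrow> y \<in> mspace G \<Longrightarrow> mdist G x y \<le> 1 \<Longrightarrow> \<bar>\<phi> x - \<phi> y\<bar> < 1/3"
    using R0 by (auto simp: R_def)
  have coh0: "coherent R S0"
    unfolding coherent_def
  proof (intro conjI ballI impI)
    show "S0 \<subseteq> mspace G" by (auto simp: S0_def)
    fix x y assume "x \<in> S0" "y \<in> mspace G" "mdist G base x > R" "mdist G base y > R" "mdist G x y \<le> 1"
    then show "y \<in> S0" using R(2)[of y] R(3)[of x y] by (auto simp: S0_def S1_def)
  qed
  have coh1: "coherent R S1"
    unfolding coherent_def
  proof (intro conjI ballI impI)
    show "S1 \<subseteq> mspace G" by (auto simp: S1_def)
    fix x y assume "x \<in> S1" "y \<in> mspace G" "mdist G base x > R" "mdist G base y > R" "mdist G x y \<le> 1"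
    then show "y \<in> S1" using R(2)[of y] R(3)[of x y] by (auto simp: S0_def S1_def)
  qed
  obtain \<gamma>0 where \<gamma>0: "ray \<gamma>0" "\<And>n. real n > R \<Longrightarrow> \<gamma>0 n \<in> S0" using coherent_ray_exists[OF coh0 inf(1)] by metis
  obtain \<gamma>1 where \<gamma>1: "ray \<gamma>1" "\<And>n. real n > R \<Longrightarrow> \<gamma>1 n \<in> S1" using coherent_ray_exists[OF coh1 inf(2)] by metis
  have "\<exists>r. \<forall>x\<in>S0. \<exists>n. mdist G x (\<gamma>0 n) \<le> r"
    by (rule ray_coarsely_dense[OF S0G _ _ \<gamma>0]) (simp_all add: star0 ind(1) U(1))
  then obtain r0 where r0: "\<forall>x\<in>S0. \<exists>n. mdist G x (\<gamma>0 n) \<le> r0" by blast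
  have "\<exists>r. \<forall>x\<in>S1. \<exists>n. mdist G x (\<gamma>1 n) \<le> r"
    by (rule ray_coarsely_dense[OF S1G _ _ \<gamma>1]) (use ind(2) op in \<open>simp_all add: star1 top\<close>)
  then obtain r1 where r1: "\<forall>x\<in>S1. \<exists>n. mdist G x (\<gamma>1 n) \<le> r1" by blast
  have ray0: "\<gamma>0 n \<in> mspace G" "mdist G base (\<gamma>0 n) = real n" "\<gamma>0 0 = base" for n using \<gamma>0(1) by (auto simp: ray_def)
  have ray1: "\<gamma>1 n \<in> mspace G" "mdist G base (\<gamma>1 n) = real n" "\<gamma>1 0 = base" for n using \<gamma>1(1) by (auto simp: ray_def)
  \<comment> \<open>When both indices exceed \<open>R\<close> the lower bound is the cost of passing
    through the ball; otherwise the difference of the two heights already gives it.\<close>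
  have cross: "real m + real n - 2 * R - 2 \<le> mdist G (\<gamma>0 m) (\<gamma>1 n)" "mdist G (\<gamma>0 m) (\<gamma>1 n) \<le> real m + real n" for m n
  proof -
    have tri: "mdist G (\<gamma>0 m) (\<gamma>1 n) \<le> mdist G (\<gamma>0 m) base + mdist G base (\<gamma>1 n)"
      "mdist G base (\<gamma>1 n) \<le> mdist G base (\<gamma>0 m) + mdist G (\<gamma>0 m) (\<gamma>1 n)"
      "mdist G base (\<gamma>0 m) \<le> mdist G base (\<gamma>1 n) + mdist G (\<gamma>1 n) (\<gamma>0 m)"
      by (intro mdist_triangle base ray0 ray1)+
    show "mdist G (\<gamma>0 m) (\<gamma>1 n) \<le> real m + real n"
      using tri(1) ray0(2) ray1(2) mdist_commute[of G base "\<gamma>0 m"] by simp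
    show "real m + real n - 2 * R - 2 \<le> mdist G (\<gamma>0 m) (\<gamma>1 n)"
    proof (cases "real m > R \<and> real n > R")
      case True
      then show ?thesis
        using coherent_disjoint_dist[OF coh0 disj S1G, of "\<gamma>0 m" "\<gamma>1 n"] \<gamma>0(2) \<gamma>1(2) ray0(2) ray1(2) by simp
    next
      case False
      then show ?thesis
        using tri(2,3) ray0(2)[of m] ray1(2)[of n] mdist_commute[of G "\<gamma>0 m" "\<gamma>1 n"] by auto
    qed
  qed
  define h where "h = (\<lambda>i::int. if i \<ge> 0 then \<gamma>0 (nat i) else \<gamma>1 (nat (- i)))"
  have hG: "h i \<in> mspace G" for i using ray0 ray1 by (simp add: h_def)
  \<comment> \<open>Each ray is geodesic and both start at the base point, so a defect arises only
    between different rays and is at most \<open>2 * R + 2\<close>.\<close>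
  have h_dist: "mdist G (h i) (h j) \<le> \<bar>real_of_int i - real_of_int j\<bar> \<and>
      \<bar>real_of_int i - real_of_int j\<bar> - 2 * R - 2 \<le> mdist G (h i) (h j)" for i j
  proof -
    consider "i \<ge> 0" "j \<ge> 0" | "i < 0" "j < 0" | "i \<ge> 0" "j < 0" | "i < 0" "j \<ge> 0" by linarith
    then show ?thesis
    proof cases
      case 1
      then show ?thesis using R(1) by (simp add: h_def ray_dist[OF \<gamma>0(1)])
    next
      case 2
      then show ?thesis using R(1) by (simp add: h_def ray_dist[OF \<gamma>1(1)] abs_minus_commute)
    next
      case 3
      then show ?thesis using cross[of "nat i" "nat (- j)"] by (simp add: h_def)
    next
      case 4
      then show ?thesis using cross[of "nat j" "nat (- i)"] mdist_commute[of G "\<gamma>1 (nat (- i))"]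
        by (simp add: h_def)
    qed
  qed
  have "coarse_embedding int_metric G h"
    unfolding coarse_embedding_def bornologous_def
  proof (intro conjI allI)
    show "h \<in> mspace int_metric \<rightarrow> mspace G" using hG by simp
    show "\<exists>s. \<forall>x\<in>mspace int_metric. \<forall>x'\<in>mspace int_metric. mdist int_metric x x' \<le> r \<longrightarrow> mdist G (h x) (h x') \<le> s" for r
    proof (intro exI ballI impI)
      fix x x' assume "mdist int_metric x x' \<le> r"
      then show "mdist G (h x) (h x') \<le> r" using h_dist[of x x'] by simp
    qed
    show "\<exists>r. \<forall>x\<in>mspace int_metric. \<forall>x'\<in>mspace int_metric. mdist G (h x) (h x') \<le> s \<longrightarrow> mdist int_metric x x' \<le> r" for s
    proof (intro exI ballI impI)
      fix x x' assume "mdist G (h x) (h x') \<le> s"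
      then show "mdist int_metric x x' \<le> s + 2 * R + 2" using h_dist[of x x'] by simp
    qed
  qed
  moreover have "coarsely_onto int_metric G h"
    unfolding coarsely_onto_def
  proof (intro exI ballI)
    fix x assume x: "x \<in> mspace G"
    have h0: "h (int n) = \<gamma>0 n" for n by (simp add: h_def)
    have h1: "h (- int n) = \<gamma>1 n" for n using ray0(3) ray1(3) by (simp add: h_def)
    consider "mdist G base x \<le> R" | "x \<in> S0" | "x \<in> S1" using R(2)[OF x] by fastforce
    then show "\<exists>i\<in>mspace int_metric. mdist G (h i) x \<le> max R (max r0 r1)"
    proof cases
      case 1
      then show ?thesis using h0[of 0] ray0(3) by (intro bexI[of _ 0]) (auto simp: h_def)
    next
      case 2
      then obtain n where "mdist G x (\<gamma>0 n) \<le> r0" using r0 by blast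
      then show ?thesis using h0[of n] by (intro bexI[of _ "int n"]) (auto simp: mdist_commute)
    next
      case 3
      then obtain n where "mdist G x (\<gamma>1 n) \<le> r1" using r1 by blast
      then show ?thesis using h1[of n] by (intro bexI[of _ "- int n"]) (auto simp: mdist_commute)
    qed
  qed
  ultimately show ?thesis by (rule coarsely_equivalentI)
qed

end

theorem theorem3p12:
  fixes X :: "'a metric"
  assumes "proper_metric X" and "\<not> compact_space (mtopology_of X)"
  shows "coarsely_equivalent X int_metric \<longleftrightarrow>
    (coarsely_geodesic X \<and> coarse_bounded_geometry X) \<and>
    (\<exists>C :: bool \<Rightarrow> (('a \<Rightarrow> real) \<Rightarrow> real) topology.
       higson_corona X homeomorphic_space sum_topology C UNIV \<and>
       (\<forall>i. indecomposable_continuum (C i) \<and>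
            C i homeomorphic_space higson_corona nat_metric))"
proof
  assume eq: "coarsely_equivalent X int_metric"
  obtain C :: "bool \<Rightarrow> (('a \<Rightarrow> real) \<Rightarrow> real) topology"
    where C: "higson_corona X homeomorphic_space sum_topology C UNIV"
      "\<And>i. C i homeomorphic_space higson_corona nat_metric"
    using higson_corona_if_int[OF assms(1) eq] by blast
  have "indecomposable_continuum (C i)" for i
    using indecomposable_continuum_homeomorphic[OF _ corona_nat_indecomposable] C(2) homeomorphic_space_sym by blast
  then show "(coarsely_geodesic X \<and> coarse_bounded_geometry X) \<and>
    (\<exists>C :: bool \<Rightarrow> (('a \<Rightarrow> real) \<Rightarrow> real) topology.
       higson_corona X homeomorphic_space sum_topology C UNIV \<and>
       (\<forall>i. indecomposable_continuum (C i) \<and> C i homeomorphic_space higson_corona nat_metric))"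
    using C coarsely_geodesic_if_int[OF eq] coarse_bounded_geometry_if_int[OF eq] by blast
next
  assume R: "(coarsely_geodesic X \<and> coarse_bounded_geometry X) \<and>
    (\<exists>C :: bool \<Rightarrow> (('a \<Rightarrow> real) \<Rightarrow> real) topology.
       higson_corona X homeomorphic_space sum_topology C UNIV \<and>
       (\<forall>i. indecomposable_continuum (C i) \<and> C i homeomorphic_space higson_corona nat_metric))"
  then obtain C :: "bool \<Rightarrow> (('a \<Rightarrow> real) \<Rightarrow> real) topology"
    where C: "higson_corona X homeomorphic_space sum_topology C UNIV" "\<And>i. indecomposable_continuum (C i)"
    by blast
  obtain G :: "'a metric" where G: "\<And>x r. finite (mcball_of G x r)" "discretely_geodesic G"
    and XG: "coarsely_equivalent X G"
    using coarsely_geodesic_discretisation R by metis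
  \<comment> \<open>Non-compactness enters here, to provide a base point for the graph.\<close>
  have "mspace X \<noteq> {}"
  proof
    assume "mspace X = {}"
    then have "compact_space (mtopology_of X)" by (simp add: compact_space_def)
    then show False using assms(2) by simp
  qed
  moreover obtain f where "coarse_embedding X G f"
    using XG coarse_equivalence_imp unfolding coarsely_equivalent_def by blast
  ultimately obtain a where "a \<in> mspace G" by (auto simp: coarse_embedding_def bornologous_def)
  then interpret geodesic_graph G a
    using G by unfold_locales
  \<comment> \<open>The graph replaces \<open>X\<close>: coarse invariance carries the sum
    decomposition over to its corona.\<close>
  have "higson_corona G homeomorphic_space sum_topology C UNIV"
    using higson_corona_coarse_invariant[OF assms(1) proper XG] C(1) homeomorphic_space_sym homeomorphic_space_trans by blast
  then obtain U where U: "openin (higson_corona G) U" "closedin (higson_corona G) U"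
    "subtopology (higson_corona G) U homeomorphic_space C True"
    "subtopology (higson_corona G) (topspace (higson_corona G) - U) homeomorphic_space C False"
    by (rule homeomorphic_sum_parts)
  have "coarsely_equivalent int_metric G"
    using U indecomposable_continuum_homeomorphic[OF _ C(2)] homeomorphic_space_sym
    by (intro coarsely_equivalent_int[OF U(1,2)]) blast+
  then show "coarsely_equivalent X int_metric"
    using XG coarsely_equivalent_sym coarsely_equivalent_trans by blast
qed

end
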